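(* Let $I$ be either $\mathbb Z$, or $\{1,\ldots,n\}$ for some $n\ge 3$ (interpreted as the vertex set of a cycle). Let $X=(X_i)_{i\in I}$ be the 1-dependent 4-coloring of $I$ and let $Y=(Y_i)_{i\in I}$ be the 2-dependent 3-coloring of $I$ (both defined in the context). All indices are interpreted modulo $n$ in the cycle case. Then: (i) The process $(\mathbf 1[X_i\in\{1,2\}])_{i\in I}$ is equal in law to $(\mathbf 1[U_i>U_{i+1}])_{i\in I}$, where $(U_i)_{i\in I}$ are i.i.d. uniform on $[0,1]$. (ii) The process $(\mathbf 1[Y_i=1])_{i\in I}$ is equal in law to $(\mathbf 1[U_{i-1}<U_i>U_{i+1}])_{i\in I}$, where $(U_i)_{i\in I}$ are i.i.d. uniform on $[0,1]$. (iii) The process $(\mathbf 1[X_i=1])_{i\in I}$ is equal in law to $(\mathbf 1[B_i>B_{i+1}])_{i\in I}$, where $(B_i)_{i\in I}$ are i.i.d. taking values $0,1$ with equal probabilities.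
   Context: **Case $I=\mathbb Z$ (Holroyd–Liggett colorings).** A word $x=x_1\cdots x_m\in\{1,\ldots,q\}^m$ is proper if $x_i\ne x_{i+1}$ for all $1\le i\le m-1$. Write $\hat x_i$ for the word of length $m-1$ obtained from $x$ by deleting its $i$-th letter. Define $\vec B(\emptyset)=1$ for the empty word and recursively $$\vec B(x)=\mathbf 1[x\text{ is proper}]\sum_{i=1}^m\vec B(\hat x_i),\qquad m\ge 1,\ x\in\{1,\ldots,q\}^m,$$ and let $\vec Z(m,q)=\sum_{y\in\{1,\ldots,q\}^m}\vec B(y)$. For $(k,q)\in\{(1,4),(2,3)\}$, the $k$-dependent $q$-coloring of $\mathbb Z$ is the stationary process $(W_i)_{i\in\mathbb Z}$ whose law is characterized by $\mathbb P\bigl((W_1,\ldots,W_m)=x\bigr)=\vec B(x)/\vec Z(m,q)$ for all $m\ge 0$ and $x\in\{1,\ldots,q\}^m$. **Case $I=\{1,\ldots,n\}$, $n\ge3$ (cycle).** For $(k,q)\in\{(1,4),(2,3)\}$, the $k$-dependent $q$-coloring of the $n$-cycle is the random sequence $(C_1,\ldots,C_n)$ obtained as follows. Let $\mathbb T$ be the infinite 3-regular tree with a distinguished root vertex, embedded in the plane, and let $\mathbb D$ be its planar dual, an infinite-degree triangulation. For a vertex $v$ of $\mathbb T$, let $\Delta(v)$ be the set of the three vertices of $\mathbb D$ incident to the (triangular) face of $\mathbb D$ dual to $v$. Define random clusters $T_1,T_2,\ldots$ of vertices of $\mathbb T$: $T_1$ consists of the root; given $T_m$, choose a vertex uniformly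 at random from those adjacent to but not lying in $T_m$, and add it to $T_m$ to form $T_{m+1}$. Let $D_m$ be the subgraph of $\mathbb D$ induced by $\bigcup_{v\in T_m}\Delta(v)$; it inherits a planar embedding with one outer face containing all of its $m+2$ vertices, all other faces being triangles. Take $m=n-2$. Conditional on $D_{n-2}$, choose a uniformly random proper $q$-coloring of $D_{n-2}$ and, independently, a uniformly random vertex $u$ of $D_{n-2}$. Let $C_1,\ldots,C_n$ be the sequence of colors of the vertices of the outer face in clockwise order starting from $u$. Equivalently (in law), this is the following necklace insertion procedure: start with a cyclic necklace of 3 beads with uniformly random distinct colors from $\{1,\ldots,q\}$; at each of $n-3$ steps, choose a uniformly random gap between consecutive beads and insert there a bead whose color is uniformly random among the colors different from those of its two neighbors; finally read the $n$ colors in clockwise order starting from an independent uniformly random bead. *)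

theory Defs
  imports "HOL-Probability.Probability"
begin

section \<open>Index sets\<close>

datatype index_set = Integers | Cycle nat

fun indices :: "index_set \<Rightarrow> int set" where
  "indices Integers = UNIV"
| "indices (Cycle n) = {1..int n}"

text \<open>The index denoted by an integer: indices of the cycle are read modulo \<open>n\<close>, with
  representatives \<open>1, \<dots>, n\<close>.\<close>

fun idx :: "index_set \<Rightarrow> int \<Rightarrow> int" where
  "idx Integers j = j"
| "idx (Cycle n) j = (j - 1) mod int n + 1"


section \<open>Laws of processes\<close>

definition law :: "index_set \<Rightarrow> 'a measure \<Rightarrow> 'b measure \<Rightarrow> (int \<Rightarrow> 'a \<Rightarrow> 'b) \<Rightarrow> (int \<Rightarrow> 'b) measure" where
  "law I M S W = distr M (PiM (indices I) (\<lambda>_. S)) (\<lambda>\<omega>. \<lambda>i\<in>indices I. W i \<omega>)"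

definition iid_process :: "index_set \<Rightarrow> 'a measure \<Rightarrow> 'b measure \<Rightarrow> (int \<Rightarrow> 'a \<Rightarrow> 'b) \<Rightarrow> bool" where
  "iid_process I M D W \<longleftrightarrow>
     prob_space M \<and>
     prob_space.indep_vars M (\<lambda>_. D) W (indices I) \<and>
     (\<forall>i\<in>indices I. distr M D (W i) = D)"

definition uniform01 :: "real measure" where
  "uniform01 = uniform_measure lborel {0..1}"

definition fair_bit :: "nat measure" where
  "fair_bit = measure_pmf (pmf_of_set {0, 1})"


section \<open>Colorings of the integers\<close>

fun B :: "nat list \<Rightarrow> nat" where
  "B x = (if x = [] then 1
          else if distinct_adj x then \<Sum>i<length x. B (take i x @ drop (Suc i) x)
          else 0)"

declare B.simps [simp del]

definition words :: "nat \<Rightarrow> nat \<Rightarrow> nat list set" where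
  "words m q = {x. length x = m \<and> set x \<subseteq> {1..q}}"

definition Z :: "nat \<Rightarrow> nat \<Rightarrow> nat" where
  "Z m q = (\<Sum>y\<in>words m q. B y)"

definition stationary :: "'a measure \<Rightarrow> 'b measure \<Rightarrow> (int \<Rightarrow> 'a \<Rightarrow> 'b) \<Rightarrow> bool" where
  "stationary M S W \<longleftrightarrow> (\<forall>t. law Integers M S (\<lambda>i. W (i + t)) = law Integers M S W)"

text \<open>The construction depends on \<open>q\<close> only; the range of dependence is a property of the result
  (\<open>k = 1\<close> for \<open>q = 4\<close> and \<open>k = 2\<close> for \<open>q = 3\<close>).\<close>

definition integer_coloring :: "nat \<Rightarrow> 'a measure \<Rightarrow> (int \<Rightarrow> 'a \<Rightarrow> nat) \<Rightarrow> bool" where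
  "integer_coloring q M W \<longleftrightarrow>
     prob_space M \<and>
     (\<forall>i. W i \<in> measurable M (count_space UNIV)) \<and>
     stationary M (count_space UNIV) W \<and>
     (\<forall>m. \<forall>x\<in>words m q.
        measure M {\<omega> \<in> space M. map (\<lambda>i. W i \<omega>) [1..int m] = x} = real (B x) / real (Z m q))"


section \<open>The 3-regular tree and its planar dual\<close>

text \<open>
  The tree is the Cayley graph of the free product of three copies of the group of order 2: its
  vertices are the words over three letters without equal neighboring letters, the root being the
  empty word. Words are stored in reverse, so that multiplying by a letter acts on the head of the
  list. The dart \<open>(v, a)\<close> is the edge from \<open>v\<close> to \<open>neighbor v a\<close> with this orientation. The planar
  embedding is given by its rotation system: the darts \<open>(v, 0), (v, 1), (v, 2)\<close> are in clockwise
  order around every vertex \<open>v\<close>.\<close>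

type_synonym vertex = "3 list"
type_synonym dart = "vertex \<times> 3"

definition neighbor :: "vertex \<Rightarrow> 3 \<Rightarrow> vertex" where
  "neighbor v a = (if v \<noteq> [] \<and> hd v = a then tl v else a # v)"

definition darts :: "dart set" where
  "darts = {(v, a). distinct_adj v}"

definition rev_dart :: "dart \<Rightarrow> dart" where
  "rev_dart d = (case d of (v, a) \<Rightarrow> (neighbor v a, a))"

text \<open>The next dart when walking along the boundary of the face to the left of a dart: on arrival
  at a vertex, take the clockwise successor of the dart leading back. Addition in the type \<open>3\<close> is
  modulo 3.\<close>

definition next_dart :: "dart \<Rightarrow> dart" where
  "next_dart d = (case rev_dart d of (w, a) \<Rightarrow> (w, a + 1))"

text \<open>The vertices of the dual are the faces of the embedded tree, and a face is identified with
  the set of darts that have it on their left, an orbit of \<open>next_dart\<close>. The edge of the tree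
  underlying a dart \<open>d\<close> is dual to the edge joining \<open>left_face d\<close> and \<open>right_face d\<close>.\<close>

type_synonym face = "dart set"

definition left_face :: "dart \<Rightarrow> face" where
  "left_face d = {e \<in> darts. \<exists>k. (next_dart ^^ k) d = e \<or> (next_dart ^^ k) e = d}"

definition right_face :: "dart \<Rightarrow> face" where
  "right_face d = left_face (rev_dart d)"

definition dual_adj :: "face \<Rightarrow> face \<Rightarrow> bool" where
  "dual_adj f g \<longleftrightarrow> (\<exists>d\<in>darts. left_face d = f \<and> right_face d = g)"

definition Delta :: "vertex \<Rightarrow> face set" where
  "Delta v = (\<lambda>a. left_face (v, a)) ` UNIV"


section \<open>Colorings of the cycle\<close>

definition frontier :: "vertex set \<Rightarrow> vertex set" where
  "frontier T = {w. w \<notin> T \<and> (\<exists>v\<in>T. \<exists>a. w = neighbor v a)}"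

definition grow :: "vertex set \<Rightarrow> vertex set pmf" where
  "grow T = map_pmf (\<lambda>w. insert w T) (pmf_of_set (frontier T))"

text \<open>Meaningful for \<open>m \<ge> 1\<close> only.\<close>

definition cluster :: "nat \<Rightarrow> vertex set pmf" where
  "cluster m = ((\<lambda>p. bind_pmf p grow) ^^ (m - 1)) (return_pmf {[]})"

definition dual_vertices :: "vertex set \<Rightarrow> face set" where
  "dual_vertices T = (\<Union>v\<in>T. Delta v)"

definition proper_colorings :: "nat \<Rightarrow> vertex set \<Rightarrow> (face \<Rightarrow> nat) set" where
  "proper_colorings q T =
     {c \<in> dual_vertices T \<rightarrow>\<^sub>E {1..q}.
        \<forall>f\<in>dual_vertices T. \<forall>g\<in>dual_vertices T. dual_adj f g \<longrightarrow> c f \<noteq> c g}"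

text \<open>The edges bounding the outer face of the subgraph of the dual induced by \<open>dual_vertices T\<close>
  are dual to the darts leaving \<open>T\<close>. Seen along a dart pointing out of \<open>T\<close>, going clockwise
  around \<open>T\<close> means going from left to right.\<close>

definition clockwise_next :: "vertex set \<Rightarrow> face \<Rightarrow> face" where
  "clockwise_next T f =
     (THE g. \<exists>v\<in>T. \<exists>a. neighbor v a \<notin> T \<and> left_face (v, a) = f \<and> right_face (v, a) = g)"

definition cycle_coloring_pmf :: "nat \<Rightarrow> nat \<Rightarrow> nat list pmf" where
  "cycle_coloring_pmf n q =
     do {
       T \<leftarrow> cluster (n - 2);
       c \<leftarrow> pmf_of_set (proper_colorings q T);
       u \<leftarrow> pmf_of_set (dual_vertices T);
       return_pmf (map (\<lambda>j. c ((clockwise_next T ^^ j) u)) [0..<n])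
     }"

definition cycle_coloring :: "nat \<Rightarrow> nat \<Rightarrow> 'a measure \<Rightarrow> (int \<Rightarrow> 'a \<Rightarrow> nat) \<Rightarrow> bool" where
  "cycle_coloring n q M C \<longleftrightarrow>
     prob_space M \<and>
     (\<forall>i\<in>{1..int n}. C i \<in> measurable M (count_space UNIV)) \<and>
     distr M (count_space UNIV) (\<lambda>\<omega>. map (\<lambda>i. C i \<omega>) [1..int n]) =
       measure_pmf (cycle_coloring_pmf n q)"

fun is_coloring :: "index_set \<Rightarrow> nat \<Rightarrow> 'a measure \<Rightarrow> (int \<Rightarrow> 'a \<Rightarrow> nat) \<Rightarrow> bool" where
  "is_coloring Integers q M W \<longleftrightarrow> integer_coloring q M W"
| "is_coloring (Cycle n) q M W \<longleftrightarrow> cycle_coloring n q M W"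

end

theory Submission
  imports Defs
begin

text \<open>
  Everything is reduced to a process of random cyclic words. A necklace starts with three beads of
  different colors; a new bead is put into a uniformly random gap and gets a uniformly random color
  different from those of its two neighbors. Since the law of the word does not change under
  rotation, such a step can be written as ``append a bead, then rotate uniformly'' (\<open>spin\<close>), and two
  growth rules agree as soon as the sums of their weights over all rotations of a word agree
  (\<open>spin_cong\<close>).

  \<^item> Projecting the colors to two classes gives a process that evolves on its own: a bead in the class
    \<open>b\<close> is appended with weight \<open>(number of colors in b) - (number of end beads in b)\<close>
    (\<open>pmf_projected_bead\<close>).
  \<^item> The descents and the peaks of a uniformly random cyclic permutation evolve on their own as well,
    because such a permutation grows by inserting a new maximum into a random gap (\<open>perms_Suc\<close>). The
    rotation sums coincide with those of the projected necklace, and induction on the length gives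
    \<open>necklace_descents\<close> and \<open>necklace_peaks\<close>.
  \<^item> For fair bits, the number of bit words with a given cyclic descent pattern is the trace of a
    product of 2 by 2 matrices. It satisfies the recursion of the projected necklace up to terms that
    cancel in the sum over rotations (\<open>necklace_bits\<close>).

  The coloring of the cycle defined by the tree is the necklace: a new vertex of the cluster adds one
  face between two consecutive faces of the outer cycle, adjacent to just these two
  (\<open>cycle_coloring_pmf_eq_necklace\<close>). The coloring of the integers is a segment of the necklace: the
  probability of a segment with 1 (if there are 4 colors) or 2 (if there are 3 colors) beads left out
  satisfies the recursion that defines \<open>B\<close> (\<open>necklace4_segment\<close>, \<open>necklace3_segment\<close>). On the other
  side, the ranks of i.i.d. uniform variables form a uniformly random permutation
  (\<open>iid_uniform_ranks\<close>), and the pattern of a segment is a segment of a cyclic pattern.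
\<close>


section \<open>Sums over rotations and spun words\<close>

definition cycsum :: "('a list \<Rightarrow> real) \<Rightarrow> 'a list \<Rightarrow> real" where
  "cycsum f y = (\<Sum>r<length y. f (rotate r y))"

lemma cycsum_rotate1: "cycsum (\<lambda>z. f (rotate1 z)) y = cycsum f y"
proof (cases "length y")
  case (Suc n)
  have "cycsum (\<lambda>z. f (rotate1 z)) y = (\<Sum>r<Suc n. f (rotate (Suc r) y))"
    by (simp add: cycsum_def Suc)
  also have "\<dots> = (\<Sum>r<n. f (rotate (Suc r) y)) + f y"
    using Suc by (simp del: rotate_Suc)
  also have "\<dots> = cycsum f y"
    unfolding cycsum_def Suc by (subst sum.lessThan_Suc_shift) simp
  finally show ?thesis .
qed (simp add: cycsum_def)

lemma cycsum_rotate_word: "cycsum f (rotate1 y) = cycsum f y"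
  using cycsum_rotate1[of f y] by (simp add: cycsum_def rotate1_rotate_swap)

lemma cycsum_cong:
  assumes "\<And>z. length z = length y \<Longrightarrow> set z = set y \<Longrightarrow> f z = g z"
  shows "cycsum f y = cycsum g y"
  unfolding cycsum_def by (intro sum.cong refl assms) auto

lemma cycsum_add: "cycsum (\<lambda>z. f z + g z) y = cycsum f y + cycsum g y"
  by (simp add: cycsum_def sum.distrib)

lemma cycsum_diff: "cycsum (\<lambda>z. f z - g z) y = cycsum f y - cycsum g y"
  by (simp add: cycsum_def sum_subtractf)

lemma cycsum_cmult: "cycsum (\<lambda>z. c * f z) y = c * cycsum f y"
  by (simp add: cycsum_def sum_distrib_left)

lemma cycsum_map: "cycsum f (map h y) = cycsum (\<lambda>z. f (map h z)) y"
  by (simp add: cycsum_def rotate_map)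

lemma rotation_invariant:
  assumes "\<And>z. f (rotate1 z) = f z"
  shows "f (rotate r z) = f z"
  by (induction r) (simp_all add: assms)

lemma cycsum_invariant:
  fixes f :: "'a list \<Rightarrow> real"
  assumes "\<And>z. f (rotate1 z) = f z"
  shows "cycsum f y = length y * f y"
  by (simp add: cycsum_def rotation_invariant[of f, OF assms])

text \<open>Rotation brings every letter to the last place exactly once.\<close>

lemma cycsum_last:
  assumes "y \<noteq> []"
  shows "cycsum (\<lambda>z. g (last z)) y = (\<Sum>x\<leftarrow>y. g x)"
proof -
  have "cycsum (\<lambda>z. g (last z)) y = cycsum (\<lambda>z. g (last (rotate1 z))) y"
    by (rule cycsum_rotate1[symmetric])
  also have "\<dots> = cycsum (\<lambda>z. g (hd z)) y"
    by (rule cycsum_cong) (metis assms last_snoc length_0_conv rotate1_hd_tl)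
  also have "\<dots> = (\<Sum>r<length y. g (y ! r))"
    unfolding cycsum_def using assms by (intro sum.cong refl) (simp add: hd_rotate_conv_nth)
  also have "\<dots> = (\<Sum>x\<leftarrow>y. g x)"
    by (simp add: sum_list_sum_nth atLeast0LessThan)
  finally show ?thesis .
qed

text \<open>A rotation sum does not change if each rotation is replaced by the next one. This turns weights
  that depend on the first letter into weights that depend on the last two.\<close>

lemma cycsum_move_last:
  fixes y :: "'a list"
  assumes "\<And>u a b. E (b # u @ [a]) = E' (u @ [a, b])" and "length y \<ge> 2"
  shows "cycsum E y = cycsum E' y"
proof -
  have "cycsum E y = cycsum (\<lambda>z. E' (rotate1 z)) y"
  proof (rule cycsum_cong)
    fix z :: "'a list" assume "length z = length y"
    then obtain b v where z: "z = b # v" "v \<noteq> []"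
      using assms(2) by (cases z; cases "tl z") auto
    then obtain u a where "v = u @ [a]" by (cases v rule: rev_cases) auto
    with z assms(1) show "E z = E' (rotate1 z)" by simp
  qed
  then show ?thesis by (simp add: cycsum_rotate1)
qed

lemma cycsum_cong_last_two:
  fixes y :: "'a list"
  assumes "\<And>u a b. length u + 2 = length y \<Longrightarrow> E (u @ [a, b]) = E' (u @ [a, b])" "length y \<ge> 2"
  shows "cycsum E y = cycsum E' y"
proof (rule cycsum_cong)
  fix z :: "'a list" assume len: "length z = length y"
  then obtain v b where z: "z = v @ [b]" "v \<noteq> []"
    using assms(2) by (cases z rule: rev_cases; cases "butlast z") auto
  then obtain u a where "v = u @ [a]" by (cases v rule: rev_cases) auto
  with z assms(1) len show "E z = E' z" by simp
qed

lemma cycsum_cong_ends: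
  fixes y :: "'a list"
  assumes "\<And>c v a b. length v + 3 = length y \<Longrightarrow> E (c # v @ [a, b]) = E' (c # v @ [a, b])" "length y \<ge> 3"
  shows "cycsum E y = cycsum E' y"
proof (rule cycsum_cong_last_two)
  fix u :: "'a list" and a b assume "length u + 2 = length y"
  with assms show "E (u @ [a, b]) = E' (u @ [a, b])" by (cases u) auto
qed (use assms(2) in simp)

text \<open>If the law of a cyclic word is invariant under rotation,
  inserting a letter into a uniformly random
  gap amounts to appending it and then rotating uniformly. All growth steps below have this form.\<close>

definition spin :: "'a list pmf \<Rightarrow> 'a list pmf" where
  "spin p = do { z \<leftarrow> p; r \<leftarrow> pmf_of_set {..<length z}; return_pmf (rotate r z) }"

lemma map_spin: "map_pmf (map f) (spin p) = spin (map_pmf (map f) p)"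
  by (simp add: spin_def map_bind_pmf bind_map_pmf rotate_map)

text \<open>Exactly one word is taken to \<open>y\<close> by each of the \<open>N\<close> rotations.\<close>

lemma pmf_spin:
  assumes len: "\<And>z. z \<in> set_pmf p \<Longrightarrow> length z = N" and N: "N > 0"
  shows "pmf (spin p) y = (if length y = N then cycsum (pmf p) y / N else 0)"
proof (cases "length y = N")
  case False
  have "y \<notin> set_pmf (spin p)"
    using False by (auto simp: spin_def dest!: len)
  with False show ?thesis by (simp add: set_pmf_iff)
next
  case True
  have rot: "rotate r z = y \<longleftrightarrow> z = rotate (N - r) y"
    if "r < N" "length z = N" for r and z :: "'a list"
  proof
    assume "rotate r z = y"
    then show "z = rotate (N - r) y"
      using that by (auto simp: rotate_rotate)
  next
    assume "z = rotate (N - r) y"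
    then show "rotate r z = y"
      using that True by (auto simp: rotate_rotate)
  qed
  have fib: "pmf (pmf_of_set {..<length z} \<bind> (\<lambda>r. return_pmf (rotate r z))) y
      = (\<Sum>r<N. indicator {rotate (N - r) y} z) / N" if "z \<in> set_pmf p" for z
  proof -
    have ne: "{..<N} \<noteq> {}" using N by auto
    have "pmf (pmf_of_set {..<N} \<bind> (\<lambda>r. return_pmf (rotate r z))) y
        = (\<Sum>r<N. pmf (return_pmf (rotate r z)) y) / N"
      using pmf_bind_pmf_of_set[OF ne, of "\<lambda>r. return_pmf (rotate r z)" y] by simp
    also have "(\<Sum>r<N. pmf (return_pmf (rotate r z)) y) = (\<Sum>r<N. indicator {rotate (N - r) y} z)"
      by (intro sum.cong refl) (use rot len[OF that] in \<open>auto simp: indicator_def\<close>)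
    finally show ?thesis using len[OF that] by simp
  qed
  have "pmf (spin p) y = measure_pmf.expectation p (\<lambda>z. (\<Sum>r<N. indicator {rotate (N - r) y} z) / N)"
    unfolding spin_def pmf_bind[of p]
    by (rule integral_cong_AE) (simp_all add: AE_measure_pmf_iff fib)
  also have "\<dots> = (\<Sum>r<N. pmf p (rotate (N - r) y)) / N"
    by (simp add: measure_pmf_single Bochner_Integration.integral_sum
        measure_pmf.integrable_const_bound[where B=1])
  also have "(\<Sum>r<N. pmf p (rotate (N - r) y)) = (\<Sum>r<N. pmf p (rotate (Suc r) y))"
    by (rule sum.reindex_bij_witness[of _ "\<lambda>r. N - Suc r" "\<lambda>r. N - Suc r"])
       (auto simp: Suc_diff_Suc simp del: rotate_Suc)
  also have "\<dots> = cycsum (pmf p) y"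
    unfolding cycsum_rotate1[symmetric, of "pmf p"] by (simp add: cycsum_def True)
  finally show ?thesis using True by simp
qed

lemma pmf_spin_rotate1:
  assumes "\<And>z. z \<in> set_pmf p \<Longrightarrow> length z = N" "N > 0"
  shows "pmf (spin p) (rotate1 y) = pmf (spin p) y"
  by (simp add: pmf_spin[OF assms] cycsum_rotate_word)

text \<open>Two growth rules may distribute their weights differently over the rotations of a word; the
  rotated word only sees the sums.\<close>

lemma spin_cong:
  assumes "\<And>z. z \<in> set_pmf p \<Longrightarrow> length z = N" "\<And>z. z \<in> set_pmf p' \<Longrightarrow> length z = N" "N > 0"
    and "\<And>y. length y = N \<Longrightarrow> cycsum (pmf p) y = cycsum (pmf p') y"
  shows "spin p = spin p'"
  by (rule pmf_eqI) (simp add: pmf_spin[OF assms(1,3)] pmf_spin[OF assms(2,3)] assms(4))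

lemma spin_invariant:
  assumes len: "\<And>z. z \<in> set_pmf p \<Longrightarrow> length z = N" "N > 0"
    and inv: "\<And>y. pmf p (rotate1 y) = pmf p y"
  shows "spin p = p"
proof (rule pmf_eqI)
  fix y
  have "pmf (spin p) y = (if length y = N then cycsum (pmf p) y / N else 0)"
    by (rule pmf_spin) (use len in auto)
  moreover have "cycsum (pmf p) y = length y * pmf p y"
    by (rule cycsum_invariant) (rule inv)
  moreover have "pmf p y = 0" if "length y \<noteq> N"
    using len(1) that by (auto simp: set_pmf_iff)
  ultimately show "pmf (spin p) y = pmf p y"
    using len(2) by (cases "length y = N") simp_all
qed


section \<open>The necklace\<close>

definition add_bead :: "nat \<Rightarrow> nat list \<Rightarrow> nat list pmf" where
  "add_bead q z = map_pmf (\<lambda>a. z @ [a]) (pmf_of_set ({1..q} - {hd z, last z}))"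

definition triples :: "nat \<Rightarrow> nat list set" where
  "triples q = {z. length z = 3 \<and> distinct z \<and> set z \<subseteq> {1..q}}"

text \<open>The second argument counts the beads beyond the first three.\<close>

fun necklace :: "nat \<Rightarrow> nat \<Rightarrow> nat list pmf" where
  "necklace q 0 = pmf_of_set (triples q)"
| "necklace q (Suc m) = spin (necklace q m \<bind> add_bead q)"

definition proper_cycle :: "nat list \<Rightarrow> bool" where
  "proper_cycle z \<longleftrightarrow> distinct_adj z \<and> hd z \<noteq> last z"

lemma proper_cycle_rotate1: "length z \<ge> 2 \<Longrightarrow> proper_cycle (rotate1 z) = proper_cycle z"
  by (cases z) (auto simp: proper_cycle_def distinct_adj_Cons distinct_adj_append_iff neq_Nil_conv)

lemma proper_cycle_rotate: "length z \<ge> 2 \<Longrightarrow> proper_cycle (rotate r z) = proper_cycle z"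
  by (induction r) (auto simp: proper_cycle_rotate1)

lemma proper_cycle_snoc:
  "z \<noteq> [] \<Longrightarrow> proper_cycle (z @ [a]) \<longleftrightarrow> distinct_adj z \<and> a \<noteq> hd z \<and> a \<noteq> last z"
  by (auto simp: proper_cycle_def distinct_adj_append_iff)

lemma triples_finite: "finite (triples q)"
  by (rule finite_subset[OF _ finite_lists_length_eq[of "{1..q}" 3]]) (auto simp: triples_def)

lemma triples_nonempty: "q \<ge> 3 \<Longrightarrow> triples q \<noteq> {}"
  by (auto simp: triples_def intro!: exI[of _ "[1,2,3]"])

lemma set_add_bead:
  assumes "q \<ge> 3"
  shows "set_pmf (add_bead q z) = (\<lambda>a. z @ [a]) ` ({1..q} - {hd z, last z})"
proof -
  have "card ({1..q} - {hd z, last z}) \<ge> card {1..q} - card {hd z, last z}"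
    by (rule diff_card_le_card_Diff) simp
  moreover have "card {hd z, last z} \<le> 2"
    by (simp add: card_insert_if)
  ultimately have "card ({1..q} - {hd z, last z}) > 0"
    using assms by simp
  then have "{1..q} - {hd z, last z} \<noteq> {}"
    by (metis card.empty less_irrefl)
  then show ?thesis by (simp add: add_bead_def)
qed

lemma necklace_support:
  assumes q: "q \<ge> 3" and "z \<in> set_pmf (necklace q m)"
  shows "length z = m + 3 \<and> proper_cycle z \<and> set z \<subseteq> {1..q}"
  using assms(2)
proof (induction m arbitrary: z)
  case 0
  then have "z \<in> triples q" using triples_nonempty[OF q] triples_finite by simp
  then show ?case
    by (auto simp: triples_def proper_cycle_def numeral_3_eq_3 length_Suc_conv)
next
  case (Suc m)
  then obtain u a r where u: "u \<in> set_pmf (necklace q m)" "a \<in> {1..q} - {hd u, last u}"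
    and z: "z = rotate r (u @ [a])"
    unfolding necklace.simps spin_def set_bind_pmf set_return_pmf UN_iff set_add_bead[OF q]
    by blast
  show ?case
  proof -
    have IH: "length u = m + 3" "proper_cycle u" "set u \<subseteq> {1..q}"
      using Suc.IH[OF u(1)] by auto
    have "u \<noteq> []" using IH(1) by auto
    then have "proper_cycle (u @ [a])"
      using proper_cycle_snoc[of u a] IH(2) u(2) by (auto simp: proper_cycle_def)
    then show ?thesis
      using IH u(2) z proper_cycle_rotate[of "u @ [a]" r] by simp
  qed
qed

lemma length_add_bead_support:
  assumes "q \<ge> 3" "z \<in> set_pmf (necklace q m \<bind> add_bead q)"
  shows "length z = m + 4"
  using assms by (auto simp: set_add_bead dest: necklace_support)

lemma pmf_necklace_rotate1:
  assumes q: "q \<ge> 3"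
  shows "pmf (necklace q m) (rotate1 z) = pmf (necklace q m) z"
proof (cases m)
  case 0
  then show ?thesis
    using triples_nonempty[OF q] triples_finite by (simp add: indicator_def triples_def)
next
  case (Suc k)
  show ?thesis
    unfolding Suc necklace.simps
    by (rule pmf_spin_rotate1[where N = "k + 4"]) (use length_add_bead_support[OF q] in auto)
qed

text \<open>The ends of a proper cyclic word have different colors, so every end in the class \<open>b\<close> removes one
  color from this class. The weight can be negative, namely if the class has one color and both ends
  of \<open>u\<close> lie in it, but then \<open>u\<close> has probability zero.\<close>

lemma pmf_projected_bead:
  assumes q: "q \<ge> 3"
  shows "pmf (map_pmf (map \<pi>) (necklace q m \<bind> add_bead q)) (u @ [b])
    = pmf (map_pmf (map \<pi>) (necklace q m)) u
      * (real (card {a\<in>{1..q}. \<pi> a = b}) - of_bool (hd u = b) - of_bool (last u = b)) / (real q - 2)"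
proof -
  let ?k = "real (card {a\<in>{1..q}. \<pi> a = b})"
  let ?w = "(?k - of_bool (hd u = b) - of_bool (last u = b)) / (real q - 2)"
  have fib: "pmf (map_pmf (map \<pi>) (add_bead q z)) (u @ [b]) = indicator (map \<pi> -` {u}) z * ?w"
    if z: "z \<in> set_pmf (necklace q m)" for z
  proof -
    let ?S = "{1..q} - {hd z, last z}"
    have zp: "z \<noteq> []" "hd z \<in> {1..q}" "last z \<in> {1..q}" "hd z \<noteq> last z"
      using necklace_support[OF q z] hd_in_set[of z] last_in_set[of z]
      by (fastforce simp: proper_cycle_def)+
    have "card ?S = card {1..q} - card {hd z, last z}"
      by (rule card_Diff_subset) (use zp in auto)
    then have cS: "card ?S = q - 2" using zp by simp
    then have "card ?S > 0" using q by linarith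
    then have neS: "?S \<noteq> {}" by (metis card.empty less_irrefl)
    have "pmf (map_pmf (map \<pi>) (add_bead q z)) (u @ [b])
        = measure (pmf_of_set ?S) ((\<lambda>a. map \<pi> z @ [\<pi> a]) -` {u @ [b]})"
      by (simp add: add_bead_def map_pmf_comp pmf_map)
    also have "\<dots> = card (?S \<inter> (\<lambda>a. map \<pi> z @ [\<pi> a]) -` {u @ [b]}) / card ?S"
      by (rule measure_pmf_of_set[OF neS]) simp
    also have "?S \<inter> (\<lambda>a. map \<pi> z @ [\<pi> a]) -` {u @ [b]}
        = (if map \<pi> z = u then {a\<in>{1..q}. \<pi> a = b} - {a\<in>{hd z, last z}. \<pi> a = b} else {})"
      by auto
    also have "real (card \<dots>) = indicator (map \<pi> -` {u}) z * (?k - of_bool (hd u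
      = b) - of_bool (last u = b))"
    proof (cases "map \<pi> z = u")
      case True
      have sub: "{a\<in>{hd z, last z}. \<pi> a = b} \<subseteq> {a\<in>{1..q}. \<pi> a = b}"
        using zp by auto
      have ends: "\<pi> (hd z) = hd u" "\<pi> (last z) = last u"
        using zp True by (auto simp: hd_map last_map)
      have "card {a\<in>{x, y}. \<pi> a = b} = of_bool (\<pi> x = b) + of_bool (\<pi> y = b)" if "x \<noteq> y" for x y
      proof -
        have "{a\<in>{x, y}. \<pi> a = b} = {a\<in>{x}. \<pi> a = b} \<union> {a\<in>{y}. \<pi> a = b}" by blast
        also have "card \<dots> = card {a\<in>{x}. \<pi> a = b} + card {a\<in>{y}. \<pi> a = b}"
          by (rule card_Un_disjoint) (use that in auto)
        finally have "card {a\<in>{x, y}. \<pi> a = b} = card {a\<in>{x}. \<pi> a = b} + card {a\<in>{y}. \<pi> a = b}" .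
        moreover have "card {a\<in>{c}. \<pi> a = b} = of_bool (\<pi> c = b)" for c
        proof -
          have "{a\<in>{c}. \<pi> a = b} = (if \<pi> c = b then {c} else {})" by auto
          then show ?thesis by simp
        qed
        ultimately show ?thesis by simp
      qed
      from this[OF zp(4)]
      have "card {a\<in>{hd z, last z}. \<pi> a = b} = of_bool (hd u = b) + of_bool (last u = b)"
        by (simp only: ends)
      moreover have "card ({a\<in>{1..q}. \<pi> a = b} - {a\<in>{hd z, last z}. \<pi> a = b})
          = card {a\<in>{1..q}. \<pi> a = b} - card {a\<in>{hd z, last z}. \<pi> a = b}"
        by (rule card_Diff_subset[OF _ sub]) simp
      moreover have "card {a\<in>{hd z, last z}. \<pi> a = b} \<le> card {a\<in>{1..q}. \<pi> a = b}"
        by (rule card_mono[OF _ sub]) simp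
      ultimately show ?thesis using True by (simp add: of_nat_diff)
    qed simp
    finally show ?thesis using cS q by (simp add: of_nat_diff)
  qed
  have "pmf (map_pmf (map \<pi>) (necklace q m \<bind> add_bead q)) (u @ [b])
      = measure_pmf.expectation (necklace q m) (\<lambda>z. indicator (map \<pi> -` {u}) z * ?w)"
    unfolding map_bind_pmf pmf_bind
    by (rule integral_cong_AE) (simp_all add: AE_measure_pmf_iff fib)
  also have "\<dots> = pmf (map_pmf (map \<pi>) (necklace q m)) u * ?w"
    by (simp add: pmf_map)
  finally show ?thesis by simp
qed

lemma pmf_bind_add_bead:
  assumes q: "q \<ge> 3"
  shows "pmf (necklace q m \<bind> add_bead q) (u @ [a])
    = pmf (necklace q m) u * of_bool (a \<in> {1..q} - {hd u, last u}) / (real q - 2)"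
proof (cases "u \<in> set_pmf (necklace q m)")
  case False
  then show ?thesis
    using pmf_projected_bead[OF q, of "\<lambda>x. x" m u a] by (simp add: set_pmf_iff)
next
  case True
  have u: "hd u \<noteq> last u" "u \<noteq> []" "set u \<subseteq> {1..q}"
    using necklace_support[OF q True] by (auto simp: proper_cycle_def)
  then have "hd u \<in> {1..q}" "last u \<in> {1..q}"
    using hd_in_set[of u] last_in_set[of u] by blast+
  moreover have "{c\<in>{1..q}. c = a} = (if a \<in> {1..q} then {a} else {})" by auto
  ultimately have "real (card {c\<in>{1..q}. c = a}) - of_bool (hd u = a) - of_bool (last u = a)
      = of_bool (a \<in> {1..q} - {hd u, last u})"
    using u(1) by auto
  then show ?thesis
    using pmf_projected_bead[OF q, of "\<lambda>x. x" m u a] by simp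
qed

lemma spin_necklace:
  assumes "q \<ge> 3" shows "spin (necklace q m) = necklace q m"
  by (rule spin_invariant[where N = "m + 3"])
     (use necklace_support[OF assms] pmf_necklace_rotate1[OF assms] in auto)

lemma pmf_map_necklace_rotate1:
  assumes q: "q \<ge> 3"
  shows "pmf (map_pmf (map \<pi>) (necklace q m)) (rotate1 y) = pmf (map_pmf (map \<pi>) (necklace q m)) y"
proof -
  have "pmf (spin (map_pmf (map \<pi>) (necklace q m))) (rotate1 y)
      = pmf (spin (map_pmf (map \<pi>) (necklace q m))) y"
    by (rule pmf_spin_rotate1[where N = "m + 3"]) (use necklace_support[OF q] in auto)
  then show ?thesis by (simp add: map_spin[symmetric] spin_necklace[OF q])
qed

section \<open>Descents and peaks around a cycle\<close>

definition cyc_desc :: "'a::linorder list \<Rightarrow> bool list" where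
  "cyc_desc l = map2 (\<lambda>x y. x > y) l (rotate1 l)"

definition cyc_peaks :: "'a::linorder list \<Rightarrow> bool list" where
  "cyc_peaks l = map (\<lambda>(x, y, z). x < y \<and> y > z) (zip (last l # butlast l) (zip l (rotate1 l)))"

lemma length_cyc_desc [simp]: "length (cyc_desc l) = length l"
  by (simp add: cyc_desc_def)

lemma length_cyc_peaks [simp]: "length (cyc_peaks l) = length l"
  by (cases l) (simp_all add: cyc_peaks_def)

lemma nth_cyc_desc:
  "i < length l \<Longrightarrow> cyc_desc l ! i \<longleftrightarrow> l ! i > l ! (Suc i mod length l)"
  by (simp add: cyc_desc_def nth_rotate1)

lemma nth_cyc_peaks:
  assumes "i < length l"
  shows "cyc_peaks l ! i \<longleftrightarrow>
    l ! (if i = 0 then length l - 1 else i - 1) < l ! i \<and> l ! i > l ! (Suc i mod length l)"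
proof -
  have "l \<noteq> []" "length (last l # butlast l) = length l" using assms by auto
  then show ?thesis
    using assms
    by (auto simp: cyc_peaks_def nth_rotate1 nth_Cons last_conv_nth nth_butlast split: nat.split)
qed

lemma cyc_desc_rotate1: "cyc_desc (rotate1 l) = rotate1 (cyc_desc l)"
proof (rule nth_equalityI)
  fix i assume "i < length (cyc_desc (rotate1 l))"
  then have i: "i < length l" by simp
  moreover from i have "Suc i mod length l < length l" by (cases l) auto
  ultimately show "cyc_desc (rotate1 l) ! i = rotate1 (cyc_desc l) ! i"
    by (simp add: nth_cyc_desc nth_rotate1)
qed simp

lemma cyc_peaks_rotate1: "cyc_peaks (rotate1 l) = rotate1 (cyc_peaks l)"
proof (rule nth_equalityI)
  fix i assume "i < length (cyc_peaks (rotate1 l))"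
  then have i: "i < length l" by simp
  moreover from i have "Suc i mod length l < length l" by (cases l) auto
  moreover have "Suc (if i = 0 then length l - 1 else i - 1) mod length l = i"
    using i by auto
  moreover have "(if Suc i mod length l = 0 then length l - 1 else Suc i mod length l - 1) = i"
    using i by (auto simp: mod_Suc split: if_splits)
  ultimately show "cyc_peaks (rotate1 l) ! i = rotate1 (cyc_peaks l) ! i"
    by (auto simp: nth_cyc_peaks nth_rotate1)
qed simp

lemma map_spin_equivariant:
  assumes "\<And>z. f (rotate1 z) = rotate1 (f z)" "\<And>z. length (f z) = length z"
  shows "map_pmf f (spin p) = spin (map_pmf f p)"
proof -
  have "f (rotate r z) = rotate r (f z)" for r z
    by (induction r) (simp_all add: assms)
  then show ?thesis
    by (simp add: spin_def map_bind_pmf bind_map_pmf assms)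
qed

text \<open>The maximum contributes an ascent followed by a descent, and these replace the comparison of its
  two neighbors.\<close>

lemma cyc_desc_append_max:
  assumes "l \<noteq> []" "\<forall>x\<in>set l. x < n"
  shows "cyc_desc (l @ [n]) = butlast (cyc_desc l) @ [False, True]"
proof (rule nth_equalityI)
  fix i assume "i < length (cyc_desc (l @ [n]))"
  then have "i < length l - 1 \<or> i = length l - 1 \<or> i = length l"
    by (simp, linarith)
  then consider "i < length l - 1" | "i = length l - 1" | "i = length l"
    by blast
  then show "cyc_desc (l @ [n]) ! i = (butlast (cyc_desc l) @ [False, True]) ! i"
  proof cases
    case 1
    then show ?thesis by (auto simp: nth_cyc_desc nth_append nth_butlast)
  next
    case 2
    then have "i < length l" "Suc i = length l" using assms(1) by (cases l; simp)+
    moreover from this have "l ! i < n" using assms(2) by auto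
    ultimately show ?thesis by (auto simp: nth_cyc_desc nth_append)
  next
    case 3
    moreover have "l ! 0 < n" using assms by (metis length_greater_0_conv nth_mem)
    ultimately show ?thesis using assms(1) by (auto simp: nth_cyc_desc nth_append less_imp_le not_less)
  qed
qed (use assms in auto)

text \<open>The maximum is a peak, its neighbors are not, and the other entries do not see it.\<close>

lemma cyc_peaks_append_max:
  assumes "length l \<ge> 2" "\<forall>x\<in>set l. x < n"
  shows "cyc_peaks (l @ [n]) = False # butlast (tl (cyc_peaks l)) @ [False, True]"
proof (rule nth_equalityI)
  let ?m = "butlast (tl (cyc_peaks l))"
  have lm: "length ?m = length l - 2" by simp
  have lt: "l ! j < n" if "j < length l" for j using assms(2) that by auto
  fix i assume "i < length (cyc_peaks (l @ [n]))"
  then have "i = 0 \<or> 0 < i \<and> i < length l - 1 \<or> i = length l - 1 \<or> i = length l"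
    by (simp, linarith)
  then consider "i = 0" | "0 < i" "i < length l - 1" | "i = length l - 1" | "i = length l"
    by blast
  then show "cyc_peaks (l @ [n]) ! i = (False # ?m @ [False, True]) ! i"
  proof cases
    case 1
    then show ?thesis using assms lt[of 0] by (auto simp: nth_cyc_peaks nth_append less_imp_le not_less)
  next
    case 2
    then obtain j where j: "i = Suc j" by (cases i) auto
    have "?m ! j = cyc_peaks l ! i"
      using 2 j by (simp add: nth_butlast nth_tl)
    then show ?thesis using 2 j assms(1) by (auto simp: nth_cyc_peaks nth_append lm)
  next
    case 3
    then obtain j where j: "i = Suc j" "j = length l - 2" "Suc i = length l" using assms(1)
      by (cases i) auto
    then show ?thesis using 3 assms less_not_sym[OF lt[of i]]
      by (auto simp: nth_cyc_peaks nth_append lm)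
  next
    case 4
    then obtain j where j: "i = Suc j" "j = length l - 1" using assms(1) by (cases i) auto
    then show ?thesis using 4 assms lt[of 0] lt[of j] by (auto simp: nth_cyc_peaks nth_append lm)
  qed
qed (use assms in auto)

section \<open>Random permutations\<close>

definition perms :: "nat \<Rightarrow> nat list pmf" where
  "perms n = pmf_of_set (permutations_of_set {..<n})"

lemma set_perms: "set_pmf (perms n) = permutations_of_set {..<n}"
  by (simp add: perms_def)

lemma length_perms: "l \<in> set_pmf (perms n) \<Longrightarrow> length l = n"
  by (auto simp: set_perms dest: length_finite_permutations_of_set)

text \<open>The maximum of a random permutation is at a uniformly random place, and the entries that follow
  it cyclically form a random permutation. In the proof, each word has exactly one rotation that ends
  with the maximum.\<close>

lemma perms_Suc: "perms (Suc n) = spin (map_pmf (\<lambda>l. l @ [n]) (perms n))"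
proof (rule pmf_eqI)
  fix y :: "nat list"
  let ?p = "map_pmf (\<lambda>l. l @ [n]) (perms n)"
  have len: "\<And>z. z \<in> set_pmf ?p \<Longrightarrow> length z = Suc n" by (auto dest: length_perms)
  have pm: "pmf ?p (u @ [a]) = (if a = n then pmf (perms n) u else 0)" for u a
  proof (cases "a = n")
    case True
    show ?thesis using True pmf_map_inj'[of "\<lambda>l. l @ [n]" "perms n" u] by (auto simp: inj_def)
  next
    case False
    then have "u @ [a] \<notin> (\<lambda>l. l @ [n]) ` set_pmf (perms n)" by auto
    with False show ?thesis by (simp add: pmf_map_outside)
  qed
  have perm: "u \<in> permutations_of_set {..<n} \<longleftrightarrow> u @ [n] \<in> permutations_of_set {..<Suc n}" for u
  proof (cases "n \<in> set u")
    case True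
    then have "set u \<noteq> {..<n}" by blast
    with True show ?thesis by (simp add: permutations_of_set_def)
  next
    case False
    then show ?thesis
      using insert_ident[of n "set u" "{..<n}"] by (simp add: permutations_of_set_def lessThan_Suc)
  qed
  have sp: "pmf (spin ?p) y = (if length y = Suc n then cycsum (pmf ?p) y / Suc n else 0)"
    by (rule pmf_spin) (use len in auto)
  show "pmf (perms (Suc n)) y = pmf (spin ?p) y"
  proof (cases "length y = Suc n")
    case False
    then have "y \<notin> permutations_of_set {..<Suc n}"
      using length_finite_permutations_of_set[of y "{..<Suc n}"] by auto
    then show ?thesis unfolding sp using False by (simp add: perms_def)
  next
    case True
    let ?c = "if y \<in> permutations_of_set {..<Suc n} then 1 / fact n else (0::real)"
    have "cycsum (pmf ?p) y = cycsum (\<lambda>z. ?c * of_bool (last z = n)) y"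
    proof (rule cycsum_cong)
      fix z assume z: "length z = length y" "set z = set y"
      then obtain u a where ua: "z = u @ [a]" using True by (cases z rule: rev_cases) auto
      have "z \<in> permutations_of_set {..<Suc n} \<longleftrightarrow> y \<in> permutations_of_set {..<Suc n}"
      proof -
        have "distinct z \<longleftrightarrow> distinct y" using z by (metis card_distinct distinct_card)
        then show ?thesis using z by (simp add: permutations_of_set_def)
      qed
      then show "pmf ?p z = ?c * of_bool (last z = n)"
        using perm[of u] by (simp add: ua pm) (auto simp: perms_def indicator_def)
    qed
    also have "\<dots> = ?c * (\<Sum>x\<leftarrow>y. of_bool (x = n))"
    proof -
      have "y \<noteq> []" using True by auto
      from cycsum_last[OF this, of "\<lambda>x. of_bool (x = n)"] show ?thesis
        by (simp add: cycsum_cmult)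
    qed
    also have "\<dots> = ?c"
    proof (cases "y \<in> permutations_of_set {..<Suc n}")
      case True
      then have "distinct y" "set y = {..<Suc n}" by (auto simp: permutations_of_set_def)
      then have "(\<Sum>x\<leftarrow>y. of_bool (x = n)) = (\<Sum>x<Suc n. of_bool (x = n) :: real)"
        by (simp add: sum_list_distinct_conv_sum_set)
      then show ?thesis by (simp add: of_bool_def)
    qed simp
    finally have "pmf (spin ?p) y = ?c / Suc n" unfolding sp using True by simp
    moreover have "1 / real (fact (Suc n)) = 1 / fact n / real (Suc n)"
      by (simp only: fact_Suc of_nat_mult) simp
    ultimately show ?thesis by (simp add: perms_def indicator_def del: fact_Suc of_nat_Suc)
  qed
qed

section \<open>Patterns of three beads\<close>

lemma pmf_map_pmf_of_list:
  assumes "distinct xs" "xs \<noteq> []"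
  shows "pmf (map_pmf f (pmf_of_set (set xs))) y = length (filter (\<lambda>x. f x = y) xs) / length xs"
proof -
  have "pmf (map_pmf f (pmf_of_set (set xs))) y = card (set xs \<inter> f -` {y}) / card (set xs)"
    unfolding pmf_map by (rule measure_pmf_of_set) (use assms in auto)
  also have "set xs \<inter> f -` {y} = set (filter (\<lambda>x. f x = y) xs)" by auto
  also have "card \<dots> = length (filter (\<lambda>x. f x = y) xs)"
    by (rule distinct_card) (use assms in simp)
  also have "card (set xs) = length xs" by (rule distinct_card) (use assms in simp)
  finally show ?thesis .
qed

text \<open>Laws of patterns of three letters are compared by counting in explicit lists.\<close>

lemma base_law_eqI:
  assumes xs: "distinct xs" "xs \<noteq> []" and ys: "distinct ys" "ys \<noteq> []"
    and len: "\<forall>x\<in>set xs. length (f x) = n" "\<forall>x\<in>set ys. length (g x) = n"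
    and eq: "\<forall>b\<in>set (List.n_lists n [True, False]).
      length (filter (\<lambda>x. f x = b) xs) * length ys = length (filter (\<lambda>x. g x = b) ys) * length xs"
  shows "map_pmf f (pmf_of_set (set xs)) = map_pmf g (pmf_of_set (set ys))"
proof (rule pmf_eqI)
  fix b
  show "pmf (map_pmf f (pmf_of_set (set xs))) b = pmf (map_pmf g (pmf_of_set (set ys))) b"
  proof (cases "length b = n")
    case True
    have "b \<in> set (List.n_lists n [True, False])"
      using True by (auto simp: set_n_lists)
    with eq have "length (filter (\<lambda>x. f x = b) xs) * length ys = length (filter (\<lambda>x. g x
      = b) ys) * length xs"
      by blast
    then have "real (length (filter (\<lambda>x. f x = b) xs)) * length ys = real (length (filter (\<lambda>x. g x
      = b) ys)) * length xs"
      by (metis of_nat_mult)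
    then show ?thesis
      using xs ys by (simp add: pmf_map_pmf_of_list field_simps)
  next
    case False
    then have "filter (\<lambda>x. f x = b) xs = []" "filter (\<lambda>x. g x = b) ys = []"
      using len by (auto simp: filter_empty_conv)
    then show ?thesis using xs ys by (simp add: pmf_map_pmf_of_list)
  qed
qed

lemma triples_list: "triples q = set (filter distinct (List.n_lists 3 [1..<Suc q]))"
  by (auto simp: triples_def set_n_lists)

lemma perms_list: "permutations_of_set {..<3::nat} = set (filter distinct (List.n_lists 3 [0..<3]))"
proof -
  have "set xs = {..<3} \<longleftrightarrow> length xs = 3 \<and> set xs \<subseteq> {0..<3}" if "distinct xs" for xs :: "nat list"
  proof
    assume "length xs = 3 \<and> set xs \<subseteq> {0..<3}"
    then show "set xs = {..<3}"
      using card_subset_eq[of "{..<3}" "set xs"] distinct_card[OF that] by (simp add: lessThan_atLeast0)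
  next
    assume xs: "set xs = {..<3}"
    have "length xs = card (set xs)" by (rule distinct_card[OF that, symmetric])
    then show "length xs = 3 \<and> set xs \<subseteq> {0..<3}" by (simp add: xs lessThan_atLeast0)
  qed
  then have iff: "set xs = {..<3} \<and> distinct xs \<longleftrightarrow> (length xs = 3 \<and> set xs \<subseteq> {0..<3}) \<and> distinct xs"
    for xs :: "nat list"
    by (cases "distinct xs") simp_all
  show ?thesis
    unfolding permutations_of_set_def iff by (simp add: set_n_lists conj_ac)
qed

lemma perms3: "filter distinct (List.n_lists 3 [0..<3]) = [[2, 1, 0], [1, 2, 0], [2, 0, 1],
 [0, 2, 1], [1, 0, 2], [0, 1, 2]]" by code_simp
lemma words4: "filter distinct (List.n_lists 3 [1..<Suc 4]) = [[3, 2, 1], [4, 2, 1], [2, 3, 1],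
 [4, 3, 1], [2, 4, 1], [3, 4, 1], [3, 1, 2], [4, 1, 2], [1, 3, 2], [4, 3, 2], [1, 4, 2], [3, 4, 2],
  [2, 1, 3], [4, 1, 3], [1, 2, 3], [4, 2, 3], [1, 4, 3], [2, 4, 3], [2, 1, 4], [3, 1, 4], [1, 2, 4],
   [3, 2, 4], [1, 3, 4], [2, 3, 4]]" by code_simp
lemma words3: "filter distinct (List.n_lists 3 [1..<Suc 3]) = [[3, 2, 1], [2, 3, 1], [3, 1, 2],
 [1, 3, 2], [2, 1, 3], [1, 2, 3]]" by code_simp
lemma bools: "List.n_lists 3 [True, False] = [[True, True, True], [False, True, True],
 [True, False, True], [False, False, True], [True, True, False], [False, True, False],
  [True, False, False], [False, False, False]]" by code_simp

lemma desc_base: "map_pmf (map (\<lambda>a. a \<in> {1, 2})) (necklace 4 0) = map_pmf cyc_desc (perms 3)"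
  unfolding perms_def necklace.simps triples_list perms_list perms3 words4
  by (rule base_law_eqI[where n = 3]) (simp_all add: bools cyc_desc_def)

lemma peaks_base: "map_pmf (map (\<lambda>a. a = 1)) (necklace 3 0) = map_pmf cyc_peaks (perms 3)"
  unfolding perms_def necklace.simps triples_list perms_list perms3 words3
  by (rule base_law_eqI[where n = 3]) (simp_all add: bools cyc_peaks_def)

lemma bits_base: "map_pmf (map (\<lambda>a. a = 1)) (necklace 4 0)
  = map_pmf cyc_desc (pmf_of_set (set (List.n_lists 3 [True, False])))"
  unfolding necklace.simps triples_list bools words4
  by (rule base_law_eqI[where n = 3]) (simp_all add: bools cyc_desc_def)

section \<open>Descents of a random permutation\<close>

lemma perms_reflect: "map_pmf (map (\<lambda>x. n - 1 - x)) (perms n) = perms n"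
proof -
  have inj: "inj_on (\<lambda>x. n - 1 - x) {..<n}" by (auto simp: inj_on_def)
  moreover have "(\<lambda>x. n - 1 - x) ` {..<n} \<subseteq> {..<n}" by auto
  ultimately have img: "(\<lambda>x. n - 1 - x) ` {..<n} = {..<n}"
    by (intro card_subset_eq) (simp_all add: card_image)
  have "inj_on (map (\<lambda>x. n - 1 - x)) (permutations_of_set {..<n})"
    by (rule inj_on_mapI, rule inj_on_subset[OF inj]) (auto simp: permutations_of_set_def)
  then show ?thesis
    using permutations_of_set_image_inj[OF inj] img
    by (simp add: perms_def map_pmf_of_set_inj)
qed

lemma cyc_desc_reflect:
  fixes n :: nat
  assumes "l \<in> permutations_of_set {..<n}" "n \<ge> 2"
  shows "cyc_desc (map (\<lambda>x. n - 1 - x) l) = map Not (cyc_desc l)"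
proof (rule nth_equalityI)
  have l: "length l = n" "distinct l" "set l = {..<n}"
    using assms(1) length_finite_permutations_of_set[OF assms(1)]
    by (auto simp: permutations_of_set_def)
  fix i assume "i < length (cyc_desc (map (\<lambda>x. n - 1 - x) l))"
  then have i: "i < n" using l by simp
  let ?j = "Suc i mod n"
  have j: "?j < n" "?j \<noteq> i" using i assms(2) by (auto simp: mod_Suc)
  then have "l ! i \<noteq> l ! ?j" using l i by (simp add: nth_eq_iff_index_eq)
  moreover have "l ! i \<in> set l" "l ! ?j \<in> set l" using l(1) i j by simp_all
  then have "l ! i < n" "l ! ?j < n" unfolding l(3) by simp_all
  moreover have "cyc_desc (map (\<lambda>x. n - 1 - x) l) ! i \<longleftrightarrow> n - 1 - l ! i > n - 1 - l ! ?j"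
    "map Not (cyc_desc l) ! i \<longleftrightarrow> \<not> l ! i > l ! ?j"
    using l(1) i j by (simp_all add: nth_cyc_desc)
  ultimately show "cyc_desc (map (\<lambda>x. n - 1 - x) l) ! i = map Not (cyc_desc l) ! i"
    by linarith
qed simp

text \<open>Reversing the order of the values exchanges ascents and descents.\<close>

lemma pmf_desc_complement:
  assumes "n \<ge> 2"
  shows "pmf (map_pmf cyc_desc (perms n)) (map Not y) = pmf (map_pmf cyc_desc (perms n)) y"
proof -
  let ?s = "map_pmf cyc_desc (perms n)"
  have "?s = map_pmf cyc_desc (map_pmf (map (\<lambda>x. n - 1 - x)) (perms n))"
    by (simp only: perms_reflect)
  also have "\<dots> = map_pmf (map Not) ?s"
    unfolding map_pmf_comp
    by (intro map_pmf_cong refl cyc_desc_reflect) (use assms in \<open>auto simp: set_perms\<close>)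
  finally have "pmf ?s (map Not y) = pmf (map_pmf (map Not) ?s) (map Not y)" by simp
  also have "\<dots> = pmf ?s y"
    by (rule pmf_map_inj') (auto simp: inj_def)
  finally show ?thesis .
qed

text \<open>The letter that is overwritten by the new maximum is summed out.\<close>

lemma pmf_insert_max_desc:
  assumes "\<And>y. y \<in> set_pmf s \<Longrightarrow> y \<noteq> []"
  shows "pmf (map_pmf (\<lambda>y. butlast y @ [False, True]) s) (u @ [a, b])
    = of_bool (\<not> a \<and> b) * (pmf s (u @ [False]) + pmf s (u @ [True]))"
proof (cases "\<not> a \<and> b")
  case True
  have "(\<lambda>y. butlast y @ [False, True]) -` {u @ [a, b]} \<inter> set_pmf s
    = {u @ [False], u @ [True]} \<inter> set_pmf s"
  proof (intro set_eqI iffI)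
    fix y assume "y \<in> (\<lambda>y. butlast y @ [False, True]) -` {u @ [a, b]} \<inter> set_pmf s"
    then show "y \<in> {u @ [False], u @ [True]} \<inter> set_pmf s"
      using assms[of y] by (cases y rule: rev_cases) auto
  qed (use True in auto)
  then have "pmf (map_pmf (\<lambda>y. butlast y @ [False, True]) s) (u @ [a, b])
    = measure s {u @ [False], u @ [True]}"
    unfolding pmf_map by (metis measure_Int_set_pmf)
  then show ?thesis using True by (simp add: measure_measure_pmf_finite)
next
  case False
  then have "u @ [a, b] \<notin> (\<lambda>y. butlast y @ [False, True]) ` set_pmf s" by auto
  then show ?thesis unfolding pmf_map_outside[OF \<open>u @ [a, b] \<notin> _\<close>] using False by simp
qed

lemma perms_bounded: "l \<in> set_pmf (perms n) \<Longrightarrow> \<forall>x\<in>set l. x < n"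
  by (simp add: set_perms permutations_of_set_def)

lemma perms_Suc_map:
  assumes "\<And>z. f (rotate1 z) = rotate1 (f z)" "\<And>z. length (f z) = length z"
    and "\<And>l. length l = n \<Longrightarrow> \<forall>x\<in>set l. x < n \<Longrightarrow> f (l @ [n]) = h (f l)"
  shows "map_pmf f (perms (Suc n)) = spin (map_pmf h (map_pmf f (perms n)))"
proof -
  have "map_pmf f (perms (Suc n)) = spin (map_pmf (\<lambda>l. f (l @ [n])) (perms n))"
    unfolding perms_Suc map_spin_equivariant[of f, OF assms(1,2)] by (simp add: map_pmf_comp)
  also have "map_pmf (\<lambda>l. f (l @ [n])) (perms n) = map_pmf (\<lambda>l. h (f l)) (perms n)"
    by (intro map_pmf_cong refl assms(3) length_perms perms_bounded)
  finally show ?thesis by (simp add: map_pmf_comp)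
qed

text \<open>Let \<open>S\<close> be the common law of the shorter patterns. For the colors, the weight of a word that ends
  with \<open>a\<close>, \<open>b\<close> consists of two parts: \<open>b\<close> may differ from the letter before it or from the first
  letter. After rotating the second part, the rotation sum runs over all pairs of unequal neighbors,
  and each pair contributes half the probability of the two words in which one letter of the pair is
  deleted. For permutations, only the pairs formed by an ascent followed by a descent contribute, but
  with the full probability. By symmetry under complement the pairs formed by a descent followed by
  an ascent have the same total, so the two rotation sums agree.\<close>

theorem necklace_descents:
  "map_pmf (map (\<lambda>a. a \<in> {1, 2})) (necklace 4 m) = map_pmf cyc_desc (perms (m + 3))"
proof (induction m)
  case 0
  show ?case using desc_base by simp
next
  case (Suc m)
  let ?\<pi> = "\<lambda>a::nat. a \<in> {1, 2}"
  let ?N = "m + 4"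
  define s where "s = map_pmf (map ?\<pi>) (necklace 4 m)"
  define S where "S = pmf s"
  define p where "p = map_pmf (map ?\<pi>) (necklace 4 m \<bind> add_bead 4)"
  define p' where "p' = map_pmf (\<lambda>y. butlast y @ [False, True]) s"
  have IH: "s = map_pmf cyc_desc (perms (m + 3))" using Suc s_def by simp
  have lens: "length y = m + 3" if "y \<in> set_pmf s" for y
    using that by (auto simp: s_def dest: necklace_support[rotated])
  have lenp: "length y = ?N" if "y \<in> set_pmf p" for y
    using that length_add_bead_support[of 4 _ m] by (auto simp: p_def simp del: set_bind_pmf)
  have lenp': "length y = ?N" if "y \<in> set_pmf p'" for y
    using that lens by (auto simp: p'_def)
  have lhs: "map_pmf (map ?\<pi>) (necklace 4 (Suc m)) = spin p"
    by (simp add: p_def map_spin)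
  have "map_pmf cyc_desc (perms (Suc (m + 3)))
    = spin (map_pmf (\<lambda>y. butlast y @ [False, True]) (map_pmf cyc_desc (perms (m + 3))))"
    by (rule perms_Suc_map) (auto simp: cyc_desc_rotate1 intro!: cyc_desc_append_max)
  then have rhs: "map_pmf cyc_desc (perms (Suc (m + 3))) = spin p'"
    by (simp add: p'_def IH)
  have rotS: "S (b # u) = S (u @ [b])" for b u
    using pmf_map_necklace_rotate1[of 4 ?\<pi> m "b # u"] by (simp add: S_def s_def)
  have p: "pmf p (u @ [a, b]) = S (u @ [a]) * (2 - of_bool (hd (u @ [a]) = b) - of_bool (a
    = b)) / 2" for u a b
  proof -
    have "{c\<in>{1..4}. ?\<pi> c = b} = (if b then {1,2} else {3,4})" by auto
    then have "real (card {c\<in>{1..4}. ?\<pi> c = b}) = 2" by simp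
    then show ?thesis
      using pmf_projected_bead[of 4 ?\<pi> m "u @ [a]" b] unfolding p_def S_def s_def by simp
  qed
  define D where "D z = S (butlast (butlast z) @ [False]) + S (butlast (butlast z) @ [True])" for z
  have Dab: "D (u @ [a, b]) = S (u @ [False]) + S (u @ [True])" for u a b
    by (simp add: D_def butlast_append)
  have p': "pmf p' (u @ [a, b]) = of_bool (\<not> a \<and> b) * D (u @ [a, b])" for u a b
    unfolding p'_def Dab S_def by (rule pmf_insert_max_desc) (use lens in force)
  have compl: "S (map Not y) = S y" for y
    unfolding S_def IH by (rule pmf_desc_complement) simp
  have "cycsum (pmf p) y = cycsum (pmf p') y" if y: "length y = ?N" for y
  proof -
    have "cycsum (pmf p') y = ?N * pmf (spin p') y"
      using pmf_spin[of p' ?N y] lenp' y by simp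
    also have "\<dots> = ?N * pmf (spin p') (map Not y)"
      by (simp add: rhs[symmetric] pmf_desc_complement)
    also have "\<dots> = cycsum (pmf p') (map Not y)"
      using pmf_spin[of p' ?N "map Not y"] lenp' y by simp
    also have "\<dots> = cycsum (\<lambda>z. of_bool (last (butlast z) \<and> \<not> last z) * D z) y"
      unfolding cycsum_map
    proof (rule cycsum_cong_last_two, goal_cases)
      case (1 u a b)
      have "S (map Not u @ [c]) = S (u @ [\<not> c])" for c
        using compl[of "u @ [\<not> c]"] by simp
      then show ?case
        using p'[of "map Not u" "\<not> a" "\<not> b"] by (simp add: Dab butlast_append)
    qed (use y in simp)
    finally have "2 * cycsum (pmf p') y = cycsum (pmf p') y + \<dots>" by simp
    also have "\<dots> = cycsum (\<lambda>z. of_bool (last (butlast z) \<noteq> last z) * D z) y"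
      unfolding cycsum_add[symmetric]
      by (rule cycsum_cong_last_two) (use y in \<open>auto simp: p' butlast_append\<close>)
    finally have rhs2: "2 * cycsum (pmf p') y = \<dots>" .
    have "2 * cycsum (pmf p) y = cycsum (\<lambda>z. of_bool (last (butlast z) \<noteq> last z) * S (butlast z)) y
        + cycsum (\<lambda>z. of_bool (hd z \<noteq> last z) * S (butlast z)) y"
      unfolding cycsum_add[symmetric] cycsum_cmult[symmetric]
      by (rule cycsum_cong_last_two) (use y in \<open>auto simp: p butlast_append hd_append\<close>)
    also have "cycsum (\<lambda>z. of_bool (hd z \<noteq> last z) * S (butlast z)) y
        = cycsum (\<lambda>z. of_bool (last (butlast z) \<noteq> last z) * S (butlast (butlast z) @ [last z])) y"
      by (rule cycsum_move_last) (use y in \<open>auto simp: butlast_append rotS\<close>)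
    also have "cycsum (\<lambda>z. of_bool (last (butlast z) \<noteq> last z) * S (butlast z)) y + \<dots>
        = cycsum (\<lambda>z. of_bool (last (butlast z) \<noteq> last z) * D z) y"
      unfolding cycsum_add[symmetric]
    proof (rule cycsum_cong_last_two, goal_cases)
      case (1 u a b)
      show ?case by (cases a; cases b) (simp_all add: Dab butlast_append)
    qed (use y in simp)
    finally show ?thesis using rhs2 by simp
  qed
  then have "spin p = spin p'"
    by (intro spin_cong[where N = ?N]) (use lenp lenp' in auto)
  with lhs rhs show ?case by simp
qed


section \<open>Peaks of a random permutation\<close>

lemma pmf_insert_max_peaks:
  assumes "\<And>y. y \<in> set_pmf s \<Longrightarrow> length y \<ge> 2"
  shows "pmf (map_pmf (\<lambda>y. False # butlast (tl y) @ [False, True]) s) (c # v @ [a, b])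
    = of_bool (\<not> c \<and> \<not> a \<and> b) * (pmf s (False # v @ [False]) + pmf s (False # v @ [True])
        + pmf s (True # v @ [False]) + pmf s (True # v @ [True]))"
proof (cases "\<not> c \<and> \<not> a \<and> b")
  case True
  let ?A = "{False # v @ [False], False # v @ [True], True # v @ [False], True # v @ [True]}"
  have "(\<lambda>y. False # butlast (tl y) @ [False, True]) -` {c # v @ [a, b]} \<inter> set_pmf s = ?A \<inter> set_pmf s"
  proof (intro set_eqI iffI)
    fix y assume y: "y \<in> (\<lambda>y. False # butlast (tl y) @ [False, True]) -` {c # v @ [a, b]} \<inter> set_pmf s"
    then have "length y \<ge> 2" using assms by auto
    then obtain d w where w: "y = d # w" "w \<noteq> []" by (cases y; cases "tl y") auto
    then obtain w' e where "w = w' @ [e]" by (cases w rule: rev_cases) auto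
    with w y show "y \<in> ?A \<inter> set_pmf s" by auto
  qed (use True in auto)
  then have "pmf (map_pmf (\<lambda>y. False # butlast (tl y) @ [False, True]) s) (c # v @ [a, b])
    = measure s ?A"
    unfolding pmf_map by (metis measure_Int_set_pmf)
  then show ?thesis using True by (simp add: measure_measure_pmf_finite)
next
  case False
  then have "c # v @ [a, b] \<notin> (\<lambda>y. False # butlast (tl y) @ [False, True]) ` set_pmf s" by auto
  then show ?thesis unfolding pmf_map_outside[OF \<open>c # v @ [a, b] \<notin> _\<close>] using False by simp
qed

lemma cyc_peaks_ends:
  assumes "length l \<ge> 2" "hd (cyc_peaks l)" "last (cyc_peaks l)"
  shows False
proof -
  obtain k where k: "length l = Suc k" "k \<noteq> 0" using assms(1) by (cases "length l") auto
  then have "cyc_peaks l \<noteq> []" by (metis length_cyc_peaks list.size(3) nat.distinct(1))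
  then have "cyc_peaks l ! 0" "cyc_peaks l ! k"
    using assms k by (simp_all add: hd_conv_nth last_conv_nth)
  then have "l ! k < l ! 0" "l ! 0 < l ! k"
    using k by (simp_all add: nth_cyc_peaks)
  then show False by simp
qed

text \<open>Two cyclically adjacent letters are never both peaks, so \<open>S\<close>, the law of the shorter patterns,
  vanishes on words in which this happens. Apart from such words the weights of the colors are 1 for
  deleting a peak and 1 for each peak next to a deleted non-peak. Attributing the latter to the peak,
  every peak contributes the three words obtained by deleting it, its left neighbor or its right
  neighbor. These are the three patterns with at most one peak among two adjacent places in which a
  maximum can be inserted to produce this peak.\<close>

theorem necklace_peaks:
  "map_pmf (map (\<lambda>a. a = 1)) (necklace 3 m) = map_pmf cyc_peaks (perms (m + 3))"
proof (induction m)
  case 0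
  show ?case using peaks_base by simp
next
  case (Suc m)
  let ?\<pi> = "\<lambda>a::nat. a = 1"
  let ?N = "m + 4"
  define s where "s = map_pmf (map ?\<pi>) (necklace 3 m)"
  define S where "S = pmf s"
  define p where "p = map_pmf (map ?\<pi>) (necklace 3 m \<bind> add_bead 3)"
  define p' where "p' = map_pmf (\<lambda>y. False # butlast (tl y) @ [False, True]) s"
  have IH: "s = map_pmf cyc_peaks (perms (m + 3))" using Suc s_def by simp
  have lens: "length y = m + 3" if "y \<in> set_pmf s" for y
    using that by (auto simp: s_def dest: necklace_support[rotated])
  have lenp: "length y = ?N" if "y \<in> set_pmf p" for y
    using that length_add_bead_support[of 3 _ m] by (auto simp: p_def simp del: set_bind_pmf)
  have lenp': "length y = ?N" if "y \<in> set_pmf p'" for y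
    using that lens by (auto simp: p'_def)
  have lhs: "map_pmf (map ?\<pi>) (necklace 3 (Suc m)) = spin p"
    by (simp add: p_def map_spin)
  have "map_pmf cyc_peaks (perms (Suc (m + 3)))
    = spin (map_pmf (\<lambda>y. False # butlast (tl y) @ [False, True]) (map_pmf cyc_peaks (perms (m + 3))))"
    by (rule perms_Suc_map) (auto simp: cyc_peaks_rotate1 intro!: cyc_peaks_append_max)
  then have rhs: "map_pmf cyc_peaks (perms (Suc (m + 3))) = spin p'"
    by (simp add: p'_def IH)
  have rotS: "S (b # u) = S (u @ [b])" for b u
    using pmf_map_necklace_rotate1[of 3 ?\<pi> m "b # u"] by (simp add: S_def s_def)
  \<comment> \<open>The first and the last letter are cyclic neighbors.\<close>
  have S0: "S (True # v @ [True]) = 0" for v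
  proof -
    have "True # v @ [True] \<notin> set_pmf s"
    proof
      assume "True # v @ [True] \<in> set_pmf s"
      then obtain l where l: "l \<in> set_pmf (perms (m + 3))" "cyc_peaks l = True # v @ [True]"
        unfolding IH set_map_pmf by force
      show False
        by (rule cyc_peaks_ends[of l]) (simp_all add: l length_perms[OF l(1)])
    qed
    then show ?thesis by (simp add: S_def set_pmf_iff)
  qed
  have p: "pmf p (u @ [a, b]) = S (u @ [a]) * ((if b then 1 else 2) - of_bool (hd (u @ [a])
    = b) - of_bool (a = b))" for u a b
  proof -
    have "{c\<in>{1..3}. ?\<pi> c = b} = (if b then {1} else {2,3})" by auto
    then have "real (card {c\<in>{1..3}. ?\<pi> c = b}) = (if b then 1 else 2)" by simp
    then show ?thesis
      using pmf_projected_bead[of 3 ?\<pi> m "u @ [a]" b] unfolding p_def S_def s_def by simp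
  qed
  have p': "pmf p' (c # v @ [a, b]) = of_bool (\<not> c \<and> \<not> a \<and> b) *
      (S (False # v @ [False]) + S (False # v @ [True]) + S (True # v @ [False]))" for c v a b
  proof -
    have "length y \<ge> 2" if "y \<in> set_pmf s" for y using lens[OF that] by simp
    then show ?thesis
      using pmf_insert_max_peaks[of s c v a b] unfolding p'_def[symmetric] S_def[symmetric]
      by (simp add: S0)
  qed
  have "cycsum (pmf p) y = cycsum (pmf p') y" if y: "length y = ?N" for y
  proof -
    have "cycsum (pmf p) y
        = cycsum (\<lambda>z. of_bool (last z \<and> \<not> last (butlast z) \<and> \<not> hd z) * S (butlast z)) y
        + (cycsum (\<lambda>z. of_bool (\<not> last z \<and> last (butlast z)) * S (butlast z)) y
        + cycsum (\<lambda>z. of_bool (\<not> last z \<and> hd z) * S (butlast z)) y)"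
      unfolding cycsum_add[symmetric]
    proof (rule cycsum_cong_ends, goal_cases)
      case (1 c v a b)
      show ?case
        using p[of "c # v" a b] by (cases a; cases b; cases c) (simp_all add: butlast_append S0)
    qed (use y in simp)
    also have "cycsum (\<lambda>z. of_bool (\<not> last z \<and> last (butlast z)) * S (butlast z)) y
        = cycsum (\<lambda>z. of_bool (\<not> hd z \<and> last z) * S (tl z)) y"
      by (rule cycsum_move_last[symmetric]) (use y in \<open>auto simp: butlast_append\<close>)
    also have "cycsum (\<lambda>z. of_bool (\<not> last z \<and> hd z) * S (butlast z)) y
        = cycsum (\<lambda>z. of_bool (\<not> last (butlast z) \<and> last z) * S (butlast (butlast z) @ [last z])) y"
      by (rule cycsum_move_last) (use y in \<open>auto simp: butlast_append rotS\<close>)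
    also have "cycsum (\<lambda>z. of_bool (last z \<and> \<not> last (butlast z) \<and> \<not> hd z) * S (butlast z)) y +
        (cycsum (\<lambda>z. of_bool (\<not> hd z \<and> last z) * S (tl z)) y + \<dots>) = cycsum (pmf p') y"
      unfolding cycsum_add[symmetric]
    proof (rule cycsum_cong_ends, goal_cases)
      case (1 c v a b)
      have "S (v @ [a, True]) = S (True # v @ [a])" for a
        using rotS[of True "v @ [a]"] by simp
      then show ?case
        unfolding p' by (cases a; cases b; cases c) (simp_all add: butlast_append S0)
    qed (use y in simp)
    finally show ?thesis .
  qed
  then have "spin p = spin p'"
    by (intro spin_cong[where N = ?N]) (use lenp lenp' in auto)
  with lhs rhs show ?case by simp
qed

section \<open>Descents of fair bits\<close>

text \<open>The number of bit words from \<open>s\<close> to \<open>t\<close> with prescribed descents: an entry of a product of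
  transfer matrices, where a descent only allows the step from \<open>True\<close> to \<open>False\<close> and a non-descent
  allows the three other steps.\<close>

fun walks :: "bool list \<Rightarrow> bool \<Rightarrow> bool \<Rightarrow> real" where
  "walks [] s t = of_bool (s = t)"
| "walks (a # y) s t = of_bool (\<not> a) * walks y True t + of_bool (s = a) * walks y False t"

lemma walks_snoc:
  "walks (y @ [a]) s t = walks y s True * of_bool (a = (\<not> t)) + walks y s False * of_bool (\<not> a)"
  by (induction y arbitrary: s) (auto simp: algebra_simps)

text \<open>The trace of the product of transfer matrices.\<close>

definition loops :: "bool list \<Rightarrow> real" where
  "loops y = walks y True True + walks y False False"

lemma loops_rotate1: "loops (rotate1 y) = loops y"
  by (cases y) (auto simp: loops_def walks_snoc)

lemma card_first_letter:
  fixes A A' :: "bool list set"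
  assumes "finite A" "finite A'"
  shows "card ((if P then (#) True ` A else {}) \<union> (if Q then (#) False ` A' else {}))
    = of_bool P * card A + of_bool Q * card A'"
proof -
  have "card ((#) True ` A \<union> (#) False ` A') = card ((#) True ` A) + card ((#) False ` A')"
    by (rule card_Un_disjoint) (use assms in auto)
  moreover have "card ((#) c ` C) = card C" for c :: bool and C
    by (rule card_image) simp
  ultimately show ?thesis by (cases P; cases Q) simp_all
qed

lemma card_walks:
  assumes "y \<noteq> []"
  shows "real (card {b. length b + 1 = length y \<and> map2 (>) (s # b) (b @ [t]) = y}) = walks y s t"
  using assms
proof (induction y arbitrary: s)
  case (Cons a y)
  note IH = Cons.IH
  show ?case
  proof (cases y)
    case Nil
    have "{b. length b + 1 = length (a # y) \<and> map2 (>) (s # b) (b @ [t]) = a # y}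
        = (if (s > t) = a then {[]} else {})"
      using Nil by auto
    then show ?thesis using Nil by auto
  next
    case (Cons a' y')
    then have ne: "y \<noteq> []" by simp
    let ?T = "\<lambda>s. {b. length b + 1 = length y \<and> map2 (>) (s # b) (b @ [t]) = y}"
    have fin: "finite (?T c)" for c
      by (rule finite_subset[OF _ finite_lists_length_eq[of "UNIV :: bool set" "length y - 1"]]) auto
    have eq: "{b. length b + 1 = length (a # y) \<and> map2 (>) (s # b) (b @ [t]) = a # y}
        = (if \<not> a then (#) True ` ?T True else {}) \<union> (if s = a then (#) False ` ?T False else {})"
      (is "?L = ?R")
    proof (rule set_eqI)
      fix b
      show "b \<in> ?L \<longleftrightarrow> b \<in> ?R"
        using Cons by (cases b; cases "hd b"; cases a; cases s) auto
    qed
    show ?thesis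
      unfolding eq card_first_letter[OF fin fin] of_nat_add of_nat_mult of_nat_of_bool IH[OF ne]
        walks.simps ..
  qed
qed simp

definition bits :: "nat \<Rightarrow> bool list pmf" where
  "bits n = pmf_of_set (set (List.n_lists n [True, False]))"

lemma n_lists_nonempty: "set (List.n_lists n [True, False]) \<noteq> {}"
  by (auto simp: set_n_lists intro!: exI[of _ "replicate n True"])

lemma set_bits: "set_pmf (bits n) = {b. length b = n}"
  unfolding bits_def by (subst set_pmf_of_set[OF n_lists_nonempty]) (simp, auto simp: set_n_lists)

lemma card_n_lists: "card (set (List.n_lists n [True, False])) = 2 ^ n"
  using distinct_card[OF distinct_n_lists[of "[True, False]" n]]
  by (simp add: length_n_lists numeral_2_eq_2)

lemma pmf_bits:
  assumes "length b = n"
  shows "pmf (bits n) b = 1 / 2 ^ n"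
proof -
  have "b \<in> set (List.n_lists n [True, False])" using assms by (auto simp: set_n_lists)
  then show ?thesis
    unfolding bits_def pmf_of_set[OF n_lists_nonempty finite_set] by (simp add: card_n_lists)
qed

lemma pmf_bits_desc:
  assumes "length y = n" "n > 0"
  shows "pmf (map_pmf cyc_desc (bits n)) y = loops y / 2 ^ n"
proof -
  let ?T = "\<lambda>s::bool. {b. length b + 1 = length y \<and> map2 (>) (s # b) (b @ [s]) = y}"
  have fin: "finite (?T c)" for c
    by (rule finite_subset[OF _ finite_lists_length_eq[of "UNIV :: bool set" "length y - 1"]]) auto
  have ne: "y \<noteq> []" using assms by auto
  have "pmf (map_pmf cyc_desc (bits n)) y
      = card (set (List.n_lists n [True,
        False]) \<inter> cyc_desc -` {y}) / card (set (List.n_lists n [True, False]))"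
    unfolding pmf_map bits_def by (rule measure_pmf_of_set[OF n_lists_nonempty]) simp
  also have "set (List.n_lists n [True, False]) \<inter> cyc_desc -` {y}
    = (#) True ` ?T True \<union> (#) False ` ?T False"
    (is "?L = ?R")
  proof (rule set_eqI)
    fix b
    show "b \<in> ?L \<longleftrightarrow> b \<in> ?R"
      using assms by (cases b; cases "hd b") (auto simp: set_n_lists cyc_desc_def)
  qed
  also have "card \<dots> = card (?T True) + card (?T False)"
    using card_first_letter[OF fin fin, of True True True False] by simp
  finally have "pmf (map_pmf cyc_desc (bits n)) y
    = (real (card (?T True)) + real (card (?T False))) / 2 ^ n"
    by (simp only: card_n_lists of_nat_add of_nat_power of_nat_numeral)
  then show ?thesis
    by (simp only: card_walks[OF ne] loops_def)
qed

text \<open>Let \<open>M a\<close> be the transfer matrix of the letter \<open>a\<close>, let \<open>e a\<close> be the sign that is negative for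
  \<open>True\<close>, and put \<open>X a = (e a / 2) diag(1, -1)\<close>. Up to normalization, the weights of the colors give
  the coefficients \<open>1/2 + e b [a]\<close> to the word without \<open>b\<close> and, after a rotation, \<open>1/2 + e a [b]\<close> to
  the word without \<open>a\<close>. For all four choices of \<open>a\<close> and \<open>b\<close>,
  \<open>M a M b = (1/2 + e b [a]) M a + (1/2 + e a [b]) M b + X a M b - M a X b\<close>.
  Under the trace the last two terms differ by one rotation, so that they cancel in the sum over all
  rotations, and the left side gives the trace itself once for every rotation.\<close>

theorem necklace_bits:
  "map_pmf (map (\<lambda>a. a = 1)) (necklace 4 m) = map_pmf cyc_desc (bits (m + 3))"
proof (induction m)
  case 0
  show ?case using bits_base by (simp add: bits_def)
next
  case (Suc m)
  let ?\<pi> = "\<lambda>a::nat. a = 1"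
  let ?N = "m + 4"
  define p where "p = map_pmf (map ?\<pi>) (necklace 4 m \<bind> add_bead 4)"
  have lenp: "length y = ?N" if "y \<in> set_pmf p" for y
    using that length_add_bead_support[of 4 _ m] by (auto simp: p_def simp del: set_bind_pmf)
  have lhs: "map_pmf (map ?\<pi>) (necklace 4 (Suc m)) = spin p"
    by (simp add: p_def map_spin)
  define e :: "bool \<Rightarrow> real" where "e b = (if b then -1 else 1)" for b
  have p: "pmf p (u @ [a, b]) = loops (u @ [a]) / 2 ^ (m + 3)
      * (1 + e b * (of_bool (hd (u @ [a])) + of_bool a)) / 2" if "length u + 2 = ?N" for u a b
  proof -
    have "{c\<in>{1..4}. ?\<pi> c = b} = (if b then {1} else {2,3,4})" by auto
    then have "real (card {c\<in>{1..4}. ?\<pi> c = b}) = (if b then 1 else 3)" by simp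
    moreover have "pmf (map_pmf (map ?\<pi>) (necklace 4 m)) (u @ [a]) = loops (u @ [a]) / 2 ^ (m + 3)"
      using Suc pmf_bits_desc[of "u @ [a]" "m + 3"] that by simp
    ultimately show ?thesis
      using pmf_projected_bead[of 4 ?\<pi> m "u @ [a]" b] unfolding p_def by (auto simp: e_def)
  qed
  have "pmf (spin p) y = pmf (map_pmf cyc_desc (bits (m + 4))) y" for y
  proof (cases "length y = ?N")
    case False
    have "y \<notin> cyc_desc ` set_pmf (bits (m + 4))"
      using False by (auto simp: set_bits)
    then show ?thesis
      using False pmf_spin[of p ?N y] lenp by (simp add: pmf_map_outside)
  next
    case y: True
    \<comment> \<open>The traces that contain \<open>X\<close> in the place of the last and of the second to last letter.\<close>
    define g where "g z = e (last z) / 2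
      * (walks (butlast z) False False - walks (butlast z) True True)" for z
    define g' where "g' z = g (last z # butlast z)" for z
    have "cycsum (\<lambda>z. (1 / 2 + e (last z) * of_bool (hd z)) * loops (butlast z)) y
        = cycsum (\<lambda>z. (1 / 2 + e (last (butlast z)) * of_bool (last z))
          * loops (butlast (butlast z) @ [last z])) y"
    proof (rule cycsum_move_last, goal_cases)
      case (1 u a b)
      have "loops (b # u) = loops (u @ [b])" using loops_rotate1[of "b # u"] by simp
      then show ?case by (simp add: butlast_append)
    qed (use y in simp)
    moreover have "2 ^ ?N * cycsum (pmf p) y
      = cycsum (\<lambda>z. (1 / 2 + e (last z) * of_bool (last (butlast z))) * loops (butlast z)) y
      + cycsum (\<lambda>z. (1 / 2 + e (last z) * of_bool (hd z)) * loops (butlast z)) y"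
      unfolding cycsum_add[symmetric] cycsum_cmult[symmetric]
    proof (rule cycsum_cong_last_two, goal_cases)
      case (1 u a b)
      then show ?case
        using p[of u a b] y by (simp add: butlast_append hd_append power_add field_simps)
    qed (use y in simp)
    moreover have "cycsum (\<lambda>z. (1 / 2 + e (last z) * of_bool (last (butlast z))) * loops (butlast z)) y
      + cycsum (\<lambda>z. (1 / 2 + e (last (butlast z)) * of_bool (last z))
        * loops (butlast (butlast z) @ [last z])) y
      = cycsum (\<lambda>z. loops z - g' z + g z) y"
      unfolding cycsum_add[symmetric]
    proof (rule cycsum_cong_last_two, goal_cases)
      case (1 u a b)
      show ?case
      proof -
        have "walks (u @ [a, b]) s t = walks (u @ [a]) s True * of_bool (b = (\<not> t))
          + walks (u @ [a]) s False * of_bool (\<not> b)" for s t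
          using walks_snoc[of "u @ [a]" b s t] by simp
        then show ?thesis
          by (cases a; cases b)
             (simp_all add: g'_def g_def e_def butlast_append loops_def walks_snoc algebra_simps
               append_Cons[of _ u "[_]", symmetric] del: append_Cons)
      qed
    qed (use y in simp)
    moreover have "cycsum g y = cycsum g' y"
      by (rule cycsum_move_last) (use y in \<open>auto simp: g'_def butlast_append\<close>)
    ultimately have "2 ^ ?N * cycsum (pmf p) y = cycsum loops y"
      by (simp add: cycsum_add cycsum_diff)
    also have "\<dots> = ?N * loops y"
      using cycsum_invariant[of loops y] loops_rotate1 y by simp
    finally have "cycsum (pmf p) y / ?N = loops y / 2 ^ ?N"
      by (simp add: field_simps)
    then show ?thesis
      using pmf_spin[of p ?N y] lenp y pmf_bits_desc[OF y] by simp
  qed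
  then have "spin p = map_pmf cyc_desc (bits (Suc m + 3))"
    by (intro pmf_eqI) (simp add: add.commute)
  with lhs show ?case by simp
qed

section \<open>The faces of the tree\<close>

lemma three_cases:
  obtains "b = a" | "b = a + 1" | "b = a + (2::3)"
proof -
  have "b = a \<or> b = a + 1 \<or> b = a + 2"
    using exhaust_3[of a] exhaust_3[of b] by (elim disjE) simp_all
  then show ?thesis using that by blast
qed

lemma UNIV_three: "(UNIV :: 3 set) = {a, a + 1, a + 2}"
  using three_cases[of _ a] by blast

lemma neighbor_neighbor: "distinct_adj v \<Longrightarrow> neighbor (neighbor v a) a = v"
  by (cases v; cases "tl v") (auto simp: neighbor_def)

lemma distinct_adj_neighbor: "distinct_adj v \<Longrightarrow> distinct_adj (neighbor v a)"
  by (cases v; cases "tl v") (auto simp: neighbor_def)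

lemma next_dart_Pair: "next_dart (v, a) = (neighbor v a, a + 1)"
  by (simp add: next_dart_def rev_dart_def)

lemma next_dart_darts: "d \<in> darts \<Longrightarrow> next_dart d \<in> darts"
  by (cases d) (auto simp: next_dart_Pair darts_def distinct_adj_neighbor)

lemma iterated_next_dart_darts: "d \<in> darts \<Longrightarrow> (next_dart ^^ k) d \<in> darts"
  by (induction k) (auto intro: next_dart_darts)

lemma next_dart_inj:
  assumes "d \<in> darts" "e \<in> darts" "next_dart d = next_dart e"
  shows "d = e"
proof -
  obtain v a w b where de: "d = (v, a)" "e = (w, b)" by (cases d, cases e) auto
  then have "a = b" "neighbor v a = neighbor w b" using assms by (auto simp: next_dart_Pair)
  moreover have "distinct_adj v" "distinct_adj w" using assms de by (auto simp: darts_def)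
  ultimately have "v = w" using neighbor_neighbor by metis
  with de \<open>a = b\<close> show ?thesis by simp
qed

text \<open>The map \<open>next_dart\<close> is injective, so its orbits can be traced in both directions.\<close>

lemma left_face_next_dart:
  assumes d: "d \<in> darts"
  shows "left_face (next_dart d) = left_face d"
proof -
  have "(\<exists>k. (next_dart ^^ k) (next_dart d) = e \<or> (next_dart ^^ k) e = next_dart d)
      \<longleftrightarrow> (\<exists>k. (next_dart ^^ k) d = e \<or> (next_dart ^^ k) e = d)" (is "?l \<longleftrightarrow> ?r")
    if e: "e \<in> darts" for e
  proof
    assume ?l
    then obtain k where "(next_dart ^^ k) (next_dart d) = e \<or> (next_dart ^^ k) e = next_dart d" by blast
    then show ?r
    proof
      assume "(next_dart ^^ k) (next_dart d) = e"
      then have "(next_dart ^^ Suc k) d = e" by (simp add: funpow_swap1)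
      then show ?r by blast
    next
      assume k: "(next_dart ^^ k) e = next_dart d"
      show ?r
      proof (cases k)
        case 0
        then have "(next_dart ^^ 1) d = e" using k by simp
        then show ?r by blast
      next
        case (Suc j)
        then have "next_dart ((next_dart ^^ j) e) = next_dart d" using k by simp
        then have "(next_dart ^^ j) e = d"
          by (rule next_dart_inj[OF iterated_next_dart_darts[OF e] d])
        then show ?r by blast
      qed
    qed
  next
    assume ?r
    then obtain k where "(next_dart ^^ k) d = e \<or> (next_dart ^^ k) e = d" by blast
    then show ?l
    proof
      assume k: "(next_dart ^^ k) d = e"
      show ?l
      proof (cases k)
        case 0
        then have "(next_dart ^^ 1) e = next_dart d" using k by simp
        then show ?l by blast
      next
        case (Suc j)
        then have "(next_dart ^^ j) (next_dart d) = e" using k by (simp add: funpow_swap1)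
        then show ?l by blast
      qed
    next
      assume "(next_dart ^^ k) e = d"
      then have "(next_dart ^^ Suc k) e = next_dart d" by simp
      then show ?l by blast
    qed
  qed
  then show ?thesis unfolding left_face_def by blast
qed

lemma left_face_refl: "d \<in> darts \<Longrightarrow> d \<in> left_face d"
  unfolding left_face_def by (auto intro: exI[of _ 0])

lemma left_face_eqD:
  assumes "d \<in> darts" "e \<in> darts" "left_face d = left_face e"
  obtains k where "(next_dart ^^ k) d = e" | k where "(next_dart ^^ k) e = d"
proof -
  have "e \<in> left_face d" using left_face_refl[OF assms(2)] assms(3) by simp
  then show ?thesis using that unfolding left_face_def by blast
qed

text \<open>A proper coloring of the faces with 3 colors: \<open>face_color v b\<close> is the color of the face to
  the left
  of \<open>(v, b)\<close>. The reflection exchanges \<open>a\<close> and \<open>a + 1\<close>, because along the edge \<open>a\<close> the two faces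
  beside it swap their labels, and fixes \<open>a + 2\<close>. Its purpose is to show that the three faces around
  a vertex are different.\<close>

fun face_color :: "vertex \<Rightarrow> 3 \<Rightarrow> 3" where
  "face_color [] b = b"
| "face_color (a # v) b = face_color v (2 * a + 1 - b)"

lemma face_color_neighbor: "face_color (neighbor v a) b = face_color v (2 * a + 1 - b)"
  by (cases v) (auto simp: neighbor_def)

lemma face_color_inj: "face_color v b = face_color v c \<Longrightarrow> b = c"
proof (induction v arbitrary: b c)
  case (Cons a v)
  then have "2 * a + 1 - b = 2 * a + 1 - c" by (metis face_color.simps(2))
  then show ?case by simp
qed simp

lemma face_color_left_face:
  assumes "(v, a) \<in> darts" "(w, b) \<in> darts" "left_face (v, a) = left_face (w, b)"
  shows "face_color v a = face_color w b"
proof -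
  define f where "f d = face_color (fst d) (snd d)" for d :: dart
  have "f (next_dart d) = f d" for d
    by (cases d) (simp add: f_def next_dart_Pair face_color_neighbor)
  then have "f ((next_dart ^^ k) d) = f d" for k d
    by (induction k) simp_all
  then have "f (v, a) = f (w, b)"
    using left_face_eqD[OF assms] by metis
  then show ?thesis by (simp add: f_def)
qed

lemma left_face_at_vertex:
  assumes "distinct_adj v"
  shows "left_face (v, a) = left_face (v, b) \<longleftrightarrow> a = b"
  using face_color_left_face[of v a v b] face_color_inj assms by (auto simp: darts_def)

lemma right_face_Pair:
  assumes "distinct_adj v"
  shows "right_face (v, a) = left_face (v, a + 1)"
proof -
  have "next_dart (neighbor v a, a) = (v, a + 1)"
    by (simp add: next_dart_Pair neighbor_neighbor assms)
  moreover have "(neighbor v a, a) \<in> darts"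
    using assms by (simp add: darts_def distinct_adj_neighbor)
  ultimately show ?thesis
    using left_face_next_dart[of "(neighbor v a, a)"] by (simp add: right_face_def rev_dart_def)
qed

lemma left_face_neighbor:
  assumes "distinct_adj v"
  shows "left_face (neighbor v a, a) = left_face (v, a + 1)"
    and "left_face (neighbor v a, a + 1) = left_face (v, a)"
  using right_face_Pair[OF assms, of a] left_face_next_dart[of "(v, a)"] assms
  by (simp_all add: right_face_def rev_dart_def next_dart_Pair darts_def)

lemma dual_adj_sym: "dual_adj f g \<Longrightarrow> dual_adj g f"
proof -
  have "rev_dart d \<in> darts" "rev_dart (rev_dart d) = d" if "d \<in> darts" for d
    using that by (cases d; simp add: rev_dart_def darts_def distinct_adj_neighbor neighbor_neighbor)+
  then show "dual_adj f g \<Longrightarrow> dual_adj g f"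
    unfolding dual_adj_def right_face_def by metis
qed

lemma dual_adj_irrefl: "\<not> dual_adj f f"
proof
  assume "dual_adj f f"
  then obtain v a where "distinct_adj v" "left_face (v, a) = right_face (v, a)"
    by (auto simp: dual_adj_def darts_def)
  then show False by (simp add: right_face_Pair left_face_at_vertex)
qed

lemma dual_adj_at_vertex:
  assumes "distinct_adj v" "a \<noteq> b"
  shows "dual_adj (left_face (v, a)) (left_face (v, b))"
proof -
  have succ: "dual_adj (left_face (v, c)) (left_face (v, c + 1))" for c
    using assms(1) right_face_Pair[OF assms(1), of c] by (auto simp: dual_adj_def darts_def)
  show ?thesis
  proof (cases b a rule: three_cases)
    case 2
    then show ?thesis using succ[of a] by simp
  next
    case 3
    have "b + 1 = a" unfolding 3 by simp
    then show ?thesis using dual_adj_sym[OF succ[of b]] by simp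
  qed (use assms in simp)
qed

text \<open>Words are stored in reverse, so these are the vertices whose path to the root passes through
  \<open>w\<close>: the part of the tree cut off by the edge between \<open>w\<close> and its parent.\<close>

definition branch :: "vertex \<Rightarrow> vertex set" where
  "branch w = {x. \<exists>u. x = u @ w}"

lemma branch_Cons: "x \<in> branch w \<Longrightarrow> c # x \<in> branch w"
  unfolding branch_def by (auto intro: exI[of _ "c # _"])

lemma branch_tl: "x \<in> branch w \<Longrightarrow> x \<noteq> w \<Longrightarrow> tl x \<in> branch w"
proof -
  assume "x \<in> branch w" "x \<noteq> w"
  then obtain u where "x = u @ w" "u \<noteq> []" by (auto simp: branch_def)
  then show ?thesis by (cases u) (auto simp: branch_def)
qed

lemma branch_ConsD: "c # x \<in> branch w \<Longrightarrow> c # x \<noteq> w \<Longrightarrow> x \<in> branch w"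
  using branch_tl[of "c # x" w] by simp

lemma enter_branch:
  assumes "x \<notin> branch (a # v)" "neighbor x c \<in> branch (a # v)"
  shows "x = v \<and> c = a"
proof (cases "x \<noteq> [] \<and> hd x = c")
  case True
  then have "neighbor x c = tl x" "x = c # tl x" by (auto simp: neighbor_def)
  then have "x \<in> branch (a # v)" using assms(2) branch_Cons by metis
  then show ?thesis using assms(1) by simp
next
  case False
  then have "c # x \<in> branch (a # v)" using assms(2) by (auto simp: neighbor_def)
  then show ?thesis using branch_ConsD assms(1) by blast
qed

lemma leave_branch:
  assumes "x \<in> branch (a # v)" "neighbor x c \<notin> branch (a # v)"
  shows "x = a # v \<and> c = a"
proof (cases "x \<noteq> [] \<and> hd x = c")
  case True
  then have "tl x \<notin> branch (a # v)" using assms(2) by (simp add: neighbor_def)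
  then have "x = a # v" using branch_tl assms(1) by blast
  then show ?thesis using True by simp
next
  case False
  then show ?thesis using assms branch_Cons by (auto simp: neighbor_def)
qed

text \<open>The boundary of a face is a walk in the tree, and the edge between \<open>v\<close> and \<open>a # v\<close> is the only one
  that joins the branch to the rest. A face that is seen from both sides therefore runs along this
  edge.\<close>

lemma face_crossing:
  assumes de: "(x, c) \<in> darts" "(y, b) \<in> darts" "left_face (x, c) = left_face (y, b)"
    and w: "distinct_adj (a # v)"
    and out: "x \<notin> branch (a # v)" and in_branch: "y \<in> branch (a # v)"
  shows "left_face (x, c) = left_face (v, a) \<or> left_face (x, c) = left_face (v, a + 1)"
proof -
  have enter: "left_face d = left_face (v, a)"
    if "d \<in> darts" "fst d \<notin> branch (a # v)" "fst ((next_dart ^^ k) d) \<in> branch (a # v)" for d k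
    using that
  proof (induction k arbitrary: d)
    case (Suc k)
    show ?case
    proof (cases "fst (next_dart d) \<in> branch (a # v)")
      case True
      then have "d = (v, a)" using enter_branch Suc.prems(2) by (cases d) (auto simp: next_dart_Pair)
      then show ?thesis by simp
    next
      case False
      moreover have "fst ((next_dart ^^ k) (next_dart d)) \<in> branch (a # v)"
        using Suc.prems(3) by (simp add: funpow_swap1)
      ultimately have "left_face (next_dart d) = left_face (v, a)"
        by (intro Suc.IH next_dart_darts Suc.prems(1))
      then show ?thesis by (simp add: left_face_next_dart Suc.prems(1))
    qed
  qed simp
  have leave: "left_face d = left_face (a # v, a)"
    if "d \<in> darts" "fst d \<in> branch (a # v)" "fst ((next_dart ^^ k) d) \<notin> branch (a # v)" for d k
    using that
  proof (induction k arbitrary: d)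
    case (Suc k)
    show ?case
    proof (cases "fst (next_dart d) \<in> branch (a # v)")
      case False
      then have "d = (a # v, a)" using leave_branch Suc.prems(2)
        by (cases d) (auto simp: next_dart_Pair)
      then show ?thesis by simp
    next
      case True
      moreover have "fst ((next_dart ^^ k) (next_dart d)) \<notin> branch (a # v)"
        using Suc.prems(3) by (simp add: funpow_swap1)
      ultimately have "left_face (next_dart d) = left_face (a # v, a)"
        by (intro Suc.IH next_dart_darts Suc.prems(1))
      then show ?thesis by (simp add: left_face_next_dart Suc.prems(1))
    qed
  qed simp
  have nb: "a # v = neighbor v a" "distinct_adj v"
    using w by (cases v; auto simp: neighbor_def)+
  have "left_face (a # v, a) = left_face (v, a + 1)"
    using left_face_neighbor(1)[OF nb(2), of a] nb(1) by simp
  with left_face_eqD[OF de] enter[OF de(1)] leave[OF de(2)] out in_branch de(3) show ?thesis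
    by (metis fst_conv)
qed


section \<open>The boundary of a cluster\<close>

text \<open>A set of vertices that contains the root is connected if and only
  if it contains the parent of each
  of its elements.\<close>

definition rooted :: "vertex set \<Rightarrow> bool" where
  "rooted T \<longleftrightarrow> finite T \<and> [] \<in> T \<and> (\<forall>x\<in>T. distinct_adj x) \<and> (\<forall>c x. c # x \<in> T \<longrightarrow> x \<in> T)"

definition exits :: "vertex set \<Rightarrow> dart set" where
  "exits T = {(v, a). v \<in> T \<and> neighbor v a \<notin> T}"

text \<open>The darts that leave \<open>T\<close>,
  in clockwise order: the face to the right of each is the face to the left
  of the next. Their left faces form the outer cycle of the induced subgraph of the dual.\<close>

definition boundary :: "vertex set \<Rightarrow> dart list \<Rightarrow> bool" where
  "boundary T ds \<longleftrightarrow> set ds = exits T \<and> distinct (map left_face ds)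
     \<and> map right_face ds = rotate1 (map left_face ds) \<and> left_face ` set ds = dual_vertices T
     \<and> length ds \<ge> 3"

lemma rooted_branch:
  assumes "rooted T" "w \<notin> T" "x \<in> branch w"
  shows "x \<notin> T"
proof
  assume "x \<in> T"
  obtain u where "x = u @ w" using assms(3) by (auto simp: branch_def)
  then have "u @ w \<in> T" using \<open>x \<in> T\<close> by simp
  then have "w \<in> T" using assms(1) by (induction u) (auto simp: rooted_def)
  then show False using assms(2) by simp
qed

lemma exit_away:
  assumes "rooted T" "(v, a) \<in> exits T"
  shows "neighbor v a = a # v" "distinct_adj (a # v)" "distinct_adj v" "v \<in> T" "a # v \<notin> T"
proof -
  show v: "v \<in> T" using assms(2) by (simp add: exits_def)
  then show dv: "distinct_adj v" using assms(1) by (simp add: rooted_def)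
  have "tl v \<in> T" if "v \<noteq> []"
    using that assms(1) v by (cases v) (auto simp: rooted_def)
  then have "\<not> (v \<noteq> [] \<and> hd v = a)"
    using assms(2) by (auto simp: exits_def neighbor_def)
  then show n: "neighbor v a = a # v" by (auto simp: neighbor_def)
  show "distinct_adj (a # v)" using distinct_adj_neighbor[OF dv, of a] n by simp
  show "a # v \<notin> T" using assms(2) n by (simp add: exits_def)
qed

lemma rooted_insert:
  assumes "rooted T" "(v, a) \<in> exits T"
  shows "rooted (insert (a # v) T)"
  using assms exit_away[OF assms] by (auto simp: rooted_def)

lemma Delta_eq: "Delta v = {left_face (v, a), left_face (v, a + 1), left_face (v, a + 2)}"
  unfolding Delta_def UNIV_three[of a] by auto

lemma boundary_rotate1: "boundary T ds \<Longrightarrow> boundary T (rotate1 ds)"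
  by (auto simp: boundary_def rotate1_map[symmetric])

lemma boundary_rotate: "boundary T ds \<Longrightarrow> boundary T (rotate r ds)"
  by (induction r) (auto intro: boundary_rotate1)

lemma boundary_root: "boundary {[]} [([], 0), ([], 1), ([], 2)]"
proof -
  have n: "neighbor [] a = [a]" for a by (simp add: neighbor_def)
  have r: "right_face ([], a) = left_face ([], a + 1)" for a by (simp add: right_face_Pair)
  have two_one: "(2::3) + 1 = 0" by simp
  then have "right_face ([], 2) = left_face ([], 0)" using r[of 2] by (simp only: two_one)
  moreover have "right_face ([], 0) = left_face ([], 1)" using r[of 0] by simp
  moreover have "right_face ([], 1) = left_face ([], 2)" using r[of 1] by simp
  moreover have "exits {[]} = {([], 0), ([], 1), ([], 2)}"
    using UNIV_three[of 0] by (auto simp: exits_def n)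
  moreover have "dual_vertices {[]} = {left_face ([], 0), left_face ([], 1), left_face ([], 2)}"
    using Delta_eq[of "[]" 0] by (simp add: dual_vertices_def)
  ultimately show ?thesis
    by (simp add: boundary_def left_face_at_vertex)
qed

text \<open>The whole boundary of the new face lies in the branch of the new vertex, while an old face is seen
  from a vertex outside this branch. So an old face that touches the new one is seen from both sides,
  and \<open>face_crossing\<close> leaves two candidates.\<close>

lemma new_face:
  assumes T: "rooted T" and va: "(v, a) \<in> exits T"
  defines "F \<equiv> left_face (a # v, a + 2)"
  shows new_face_notin: "F \<notin> dual_vertices T"
    and new_face_adj: "f \<in> dual_vertices T \<Longrightarrow>
      dual_adj F f \<longleftrightarrow> f = left_face (v, a) \<or> f = left_face (v, a + 1)"
proof -
  note w = exit_away[OF T va]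
  have old: "left_face (a # v, a) = left_face (v, a + 1)" "left_face (a # v, a + 1) = left_face (v, a)"
    using left_face_neighbor[OF w(3), of a] w(1) by simp_all
  have F_old: "F \<noteq> left_face (v, a)" "F \<noteq> left_face (v, a + 1)"
    unfolding F_def old[symmetric] by (simp_all add: left_face_at_vertex w(2))
  have self: "a # v \<in> branch (a # v)" by (auto simp: branch_def)
  have out: "x \<notin> branch (a # v)" if "x \<in> T" for x
    using rooted_branch[OF T w(5)] that by blast
  have inside: "x \<in> branch (a # v)" if "(x, c) \<in> darts" "left_face (x, c) = F" for x c
  proof (rule ccontr)
    assume "x \<notin> branch (a # v)"
    moreover have "(a # v, a + 2) \<in> darts" using w(2) by (simp add: darts_def)
    ultimately show False
      using face_crossing[OF that(1) _ _ w(2) _ self, of "a + 2"] that(2) F_old by (simp add: F_def)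
  qed
  have darts_T: "(x, c) \<in> darts" if "x \<in> T" for x c
    using that T by (simp add: rooted_def darts_def)
  show "F \<notin> dual_vertices T"
  proof
    assume "F \<in> dual_vertices T"
    then obtain x c where "x \<in> T" "left_face (x, c) = F"
      by (auto simp: dual_vertices_def Delta_def)
    then show False using inside darts_T out by blast
  qed
  show "dual_adj F f \<longleftrightarrow> f = left_face (v, a) \<or> f = left_face (v, a + 1)" if "f \<in> dual_vertices T"
  proof
    assume "dual_adj F f"
    then obtain x c where x: "(x, c) \<in> darts" "left_face (x, c) = F" "right_face (x, c) = f"
      by (auto simp: dual_adj_def)
    have f: "f = left_face (x, c + 1)" "(x, c + 1) \<in> darts"
      using x right_face_Pair[of x c] by (auto simp: darts_def)
    obtain y b where y: "y \<in> T" "f = left_face (y, b)"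
      using \<open>f \<in> dual_vertices T\<close> by (auto simp: dual_vertices_def Delta_def)
    show "f = left_face (v, a) \<or> f = left_face (v, a + 1)"
      using face_crossing[OF darts_T[OF y(1)] f(2) _ w(2) out[OF y(1)] inside[OF x(1,2)],
        of b] y f by simp
  next
    assume "f = left_face (v, a) \<or> f = left_face (v, a + 1)"
    then show "dual_adj F f"
      using dual_adj_at_vertex[OF w(2), of "a + 2" "a + 1"] dual_adj_at_vertex[OF w(2), of "a + 2" a]
      unfolding F_def old by auto
  qed
qed

text \<open>The exit to the new vertex is replaced
  by the two other darts at this vertex. If it is the last one
  in the list, the new face is appended to the list of faces.\<close>

lemma boundary_grow:
  assumes T: "rooted T" and ds: "boundary T (es @ [(v, a)])"
  shows "boundary (insert (a # v) T) (es @ [(a # v, a + 1), (a # v, a + 2)])"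
    and "left_face (a # v, a + 1) = left_face (v, a)"
    and "dual_vertices (insert (a # v) T) = insert (left_face (a # v, a + 2)) (dual_vertices T)"
proof -
  let ?w = "a # v" and ?T = "insert (a # v) T" and ?F = "left_face (a # v, a + 2)"
  have va: "(v, a) \<in> exits T" using ds by (auto simp: boundary_def)
  note w = exit_away[OF T va]
  have old: "left_face (?w, a) = left_face (v, a + 1)" "left_face (?w, a + 1) = left_face (v, a)"
    using left_face_neighbor[OF w(3), of a] w(1) by simp_all
  show "left_face (?w, a + 1) = left_face (v, a)" by (rule old)
  have dv: "dual_vertices ?T = insert ?F (dual_vertices T)"
  proof -
    have "Delta ?w \<subseteq> insert ?F (Delta v)" "?F \<in> Delta ?w"
      unfolding Delta_eq[of ?w a] Delta_eq[of v a] old by auto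
    then show ?thesis using w(4) unfolding dual_vertices_def by auto
  qed
  then show "dual_vertices ?T = insert ?F (dual_vertices T)" .
  have ex: "exits ?T = (exits T - {(v, a)}) \<union> {(?w, a + 1), (?w, a + 2)}"
  proof (intro set_eqI iffI)
    fix d assume d: "d \<in> exits ?T"
    obtain x c where xc: "d = (x, c)" by (cases d)
    show "d \<in> (exits T - {(v, a)}) \<union> {(?w, a + 1), (?w, a + 2)}"
    proof (cases "x = ?w")
      case True
      have "neighbor ?w a = v" by (simp add: neighbor_def)
      then have "c \<noteq> a" using d xc True w(4) by (auto simp: exits_def)
      then show ?thesis using xc True three_cases[of c a] by blast
    next
      case False
      then show ?thesis using d xc w(1) by (auto simp: exits_def)
    qed
  next
    fix d assume d: "d \<in> (exits T - {(v, a)}) \<union> {(?w, a + 1), (?w, a + 2)}"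
    obtain x c where xc: "d = (x, c)" by (cases d)
    from d consider "d \<in> exits T" "d \<noteq> (v, a)" | "x = ?w" "c \<noteq> a"
      using xc by fastforce
    then show "d \<in> exits ?T"
    proof cases
      case 1
      have "neighbor x c \<noteq> ?w"
      proof
        assume n: "neighbor x c = ?w"
        have "x \<in> T" using 1 xc by (simp add: exits_def)
        then have "x \<notin> branch ?w" using rooted_branch[OF T w(5)] by blast
        moreover have "neighbor x c \<in> branch ?w" unfolding n branch_def by auto
        ultimately show False using enter_branch 1 xc by blast
      qed
      then show ?thesis using 1 xc by (auto simp: exits_def)
    next
      case 2
      then have n: "neighbor x c = c # ?w" by (auto simp: neighbor_def)
      have "c # ?w \<in> branch ?w" unfolding branch_def by (auto intro: exI[of _ "[c]"])
      then have "c # ?w \<notin> T" using rooted_branch[OF T w(5)] by blast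
      then show ?thesis using 2 xc n by (auto simp: exits_def)
    qed
  qed
  have "distinct (es @ [(v, a)])" using ds unfolding boundary_def distinct_map by blast
  moreover have "set (es @ [(v, a)]) = exits T" using ds by (simp add: boundary_def)
  ultimately have es: "set es = exits T - {(v, a)}" by auto
  let ?fs = "map left_face (es @ [(v, a)])"
  have fs: "map left_face (es @ [(?w, a + 1), (?w, a + 2)]) = ?fs @ [?F]"
    using old by simp
  have cyclic: "a + 1 + 1 = a + 2" "a + 2 + 1 = a" by simp_all
  have rf: "right_face (?w, a + 1) = ?F" "right_face (?w, a + 2) = right_face (v, a)"
    unfolding right_face_Pair[OF w(2)] right_face_Pair[OF w(3)] cyclic by (simp_all add: old)
  have rot: "map right_face es @ [right_face (v, a)] = rotate1 ?fs"
    using ds by (simp add: boundary_def)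
  have "rotate1 (?fs @ [?F]) = map right_face es @ [?F, right_face (v, a)]"
  proof -
    have "rotate1 ?fs = tl ?fs @ [hd ?fs]" by (rule rotate1_hd_tl) simp
    then have "map right_face es = tl ?fs" "right_face (v, a) = hd ?fs"
      using rot by simp_all
    moreover have "rotate1 (?fs @ [?F]) = tl ?fs @ [?F, hd ?fs]"
      using rotate1_hd_tl[of "?fs @ [?F]"] by (simp add: tl_append hd_append split: list.split)
    ultimately show ?thesis by simp
  qed
  moreover have "distinct (?fs @ [?F])"
    using ds new_face_notin[OF T va] by (auto simp: boundary_def)
  moreover have "set ?fs = dual_vertices T" using ds by (simp add: boundary_def)
  then have "left_face ` set (es @ [(?w, a + 1), (?w, a + 2)]) = dual_vertices ?T"
    unfolding list.set_map[symmetric] fs dv by auto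
  moreover have "length (es @ [(v, a)]) \<ge> 3" using ds by (simp add: boundary_def)
  ultimately show "boundary ?T (es @ [(?w, a + 1), (?w, a + 2)])"
    unfolding boundary_def fs using es by (simp add: ex rf)
qed


section \<open>Coloring the boundary\<close>

definition colored_boundary :: "nat \<Rightarrow> nat \<Rightarrow> vertex set \<Rightarrow> nat list pmf" where
  "colored_boundary n q T =
     do {
       c \<leftarrow> pmf_of_set (proper_colorings q T);
       u \<leftarrow> pmf_of_set (dual_vertices T);
       return_pmf (map (\<lambda>j. c ((clockwise_next T ^^ j) u)) [0..<n])
     }"

lemma clockwise_next_boundary:
  assumes ds: "boundary T ds" and i: "i < length ds"
  shows "clockwise_next T (left_face (ds ! i)) = left_face (ds ! (Suc i mod length ds))"
proof -
  have inj: "inj_on left_face (exits T)" and set_ds: "set ds = exits T"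
    using ds by (auto simp: boundary_def distinct_map)
  have right: "right_face (ds ! i) = left_face (ds ! (Suc i mod length ds))"
  proof -
    have "map right_face ds ! i = rotate1 (map left_face ds) ! i"
      using ds by (simp add: boundary_def)
    moreover have "Suc i mod length ds < length ds" using i by (cases ds) auto
    ultimately show ?thesis using i by (simp add: nth_rotate1)
  qed
  have mem: "ds ! i \<in> exits T" using i set_ds nth_mem by blast
  show ?thesis
    unfolding clockwise_next_def
  proof (rule the_equality)
    obtain v a where "ds ! i = (v, a)" by (cases "ds ! i")
    then show "\<exists>v\<in>T. \<exists>a. neighbor v a \<notin> T \<and> left_face (v, a) = left_face (ds ! i)
        \<and> right_face (v, a) = left_face (ds ! (Suc i mod length ds))"
      using mem right by (auto simp: exits_def)
  next
    fix g assume "\<exists>v\<in>T. \<exists>a. neighbor v a \<notin> T \<and> left_face (v, a)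
      = left_face (ds ! i) \<and> right_face (v, a) = g"
    then obtain v a where "(v, a) \<in> exits T" "left_face (v, a)
      = left_face (ds ! i)" "right_face (v, a) = g"
      by (auto simp: exits_def)
    then show "g = left_face (ds ! (Suc i mod length ds))"
      using inj_onD[OF inj _ _ mem] right by metis
  qed
qed

lemma clockwise_walk:
  assumes ds: "boundary T ds" and i: "i < length ds"
  shows "(clockwise_next T ^^ j) (left_face (ds ! i)) = left_face (ds ! ((i + j) mod length ds))"
proof (induction j)
  case (Suc j)
  have "(i + j) mod length ds < length ds" using i by (intro mod_less_divisor) linarith
  then show ?case
    using Suc clockwise_next_boundary[OF ds, of "(i + j) mod length ds"] by (simp add: mod_Suc_eq)
qed (use i in simp)

text \<open>A uniformly random face of the outer cycle is a uniformly random place in the boundary list.\<close>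

lemma colored_boundary_eq_spin:
  assumes ds: "boundary T ds"
  shows "colored_boundary (length ds) q T
    = spin (map_pmf (\<lambda>c. map c (map left_face ds)) (pmf_of_set (proper_colorings q T)))"
proof -
  let ?n = "length ds"
  have n: "?n \<ge> 3" and dist: "distinct (map left_face ds)" and dv: "left_face ` set ds
    = dual_vertices T"
    using ds by (auto simp: boundary_def)
  have "0 \<in> {..<?n}" by (rule lessThan_iff[THEN iffD2]) (use n in linarith)
  then have ne: "{..<?n} \<noteq> {}" by blast
  have inj: "inj_on (\<lambda>i. left_face (ds ! i)) {..<?n}"
    using dist by (auto simp: inj_on_def distinct_conv_nth)
  have img: "(\<lambda>i. left_face (ds ! i)) ` {..<?n} = dual_vertices T"
  proof -
    have "set ds = (!) ds ` {..<?n}" by (auto simp: set_conv_nth)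
    then show ?thesis unfolding dv[symmetric] by (simp add: image_image)
  qed
  have uniform: "pmf_of_set (dual_vertices T) = map_pmf (\<lambda>i. left_face (ds ! i)) (pmf_of_set {..<?n})"
    unfolding map_pmf_of_set_inj[OF inj ne finite_lessThan] img ..
  have walk: "map (\<lambda>j. c ((clockwise_next T ^^ j) (left_face (ds ! i)))) [0..<?n]
      = rotate i (map c (map left_face ds))" if "i < ?n" for c :: "face \<Rightarrow> nat" and i
  proof (rule nth_equalityI)
    fix j assume "j < length (map (\<lambda>j. c ((clockwise_next T ^^ j) (left_face (ds ! i)))) [0..<?n])"
    then have j: "j < ?n" by simp
    moreover have "(i + j) mod ?n < ?n" using that by (intro mod_less_divisor) linarith
    ultimately show "map (\<lambda>j. c ((clockwise_next T ^^ j) (left_face (ds ! i)))) [0..<?n] ! j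
        = rotate i (map c (map left_face ds)) ! j"
      by (simp add: clockwise_walk[OF ds that] nth_rotate)
  qed simp
  show ?thesis
    unfolding colored_boundary_def spin_def uniform bind_map_pmf length_map
  proof (intro bind_pmf_cong refl)
    fix c :: "face \<Rightarrow> nat" and i assume "i \<in> set_pmf (pmf_of_set {..<?n})"
    then have "i < ?n" using ne by simp
    from walk[OF this] show "return_pmf (map (\<lambda>j. c ((clockwise_next T ^^ j) (left_face (ds !
      i)))) [0..<?n])
        = return_pmf (rotate i (map c (map left_face ds)))" by simp
  qed
qed

lemma finite_dual_vertices: "finite T \<Longrightarrow> finite (dual_vertices T)"
  by (simp add: dual_vertices_def Delta_def)

lemma finite_proper_colorings: "finite T \<Longrightarrow> finite (proper_colorings q T)"
  unfolding proper_colorings_def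
  by (rule finite_subset[OF _ finite_PiE[of "dual_vertices T" "\<lambda>_. {1..q}"]])
     (auto simp: finite_dual_vertices)

lemma proper_coloring_insert:
  assumes F: "F \<notin> dual_vertices T" and dv: "dual_vertices T' = insert F (dual_vertices T)"
    and adj: "\<And>f. f \<in> dual_vertices T \<Longrightarrow> dual_adj F f \<longleftrightarrow> f = g \<or> f = h"
    and gh: "g \<in> dual_vertices T" "h \<in> dual_vertices T"
  shows "proper_colorings q T' = (\<Union>c\<in>proper_colorings q T. (\<lambda>x. c(F := x)) ` ({1..q} - {c g, c h}))"
proof (intro set_eqI iffI)
  fix c assume c: "c \<in> proper_colorings q T'"
  \<comment> \<open>Colorings are extensional, so forgetting the new face means resetting it to \<open>undefined\<close>.\<close>
  define c0 where "c0 = c(F := undefined)"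
  have FF: "dual_adj F g" "dual_adj F h" using adj gh by auto
  then have "c F \<noteq> c g" "c F \<noteq> c h" using c gh unfolding proper_colorings_def dv by auto
  moreover have "g \<noteq> F" "h \<noteq> F" using gh F by auto
  moreover have "c F \<in> {1..q}" using c unfolding proper_colorings_def dv by auto
  ultimately have "c F \<in> {1..q} - {c0 g, c0 h}" by (auto simp: c0_def)
  moreover have "c0 \<in> proper_colorings q T"
    using c F unfolding proper_colorings_def dv c0_def by (auto simp: PiE_def extensional_def)
  moreover have "c = c0(F := c F)" by (simp add: c0_def)
  ultimately show "c \<in> (\<Union>c\<in>proper_colorings q T. (\<lambda>x. c(F := x)) ` ({1..q} - {c g, c h}))"
    by blast
next
  fix c assume "c \<in> (\<Union>c\<in>proper_colorings q T. (\<lambda>x. c(F := x)) ` ({1..q} - {c g, c h}))"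
  then obtain c0 x where c0: "c0 \<in> proper_colorings q T" and x: "x
    \<in> {1..q} - {c0 g, c0 h}" and c: "c = c0(F := x)"
    by blast
  have "c \<in> insert F (dual_vertices T) \<rightarrow>\<^sub>E {1..q}"
    using c0 x unfolding proper_colorings_def c by (auto simp: PiE_def extensional_def)
  moreover have "c f \<noteq> c f'"
    if f: "f \<in> insert F (dual_vertices T)" "f'
      \<in> insert F (dual_vertices T)" and ff: "dual_adj f f'" for f f'
  proof -
    have "f \<noteq> f'" using ff dual_adj_irrefl by auto
    then consider "f = F" "f' \<in> dual_vertices T" | "f' = F" "f \<in> dual_vertices T"
      | "f \<in> dual_vertices T" "f' \<in> dual_vertices T"
      using f by blast
    then show ?thesis
    proof cases
      case 1
      then have "f' = g \<or> f' = h" using adj ff by blast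
      then show ?thesis using 1 x F by (auto simp: c)
    next
      case 2
      then have "f = g \<or> f = h" using adj dual_adj_sym[OF ff] by blast
      then show ?thesis using 2 x F by (auto simp: c)
    next
      case 3
      then show ?thesis using c0 F ff by (auto simp: c proper_colorings_def)
    qed
  qed
  ultimately show "c \<in> proper_colorings q T'" unfolding proper_colorings_def dv by blast
qed

lemma card_minus_two_colors:
  assumes "s \<in> {1..q}" "t \<in> {1..q}" "s \<noteq> t"
  shows "card ({1..q} - {s, t}) = q - 2"
  using assms by (subst card_Diff_subset) auto

text \<open>The new face is adjacent to two old ones, which are adjacent to each other and thus have different
  colors. So every coloring has the same number \<open>q - 2\<close> of extensions, and a uniform coloring of the
  larger graph is a uniform coloring of the smaller one followed by a uniform extension.\<close>

lemma color_new_face: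
  assumes q: "q \<ge> 3" and T: "rooted T" and ds: "boundary T (es @ [(v, a)])"
    and ne: "proper_colorings q T \<noteq> {}"
  defines "fs \<equiv> map left_face (es @ [(v,
    a)])" and "T' \<equiv> insert (a # v) T" and "F \<equiv> left_face (a # v, a + 2)"
  shows "map_pmf (\<lambda>c. map c (fs @ [F])) (pmf_of_set (proper_colorings q T'))
      = map_pmf (\<lambda>c. map c fs) (pmf_of_set (proper_colorings q T)) \<bind> add_bead q"
    and "proper_colorings q T' \<noteq> {}"
proof -
  have va: "(v, a) \<in> exits T" using ds by (auto simp: boundary_def)
  note w = exit_away[OF T va]
  let ?g = "left_face (v, a)" and ?h = "left_face (v, a + 1)"
  let ?A = "\<lambda>c. {1..q} - {c ?g, c ?h}"
  have dv: "dual_vertices T' = insert F (dual_vertices T)"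
    unfolding T'_def F_def by (rule boundary_grow(3)[OF T ds])
  have F: "F \<notin> dual_vertices T" unfolding F_def by (rule new_face_notin[OF T va])
  have gh: "?g \<in> dual_vertices T" "?h \<in> dual_vertices T"
    using w(4) by (auto simp: dual_vertices_def Delta_def)
  have set_fs: "set fs = dual_vertices T" "fs \<noteq> []"
    using ds by (auto simp: fs_def boundary_def)
  have last_fs: "last fs = ?g" by (simp add: fs_def)
  have hd_fs: "hd fs = ?h"
  proof -
    have "map right_face es @ [right_face (v, a)] = tl fs @ [hd fs]"
      using ds rotate1_hd_tl[OF set_fs(2)] by (simp add: boundary_def fs_def)
    then show ?thesis using right_face_Pair[OF w(3)] by simp
  qed
  have fib: "c ?g \<in> {1..q}" "c ?h \<in> {1..q}" "c ?g \<noteq> c ?h" "card (?A c) = q - 2" "?A c \<noteq> {}"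
    if "c \<in> proper_colorings q T" for c
  proof -
    show *: "c ?g \<in> {1..q}" "c ?h \<in> {1..q}" using that gh by (auto simp: proper_colorings_def)
    have "dual_adj ?g ?h" by (rule dual_adj_at_vertex) (use w in simp_all)
    then show **: "c ?g \<noteq> c ?h" using that gh by (auto simp: proper_colorings_def)
    show card: "card (?A c) = q - 2" by (rule card_minus_two_colors[OF * **])
    show "?A c \<noteq> {}"
    proof
      assume "?A c = {}"
      then have "card (?A c) = 0" by (simp only: card.empty)
      then show False using card q by linarith
    qed
  qed
  have Un: "proper_colorings q T' = (\<Union>c\<in>proper_colorings q T. (\<lambda>x. c(F := x)) ` ?A c)"
    by (rule proper_coloring_insert[OF F dv _ gh]) (use new_face_adj[OF T va] in \<open>simp add: F_def\<close>)
  show "proper_colorings q T' \<noteq> {}" unfolding Un using ne fib(5) by fast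
  have inj: "inj_on (\<lambda>x. c(F := x)) X" for c :: "face \<Rightarrow> nat" and X
    by (rule inj_onI) (metis fun_upd_same)
  have "finite T" using T by (simp add: rooted_def)
  have "finite (proper_colorings q T')"
    by (rule finite_proper_colorings) (use \<open>finite T\<close> in \<open>simp add: T'_def\<close>)
  then have "pmf_of_set (proper_colorings q T')
      = pmf_of_set (proper_colorings q T) \<bind> (\<lambda>c. pmf_of_set ((\<lambda>x. c(F := x)) ` ?A c))"
    unfolding Un
  proof (rule pmf_of_set_UN)
    show "card ((\<lambda>x. c(F := x)) ` ?A c) = q - 2" if "c \<in> proper_colorings q T" for c
      using fib(4)[OF that] by (simp add: card_image[OF inj])
    show "disjoint_family_on (\<lambda>c. (\<lambda>x. c(F := x)) ` ?A c) (proper_colorings q T)"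
      unfolding disjoint_family_on_def
    proof (intro ballI impI, rule ccontr)
      fix c c' assume cc: "c \<in> proper_colorings q T" "c' \<in> proper_colorings q T" "c \<noteq> c'"
        and "(\<lambda>x. c(F := x)) ` ?A c \<inter> (\<lambda>x. c'(F := x)) ` ?A c' \<noteq> {}"
      then obtain x y where eq: "c(F := x) = c'(F := y)" by blast
      have und: "c F = undefined" "c' F = undefined"
        using cc F by (auto simp: proper_colorings_def PiE_def extensional_def)
      have "c f = c' f" for f
        using fun_cong[OF eq, of f] und by (cases "f = F") auto
      then show False using cc(3) by blast
    qed
  qed (use ne fib(5) in auto)
  also have "\<dots> = pmf_of_set (proper_colorings q T) \<bind> (\<lambda>c. map_pmf (\<lambda>x. c(F := x)) (pmf_of_set (?A c)))"
    by (intro bind_pmf_cong refl map_pmf_of_set_inj[symmetric] inj fib(5))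
       (use ne finite_proper_colorings[OF \<open>finite T\<close>, of q] in auto)
  finally have step: "pmf_of_set (proper_colorings q T') = \<dots>" .
  have upd: "map (c(F := x)) (fs @ [F]) = map c fs @ [x]" for c :: "face \<Rightarrow> nat" and x
    using F set_fs by (auto simp: map_idI)
  have ends: "hd (map c fs) = c ?h" "last (map c fs) = c ?g" for c :: "face \<Rightarrow> nat"
    using hd_map[OF set_fs(2), of c] last_map[OF set_fs(2), of c] hd_fs last_fs by simp_all
  have comm: "{1..q} - {c ?h, c ?g} = ?A c" for c :: "face \<Rightarrow> nat" by auto
  show "map_pmf (\<lambda>c. map c (fs @ [F])) (pmf_of_set (proper_colorings q T'))
      = map_pmf (\<lambda>c. map c fs) (pmf_of_set (proper_colorings q T)) \<bind> add_bead q"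
    unfolding step map_bind_pmf bind_map_pmf add_bead_def map_pmf_comp upd ends comm ..
qed


section \<open>Growing the cluster is adding beads\<close>

lemma frontier_eq: "frontier T = (\<lambda>(v, a). neighbor v a) ` exits T"
  unfolding frontier_def exits_def by auto

text \<open>In a tree, different exits of a connected set lead to different vertices.\<close>

lemma grow_eq_uniform_exit:
  assumes T: "rooted T" and ds: "boundary T ds"
  shows "grow T = map_pmf (\<lambda>i. insert (snd (ds ! i) # fst (ds ! i)) T) (pmf_of_set {..<length ds})"
proof -
  let ?f = "\<lambda>i. snd (ds ! i) # fst (ds ! i)"
  have n: "length ds \<ge> 3" and set_ds: "set ds = exits T" and "distinct ds"
    using ds by (auto simp: boundary_def distinct_map)
  have "0 \<in> {..<length ds}" by (rule lessThan_iff[THEN iffD2]) (use n in linarith)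
  then have ne: "{..<length ds} \<noteq> {}" by blast
  have inj: "inj_on ?f {..<length ds}"
  proof (rule inj_onI)
    fix i j assume ij: "i \<in> {..<length ds}" "j \<in> {..<length ds}" "?f i = ?f j"
    then have "ds ! i = ds ! j" by (simp add: prod_eq_iff)
    then show "i = j" using ij \<open>distinct ds\<close> by (simp add: nth_eq_iff_index_eq)
  qed
  have "(\<lambda>(v, a). neighbor v a) ` exits T = (\<lambda>d. snd d # fst d) ` exits T"
    using exit_away(1)[OF T] by (intro image_cong refl) auto
  also have "\<dots> = ?f ` {..<length ds}"
  proof -
    have "set ds = (!) ds ` {..<length ds}" by (auto simp: set_conv_nth)
    then show ?thesis unfolding set_ds[symmetric] by (simp add: image_image)
  qed
  finally have "pmf_of_set (frontier T) = map_pmf ?f (pmf_of_set {..<length ds})"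
    by (simp only: frontier_eq map_pmf_of_set_inj[OF inj ne finite_lessThan])
  then show ?thesis by (simp add: grow_def map_pmf_comp)
qed

lemma rotate_exit_to_end:
  assumes "i < length ds"
  shows "rotate (Suc i) ds = drop (Suc i) ds @ take i ds @ [ds ! i]"
  using assms take_Suc_conv_app_nth[OF assms]
  by (cases "Suc i = length ds") (simp_all add: rotate_drop_take del: rotate_Suc)

lemma bind_spin: "spin (p \<bind> f) = p \<bind> (\<lambda>x. spin (f x))"
  by (simp add: spin_def bind_assoc_pmf)

text \<open>Rotating the boundary list such that the chosen exit comes last puts the new color at the
  end of the
  word. Since the exit is uniform, the word before it is a uniform rotation, which is the colored
  boundary of the smaller cluster.\<close>

lemma grow_colored_boundary:
  assumes q: "q \<ge> 3" and T: "rooted T" and ds: "boundary T ds" and ne: "proper_colorings q T \<noteq> {}"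
  shows "grow T \<bind> colored_boundary (Suc (length ds)) q
    = spin (colored_boundary (length ds) q T \<bind> add_bead q)"
    and "T' \<in> set_pmf (grow T) \<Longrightarrow>
      rooted T' \<and> proper_colorings q T' \<noteq> {} \<and> (\<exists>ds'. boundary T' ds' \<and> length ds' = Suc (length ds))"
proof -
  let ?n = "length ds"
  let ?T = "\<lambda>i. insert (snd (ds ! i) # fst (ds ! i)) T"
  let ?p = "pmf_of_set (proper_colorings q T)"
  have "?n \<ge> 3" using ds by (simp add: boundary_def)
  have "0 \<in> {..<?n}" by (rule lessThan_iff[THEN iffD2]) (use \<open>?n \<ge> 3\<close> in linarith)
  then have ne_n: "{..<?n} \<noteq> {}" by blast
  have step: "colored_boundary (Suc ?n) q (?T i)
      = spin (map_pmf (\<lambda>c. map c (map left_face (rotate (Suc i) ds))) ?p \<bind> add_bead q)"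
    and valid: "rooted (?T i) \<and> proper_colorings q (?T i) \<noteq> {} \<and>
      (\<exists>ds'. boundary (?T i) ds' \<and> length ds' = Suc ?n)" if i: "i < ?n" for i
  proof -
    obtain v a where va: "ds ! i = (v, a)" by (cases "ds ! i")
    obtain es where es: "rotate (Suc i) ds = es @ [(v, a)]"
      using rotate_exit_to_end[OF i] va by simp
    have b: "boundary T (es @ [(v, a)])"
      using boundary_rotate[OF ds, of "Suc i"] es by simp
    then have "(v, a) \<in> exits T" by (auto simp: boundary_def)
    let ?es' = "es @ [(a # v, a + 1), (a # v, a + 2)]"
    note g = boundary_grow[OF T b]
    have len: "length ?es' = Suc ?n" using arg_cong[OF es, of length] by simp
    have faces: "map left_face ?es' = map left_face (es @ [(v, a)]) @ [left_face (a # v, a + 2)]"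
      using g(2) by simp
    note c = color_new_face[OF q T b ne]
    show "colored_boundary (Suc ?n) q (?T i)
      = spin (map_pmf (\<lambda>c. map c (map left_face (rotate (Suc i) ds))) ?p \<bind> add_bead q)"
      using colored_boundary_eq_spin[OF g(1), of q] c(1)
        unfolding len faces es va fst_conv snd_conv by simp
    show "rooted (?T i) \<and> proper_colorings q (?T i) \<noteq> {} \<and>
      (\<exists>ds'. boundary (?T i) ds' \<and> length ds' = Suc ?n)"
      using rooted_insert[OF T \<open>(v, a) \<in> exits T\<close>] c(2) g(1) len va by auto
  qed
  have grow: "grow T = map_pmf ?T (pmf_of_set {..<?n})" by (rule grow_eq_uniform_exit[OF T ds])
  show "rooted T' \<and> proper_colorings q T' \<noteq> {} \<and> (\<exists>ds'. boundary T' ds' \<and> length ds' = Suc ?n)"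
    if "T' \<in> set_pmf (grow T)"
    using that valid ne_n unfolding grow by auto
  have "colored_boundary ?n q T = spin (map_pmf (\<lambda>c. map c (map left_face (rotate1 ds))) ?p)"
    using colored_boundary_eq_spin[OF boundary_rotate1[OF ds], of q] by simp
  also have "\<dots> = pmf_of_set {..<?n} \<bind> (\<lambda>i. map_pmf (\<lambda>c. map c (map left_face (rotate (Suc i) ds))) ?p)"
    unfolding spin_def bind_map_pmf length_map length_rotate1
    by (subst bind_commute_pmf) (simp add: map_pmf_def rotate_map rotate1_rotate_swap)
  finally have now: "colored_boundary ?n q T = \<dots>" .
  have "grow T \<bind> colored_boundary (Suc ?n) q
      = pmf_of_set {..<?n} \<bind> (\<lambda>i. colored_boundary (Suc ?n) q (?T i))"
    unfolding grow bind_map_pmf ..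
  also have "\<dots> = pmf_of_set {..<?n} \<bind>
      (\<lambda>i. spin (map_pmf (\<lambda>c. map c (map left_face (rotate (Suc i) ds))) ?p \<bind> add_bead q))"
    by (intro bind_pmf_cong refl step) (use ne_n in auto)
  also have "\<dots> = spin (colored_boundary ?n q T \<bind> add_bead q)"
    unfolding now bind_assoc_pmf bind_spin ..
  finally show "grow T \<bind> colored_boundary (Suc ?n) q = spin (colored_boundary ?n q T \<bind> add_bead q)" .
qed

lemma colored_root:
  assumes q: "q \<ge> 3"
  shows "colored_boundary 3 q {[]} = necklace q 0" and "proper_colorings q {[]} \<noteq> {}"
proof -
  let ?ds = "[([], 0), ([], 1), ([], 2)] :: dart list"
  define f0 f1 f2 where f: "f0 = left_face ([], 0)" "f1 = left_face ([], 1)" "f2 = left_face ([], 2)"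
  have b: "boundary {[]} ?ds" by (rule boundary_root)
  have dv: "dual_vertices {[]} = {f0, f1, f2}"
    using b by (simp add: boundary_def f)
  have dist: "f0 \<noteq> f1" "f0 \<noteq> f2" "f1 \<noteq> f2" by (simp_all add: f left_face_at_vertex)
  have adj: "dual_adj f0 f1" "dual_adj f0 f2" "dual_adj f1 f2"
    unfolding f by (rule dual_adj_at_vertex; simp)+
  have proper: "proper_colorings q {[]}
    = {c \<in> {f0, f1, f2} \<rightarrow>\<^sub>E {1..q}. c f0 \<noteq> c f1 \<and> c f0 \<noteq> c f2 \<and> c f1 \<noteq> c f2}"
  proof (intro set_eqI iffI)
    fix c assume "c \<in> proper_colorings q {[]}"
    then show "c \<in> {c \<in> {f0, f1, f2} \<rightarrow>\<^sub>E {1..q}. c f0 \<noteq> c f1 \<and> c f0 \<noteq> c f2 \<and> c f1 \<noteq> c f2}"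
      using adj dist unfolding proper_colorings_def dv by simp
  next
    fix c assume c: "c \<in> {c \<in> {f0, f1, f2} \<rightarrow>\<^sub>E {1..q}. c f0 \<noteq> c f1 \<and> c f0 \<noteq> c f2 \<and> c f1 \<noteq> c f2}"
    have "\<forall>g\<in>{f0, f1, f2}. \<forall>h\<in>{f0, f1, f2}. dual_adj g h \<longrightarrow> c g \<noteq> c h"
      using c dual_adj_irrefl by fastforce
    then show "c \<in> proper_colorings q {[]}" using c unfolding proper_colorings_def dv by blast
  qed
  let ?m = "\<lambda>c::face \<Rightarrow> nat. map c [f0, f1, f2]"
  have img: "?m ` proper_colorings q {[]} = triples q"
  proof (intro set_eqI iffI)
    fix z assume "z \<in> ?m ` proper_colorings q {[]}"
    then obtain c where "c \<in> proper_colorings q {[]}" "z = ?m c" by blast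
    then show "z \<in> triples q" unfolding proper triples_def by (auto simp: PiE_def Pi_def)
  next
    fix z assume z: "z \<in> triples q"
    then have "length z = Suc (Suc (Suc 0))" by (simp add: triples_def)
    then obtain x y t where xyt: "z = [x, y, t]" by (auto simp: length_Suc_conv)
    define c where "c = (\<lambda>_. undefined)(f0 := x, f1 := y, f2 := t)"
    have vals: "c f0 = x" "c f1 = y" "c f2 = t" using dist by (simp_all add: c_def)
    have "c \<in> {f0, f1, f2} \<rightarrow>\<^sub>E {1..q}"
      using z vals by (auto simp: PiE_def extensional_def triples_def xyt c_def)
    then have "c \<in> proper_colorings q {[]}"
      unfolding proper using z vals by (simp add: triples_def xyt)
    moreover have "?m c = z" using vals xyt by simp
    ultimately show "z \<in> ?m ` proper_colorings q {[]}" by blast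
  qed
  have inj: "inj_on ?m (proper_colorings q {[]})"
  proof (rule inj_onI)
    fix c c' assume cc: "c \<in> proper_colorings q {[]}" "c' \<in> proper_colorings q {[]}" "?m c = ?m c'"
    then have "c \<in> {f0, f1, f2} \<rightarrow>\<^sub>E {1..q}" "c' \<in> {f0, f1, f2} \<rightarrow>\<^sub>E {1..q}"
      unfolding proper by blast+
    then show "c = c'" by (rule PiE_ext) (use cc(3) in auto)
  qed
  show ne: "proper_colorings q {[]} \<noteq> {}" using img triples_nonempty[OF q] by blast
  have "colored_boundary (length ?ds) q {[]} = spin (map_pmf ?m (pmf_of_set (proper_colorings q {[]})))"
    using colored_boundary_eq_spin[OF b, of q] by (simp add: f)
  also have "map_pmf ?m (pmf_of_set (proper_colorings q {[]})) = necklace q 0"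
    unfolding necklace.simps img[symmetric]
    by (rule map_pmf_of_set_inj[OF inj ne]) (simp add: finite_proper_colorings)
  also have "spin (necklace q 0) = necklace q 0"
    by (rule spin_invariant[where N = 3])
       (use necklace_support[OF q, of _ 0] pmf_necklace_rotate1[OF q, of 0] in auto)
  finally show "colored_boundary 3 q {[]} = necklace q 0" by (simp add: numeral_3_eq_3)
qed

text \<open>Every cluster with \<open>k + 1\<close> vertices has an outer cycle of \<open>k
  + 3\<close> faces, so the growth step applies
  to all clusters of a given size at once.\<close>

theorem cycle_coloring_pmf_eq_necklace:
  assumes q: "q \<ge> 3"
  shows "cycle_coloring_pmf (m + 3) q = necklace q m"
proof -
  define C where "C k = ((\<lambda>p. bind_pmf p grow) ^^ k) (return_pmf {[]})" for k
  have C_Suc: "C (Suc k) = C k \<bind> grow" for k by (simp add: C_def)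
  have valid: "rooted T \<and> proper_colorings q T \<noteq> {} \<and> (\<exists>ds. boundary T ds \<and> length ds = k + 3)"
    if "T \<in> set_pmf (C k)" for k T
    using that
  proof (induction k arbitrary: T)
    case 0
    then have "T = {[]}" by (simp add: C_def)
    moreover have "rooted {[]}" by (simp add: rooted_def)
    ultimately show ?case
      using boundary_root colored_root(2)[OF q]
        by (auto intro!: exI[of _ "[([], 0), ([], 1), ([], 2)]"])
  next
    case (Suc k)
    then obtain T0 where T0: "T0 \<in> set_pmf (C k)" "T \<in> set_pmf (grow T0)" by (auto simp: C_Suc)
    then obtain ds where ds: "boundary T0 ds" "length ds = k + 3" using Suc.IH by blast
    then show ?case
      using grow_colored_boundary(2)[OF q _ ds(1) _ T0(2)] Suc.IH[OF T0(1)] by simp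
  qed
  have "C k \<bind> colored_boundary (k + 3) q = necklace q k" for k
  proof (induction k)
    case 0
    then show ?case using colored_root(1)[OF q] by (simp add: C_def bind_return_pmf)
  next
    case (Suc k)
    have "C (Suc k) \<bind> colored_boundary (Suc k + 3) q
        = C k \<bind> (\<lambda>T. grow T \<bind> colored_boundary (Suc (k + 3)) q)"
      by (simp add: C_Suc bind_assoc_pmf)
    also have "\<dots> = C k \<bind> (\<lambda>T. spin (colored_boundary (k + 3) q T \<bind> add_bead q))"
    proof (intro bind_pmf_cong refl)
      fix T assume T: "T \<in> set_pmf (C k)"
      then obtain ds where "boundary T ds" "length ds = k + 3" using valid by blast
      then show "grow T \<bind> colored_boundary (Suc (k + 3)) q
        = spin (colored_boundary (k + 3) q T \<bind> add_bead q)"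
        using grow_colored_boundary(1)[OF q, of T ds] valid[OF T] by simp
    qed
    also have "\<dots> = spin ((C k \<bind> colored_boundary (k + 3) q) \<bind> add_bead q)"
      by (simp add: bind_spin bind_assoc_pmf)
    finally show ?case using Suc by simp
  qed
  moreover have "cluster (m + 3 - 2) = C m" by (simp add: cluster_def C_def)
  ultimately show ?thesis
    unfolding cycle_coloring_pmf_def colored_boundary_def by simp
qed

section \<open>Deleting a bead\<close>

abbreviation delete_nth :: "nat \<Rightarrow> 'a list \<Rightarrow> 'a list" where
  "delete_nth i x \<equiv> take i x @ drop (Suc i) x"

lemma pmf_necklace_eq_0:
  assumes "q \<ge> 3" "\<not> proper_cycle z"
  shows "pmf (necklace q m) z = 0"
  using assms necklace_support[of q z m] by (auto simp: set_pmf_iff)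

lemma pmf_necklace_swap:
  assumes "q \<ge> 3"
  shows "pmf (necklace q m) (u @ v) = pmf (necklace q m) (v @ u)"
  using rotation_invariant[of "pmf (necklace q m)" "length u" "u @ v"] pmf_necklace_rotate1[OF assms]
  by (simp add: rotate_append)

text \<open>The sum runs over the place of the bead inserted last; deleting this bead gives the previous
  necklace.\<close>

theorem necklace_deletion:
  assumes q: "q \<ge> 3" and y: "length y = m + 4" "set y \<subseteq> {1..q}" "proper_cycle y"
  shows "real (m + 4) * (real q - 2) * pmf (necklace q (Suc m)) y
    = (\<Sum>i<length y. pmf (necklace q m) (delete_nth i y))"
proof -
  let ?P = "pmf (necklace q m)"
  let ?p = "pmf (necklace q m \<bind> add_bead q)"
  have step: "(real q - 2) * ?p (rotate r y) = ?P (butlast (rotate r y))" for r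
  proof -
    have z: "proper_cycle (rotate r y)" "set (rotate r y) \<subseteq> {1..q}" "length (rotate r y) = m + 4"
      using y by (simp_all add: proper_cycle_rotate)
    then obtain u a where ua: "rotate r y = u @ [a]" by (cases "rotate r y" rule: rev_cases) auto
    then have "u \<noteq> []" using z by auto
    then have "a \<in> {1..q} - {hd u, last u}"
      using z proper_cycle_snoc[of u a] unfolding ua by auto
    then show ?thesis
      using q pmf_bind_add_bead[OF q, of m u a] by (simp add: ua)
  qed
  have "real (m + 4) * pmf (necklace q (Suc m)) y = cycsum ?p y"
    using pmf_spin[of "necklace q m \<bind> add_bead q" "m + 4" y] length_add_bead_support[OF q] y(1)
    by simp
  then have "real (m + 4) * (real q - 2) * pmf (necklace q (Suc m)) y
      = cycsum (\<lambda>z. (real q - 2) * ?p z) y"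
    by (simp add: cycsum_cmult)
  also have "\<dots> = cycsum (\<lambda>z. ?P (butlast z)) y"
    unfolding cycsum_def by (simp add: step)
  also have "\<dots> = cycsum (\<lambda>z. ?P (butlast (rotate1 z))) y"
    by (rule cycsum_rotate1[symmetric])
  also have "\<dots> = (\<Sum>i<length y. ?P (delete_nth i y))"
    unfolding cycsum_def
  proof (intro sum.cong refl)
    fix i assume i: "i \<in> {..<length y}"
    then have "rotate i y = y ! i # drop (Suc i) y @ take i y"
      by (simp add: rotate_drop_take Cons_nth_drop_Suc)
    then have "butlast (rotate1 (rotate i y)) = drop (Suc i) y @ take i y"
      by (simp add: append_assoc[symmetric] del: append_assoc)
    then show "?P (butlast (rotate1 (rotate i y))) = ?P (delete_nth i y)"
      using pmf_necklace_swap[OF q] by simp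
  qed
  finally show ?thesis .
qed


section \<open>Segments of the necklace\<close>

text \<open>The probability of a segment \<open>x\<close> followed
  by \<open>k\<close> further beads, which will be used with \<open>k = 1\<close> for
  4 colors and with \<open>k = 2\<close>
    for 3 colors. Deleting letters of \<open>x\<close> in \<open>necklace_deletion\<close> nearly gives the recursion
  of \<open>B\<close>; the difference is that the first and the last letter of \<open>x\<close> also constrain the further beads,
  so each of them excludes a set of words whose total weight is that of \<open>x\<close> followed by \<open>k - 1\<close> beads.
  Deleting one of the further beads adds the same weight for each of its \<open>k\<close> places and each of its
  \<open>q - 2\<close> colors. The two effects cancel because \<open>k (q - 2) = 2\<close>.\<close>

definition extension :: "nat \<Rightarrow> nat \<Rightarrow> nat \<Rightarrow> nat list \<Rightarrow> real" where
  "extension q k m x = (\<Sum>v\<in>words k q. pmf (necklace q m) (x @ v))"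

lemma del_ends:
  assumes "i < length x" "length x \<ge> 2"
  shows "delete_nth i x \<noteq> []" "i \<noteq> 0 \<Longrightarrow> hd (delete_nth i x) = hd x" "i \<noteq> length x - 1
    \<Longrightarrow> last (delete_nth i x) = last x"
    and "delete_nth 0 x = tl x" "delete_nth (length x - 1) x = butlast x"
proof -
  have "length (delete_nth i x) = length x - 1" using assms by simp
  then show "delete_nth i x \<noteq> []" using assms(2)
    by (metis diff_is_0_eq list.size(3) not_numeral_le_zero numeral_2_eq_2 not_less_eq_eq One_nat_def)
  show "hd (delete_nth i x) = hd x" if "i \<noteq> 0" using that assms by (cases x; cases i) auto
  show "last (delete_nth i x) = last x" if "i \<noteq> length x - 1" using that assms
    by (auto simp: last_append)
  show "delete_nth 0 x = tl x" by (simp add: drop_Suc)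
  show "delete_nth (length x - 1) x = butlast x" using assms by (simp add: butlast_conv_take)
qed

lemma sum_ends:
  fixes c :: real and L :: nat
  assumes "L \<ge> 2"
  shows "(\<Sum>i<L. (of_bool (i = 0) + of_bool (i = L - 1)) * c) = 2 * c"
proof -
  have "(\<Sum>i<L. (of_bool (i = 0) + of_bool (i = L - 1)) * c)
      = (\<Sum>i<L. if i = 0 then c else 0) + (\<Sum>i<L. if i = L - 1 then c else 0)"
    unfolding sum.distrib[symmetric] by (intro sum.cong refl) auto
  then show ?thesis using assms by (simp add: sum.delta)
qed

lemma sum_avoiding_two:
  assumes "s \<in> {1..q}" "t \<in> {1..q}" "s \<noteq> t"
  shows "(\<Sum>c\<in>{1..q}. of_bool (c \<noteq> s \<and> c \<noteq> t)) = real (q - 2)"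
proof -
  have "(\<Sum>c\<in>{1..q}. of_bool (c \<noteq> s \<and> c \<noteq> t)) = real (card ({1..q} - {s, t}))"
    by (subst sum_of_bool_eq) (auto intro!: arg_cong[of _ _ card])
  then show ?thesis by (simp only: card_minus_two_colors[OF assms])
qed

lemma finite_words: "finite (words m q)"
  unfolding words_def by (rule finite_subset[OF _ finite_lists_length_eq[of "{1..q}" m]]) auto

lemma proper_cycle_append:
  assumes "u \<noteq> []" "v \<noteq> []"
  shows "proper_cycle (u @ v) \<longleftrightarrow>
    distinct_adj u \<and> distinct_adj v \<and> last u \<noteq> hd v \<and> last v \<noteq> hd u"
  using assms by (auto simp: proper_cycle_def distinct_adj_append_iff)

lemma sum_words_snoc:
  assumes "c \<in> {1..q}"
  shows "(\<Sum>v\<in>words (Suc k) q. if last v = c then f v else 0) = (\<Sum>u\<in>words k q. f (u @ [c]))"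
proof -
  have "(\<Sum>v\<in>words (Suc k) q.
    if last v = c then f v else 0) = (\<Sum>v\<in>{v \<in> words (Suc k) q. last v = c}. f v)"
    by (simp add: sum.inter_filter finite_words)
  also have "\<dots> = (\<Sum>u\<in>words k q. f (u @ [c]))"
  proof (rule sum.reindex_bij_witness[of _ "\<lambda>u. u @ [c]" butlast])
    fix v assume v: "v \<in> {v \<in> words (Suc k) q. last v = c}"
    then have "v \<noteq> []" by (auto simp: words_def)
    with v show "butlast v @ [c] = v" using append_butlast_last_id by fastforce
    show "butlast v \<in> words k q" using v by (auto simp: words_def dest: in_set_butlastD)
    show "f (butlast v @ [c]) = f v" using \<open>butlast v @ [c] = v\<close> by simp
  qed (use assms in \<open>auto simp: words_def\<close>)
  finally show ?thesis .
qed

lemma sum_words_Cons: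
  assumes "c \<in> {1..q}"
  shows "(\<Sum>v\<in>words (Suc k) q. if hd v = c then f v else 0) = (\<Sum>u\<in>words k q. f (c # u))"
proof -
  have "(\<Sum>v\<in>words (Suc k) q. if hd v = c then f v else 0) = (\<Sum>v\<in>{v \<in> words (Suc k) q. hd v = c}. f v)"
    by (simp add: sum.inter_filter finite_words)
  also have "\<dots> = (\<Sum>u\<in>words k q. f (c # u))"
  proof (rule sum.reindex_bij_witness[of _ "(#) c" tl])
    fix v assume v: "v \<in> {v \<in> words (Suc k) q. hd v = c}"
    then have "v \<noteq> []" by (auto simp: words_def)
    with v show "c # tl v = v" by auto
    show "tl v \<in> words k q" using v by (cases v) (auto simp: words_def)
    show "f (c # tl v) = f v" using \<open>c # tl v = v\<close> by simp
  qed (use assms in \<open>auto simp: words_def\<close>)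
  finally show ?thesis .
qed

lemma sum_words_insert:
  assumes "j \<le> k"
  shows "(\<Sum>v\<in>words (Suc k) q. f v) = (\<Sum>u\<in>words k q. \<Sum>a\<in>{1..q}. f (take j u @ a # drop j u))"
proof -
  have "(\<Sum>v\<in>words (Suc k) q. f v) = (\<Sum>(u, a)\<in>words k q \<times> {1..q}. f (take j u @ a # drop j u))"
  proof (rule sum.reindex_bij_witness[of _ "\<lambda>(u, a). take j u @ a # drop j u" "\<lambda>v. (delete_nth j v,
    v ! j)"])
    fix v assume v: "v \<in> words (Suc k) q"
    then have j: "j < length v" using assms by (auto simp: words_def)
    then show "(case (delete_nth j v, v ! j) of (u, a) \<Rightarrow> take j u @ a # drop j u) = v"
      by (simp add: Cons_nth_drop_Suc)
    then show "(case (delete_nth j v, v ! j) of (u, a) \<Rightarrow> f (take j u @ a # drop j u)) = f v" by simp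
    have "v ! j \<in> {1..q}" using v nth_mem[OF j] unfolding words_def by blast
    then show "(delete_nth j v, v ! j) \<in> words k q \<times> {1..q}"
      using v j by (auto simp: words_def dest: in_set_takeD in_set_dropD)
  next
    fix ua assume ua: "ua \<in> words k q \<times> {1..q}"
    then show "(\<lambda>v. (delete_nth j v, v ! j)) (case ua of (u, a) \<Rightarrow> take j u @ a # drop j u) = ua"
      using assms by (auto simp: words_def nth_append)
    show "(case ua of (u, a) \<Rightarrow> take j u @ a # drop j u) \<in> words (Suc k) q"
      using ua assms by (auto simp: words_def dest: in_set_takeD in_set_dropD)
  qed
  then show ?thesis by (simp add: sum.cartesian_product)
qed

text \<open>Here \<open>ok\<close> marks the further beads that fit to the ends of \<open>x\<close>, \<open>loss\<close> is what the constraints at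
  the ends of \<open>x\<close> exclude, and \<open>free\<close> is the effect of deleting one of the further beads: it can be
  reinserted in all colors but the two different ones of its neighbors.\<close>

lemma extension_rec:
  assumes q: "q \<ge> 3" and k: "Suc k * (q - 2) = 2" and len: "length x + Suc k = m + 4" "length x \<ge> 2"
    and x: "set x \<subseteq> {1..q}" "distinct_adj x"
  shows "real (m + 4) * (real q - 2) * extension q (Suc k) (Suc m) x
    = (\<Sum>i<length x. extension q (Suc k) m (delete_nth i x))"
proof -
  let ?P = "pmf (necklace q m)" and ?W = "words (Suc k) q" and ?L = "length x"
  define ok where "ok v = (of_bool (proper_cycle (x @ v)) :: real)" for v
  define Q where "Q = (\<Sum>u\<in>words k q. ?P (x @ u))"
  have P0: "?P z = 0" if "\<not> proper_cycle z" for z using that q by (simp add: pmf_necklace_eq_0)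
  have xne: "x \<noteq> []" using len(2) by auto
  have ends: "hd x \<in> {1..q}" "last x \<in> {1..q}" using x xne hd_in_set last_in_set by blast+
  have Wne: "v \<noteq> []" if "v \<in> ?W" for v using that by (auto simp: words_def)
  have one: "real (m + 4) * (real q - 2) * pmf (necklace q (Suc m)) (x @ v)
      = ok v * ((\<Sum>i<?L. ?P (delete_nth i x @ v)) + (\<Sum>j<Suc k. ?P (x @ delete_nth j v)))"
    if v: "v \<in> ?W" for v
  proof (cases "proper_cycle (x @ v)")
    case True
    have split: "(\<Sum>i<?L + n. g i) = (\<Sum>i<?L. g i) + (\<Sum>j<n. g (?L + j))" for g :: "nat \<Rightarrow> real" and n
      by (induction n) (simp_all add: add.assoc)
    have "(\<Sum>i<length (x @ v). ?P (delete_nth i (x @ v)))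
        = (\<Sum>i<?L. ?P (delete_nth i (x @ v))) + (\<Sum>j<Suc k. ?P (delete_nth (?L + j) (x @ v)))"
    proof -
      have "length (x @ v) = ?L + Suc k" using v by (simp add: words_def)
      then show ?thesis by (simp only: split)
    qed
    also have "\<dots> = (\<Sum>i<?L. ?P (delete_nth i x @ v)) + (\<Sum>j<Suc k. ?P (x @ delete_nth j v))"
      by (intro arg_cong2[where f = "(+)"] sum.cong refl) simp_all
    finally have "(\<Sum>i<length (x @ v). ?P (delete_nth i (x @ v))) = \<dots>" .
    moreover have "real (m + 4) * (real q - 2) * pmf (necklace q (Suc m)) (x @ v)
        = (\<Sum>i<length (x @ v). ?P (delete_nth i (x @ v)))"
      by (rule necklace_deletion[OF q]) (use True v x len in \<open>auto simp: words_def\<close>)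
    moreover have "ok v = 1" using True by (simp add: ok_def)
    ultimately show ?thesis by (simp only: mult_1)
  qed (use q in \<open>simp add: ok_def pmf_necklace_eq_0 del: necklace.simps\<close>)
  have loss: "(\<Sum>v\<in>?W. (1 - ok v) * ?P (delete_nth i x @ v)) = (of_bool (i = 0) + of_bool (i
    = ?L - 1)) * Q"
    if i: "i < ?L" for i
  proof -
    note d = del_ends[OF i len(2)]
    have P1: "?P (u @ v) = 0"
      if "u \<noteq> []" "v \<in> ?W" "\<not> (distinct_adj v \<and> last u \<noteq> hd v \<and> last v \<noteq> hd u)" for u v
      using that Wne by (intro P0) (simp add: proper_cycle_append)
    consider "i = 0" | "i = ?L - 1" "i \<noteq> 0" | "i \<noteq> 0" "i \<noteq> ?L - 1" by blast
    then show ?thesis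
    proof cases
      case 1
      have tl: "tl x \<noteq> []" "last (tl x) = last x" using len(2) by (cases x; cases "tl x"; simp)+
      have "(\<Sum>v\<in>?W. (1 - ok v) * ?P (delete_nth i x @ v)) = (\<Sum>v\<in>?W.
        if last v = hd x then ?P (tl x @ v) else 0)"
      proof (rule sum.cong[OF refl])
        fix v assume v: "v \<in> ?W"
        show "(1 - ok v) * ?P (delete_nth i x @ v) = (if last v = hd x then ?P (tl x @ v) else 0)"
          using P1[OF tl(1) v] x(2) Wne[OF v] xne tl(2) 1 d(4)
          by (cases "?P (tl x @ v) = 0") (auto simp: ok_def proper_cycle_append drop_Suc)
      qed
      also have "\<dots> = (\<Sum>u\<in>words k q. ?P (tl x @ u @ [hd x]))" by (rule sum_words_snoc[OF ends(1)])
      also have "\<dots> = Q"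
        unfolding Q_def
      proof (rule sum.cong[OF refl])
        fix u show "?P (tl x @ u @ [hd x]) = ?P (x @ u)"
          using pmf_necklace_swap[OF q, of m "tl x @ u" "[hd x]"] xne by (cases x) auto
      qed
      finally show ?thesis using 1 len(2) by simp
    next
      case 2
      have bl: "butlast x \<noteq> []" "hd (butlast x) = hd x" using len(2) by (cases x; cases "tl x"; simp)+
      have "(\<Sum>v\<in>?W. (1 - ok v) * ?P (delete_nth i x @ v)) = (\<Sum>v\<in>?W.
        if hd v = last x then ?P (butlast x @ v) else 0)"
      proof (rule sum.cong[OF refl])
        fix v assume v: "v \<in> ?W"
        have "delete_nth i x = butlast x" using d(5) 2 by simp
        then show "(1 - ok v) * ?P (delete_nth i x @ v) = (if hd v
          = last x then ?P (butlast x @ v) else 0)"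
          unfolding \<open>delete_nth i x = butlast x\<close> using P1[OF bl(1) v] x(2) Wne[OF v] xne bl(2)
          by (cases "?P (butlast x @ v) = 0") (auto simp: ok_def proper_cycle_append)
      qed
      also have "\<dots> = (\<Sum>u\<in>words k q. ?P (butlast x @ last x # u))" by (rule sum_words_Cons[OF ends(2)])
      also have "\<dots> = Q"
        unfolding Q_def using append_butlast_last_id[OF xne]
        by (intro sum.cong refl) (metis append.assoc append_Cons append_Nil)
      finally show ?thesis using 2 by simp
    next
      case 3
      have "(1 - ok v) * ?P (delete_nth i x @ v) = 0" if v: "v \<in> ?W" for v
        using P1[OF d(1) v] x(2) Wne[OF v] xne d(2,3) 3
        by (cases "?P (delete_nth i x @ v) = 0") (auto simp: ok_def proper_cycle_append)
      then have "(\<Sum>v\<in>?W. (1 - ok v) * ?P (delete_nth i x @ v)) = 0" by (intro sum.neutral) blast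
      then show ?thesis using 3 by simp
    qed
  qed
  have free: "(\<Sum>v\<in>?W. ok v * ?P (x @ delete_nth j v)) = (real q - 2) * Q" if j: "j < Suc k" for j
  proof -
    have "(\<Sum>v\<in>?W. ok v * ?P (x @ delete_nth j v))
        = (\<Sum>u\<in>words k q. \<Sum>a\<in>{1..q}. ok (take j u @ a # drop j u)
          * ?P (x @ delete_nth j (take j u @ a # drop j u)))"
      by (rule sum_words_insert) (use j in simp)
    also have "\<dots> = (\<Sum>u\<in>words k q. (real q - 2) * ?P (x @ u))"
    proof (rule sum.cong[OF refl])
      fix u assume u: "u \<in> words k q"
      then have lu: "j \<le> length u" "set u \<subseteq> {1..q}" using j by (auto simp: words_def)
      \<comment> \<open>The cyclic word read such that a bead inserted at the place \<open>j\<close> comes last.\<close>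
      let ?w = "drop j u @ x @ take j u"
      have swap: "?P (x @ u) = ?P ?w"
        using pmf_necklace_swap[OF q, of m "x @ take j u" "drop j u"] by simp
      have del: "delete_nth j (take j u @ a # drop j u) = u" for a using lu by simp
      show "(\<Sum>a\<in>{1..q}. ok (take j u @ a # drop j u) * ?P (x @ delete_nth j (take j u @ a # drop j u)))
          = (real q - 2) * ?P (x @ u)"
      proof (cases "proper_cycle ?w")
        case True
        have wne: "?w \<noteq> []" using xne by simp
        have "set ?w \<subseteq> {1..q}" using x(1) lu by (auto dest: in_set_takeD in_set_dropD)
        then have wends: "hd ?w \<in> {1..q}" "last ?w \<in> {1..q}" "hd ?w \<noteq> last ?w"
          using True hd_in_set[OF wne] last_in_set[OF wne] unfolding proper_cycle_def by blast+
        have "ok (take j u @ a # drop j u) = of_bool (a \<noteq> hd ?w \<and> a \<noteq> last ?w)" for a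
        proof -
          have "rotate (length (x @ take j u @ [a])) ((x @ take j u @ [a]) @ drop j u) = ?w @ [a]"
            unfolding rotate_append by simp
          then have "proper_cycle (x @ take j u @ a # drop j u) \<longleftrightarrow> proper_cycle (?w @ [a])"
            using proper_cycle_rotate[of "(x @ take j u @ [a]) @ drop j u" "length (x @ take j u @
              [a])"] len(2)
            by simp
          then show ?thesis
            using True proper_cycle_snoc[OF wne, of a] by (simp add: ok_def proper_cycle_def)
        qed
        then show ?thesis
          using sum_avoiding_two[OF wends] q
            by (simp only: del sum_distrib_right[symmetric]) (simp add: of_nat_diff)
      next
        case False
        then show ?thesis unfolding del swap P0[OF False] by simp
      qed
    qed
    finally show ?thesis by (simp add: Q_def sum_distrib_left)
  qed
  have "real (m + 4) * (real q - 2) * extension q (Suc k) (Suc m) x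
      = (\<Sum>v\<in>?W. ok v * ((\<Sum>i<?L. ?P (delete_nth i x @ v)) + (\<Sum>j<Suc k. ?P (x @ delete_nth j v))))"
    unfolding extension_def sum_distrib_left by (intro sum.cong refl one)
  also have "\<dots> = (\<Sum>v\<in>?W. \<Sum>i<?L. ok v * ?P (delete_nth i x @ v))
    + (\<Sum>v\<in>?W. \<Sum>j<Suc k. ok v * ?P (x @ delete_nth j v))"
    by (simp only: distrib_left sum.distrib sum_distrib_left)
  also have "(\<Sum>v\<in>?W. \<Sum>i<?L. ok v * ?P (delete_nth i x @ v))
    = (\<Sum>i<?L. \<Sum>v\<in>?W. ok v * ?P (delete_nth i x @ v))"
    by (rule sum.swap)
  also have "(\<Sum>v\<in>?W. \<Sum>j<Suc k. ok v * ?P (x @ delete_nth j v))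
    = (\<Sum>j<Suc k. \<Sum>v\<in>?W. ok v * ?P (x @ delete_nth j v))"
    by (rule sum.swap)
  also have "\<dots> = (\<Sum>j<Suc k. (real q - 2) * Q)"
    by (rule sum.cong[OF refl]) (simp add: free)
  also have "\<dots> = 2 * Q"
  proof -
    have "real (q - 2) = real q - 2" using q by (simp add: of_nat_diff)
    then have "real (Suc k) * (real q - 2) = real (Suc k * (q - 2))" by (simp only: of_nat_mult)
    then have "real (Suc k) * (real q - 2) = 2" by (simp only: k of_nat_numeral)
    then show ?thesis by (simp only: sum_constant card_lessThan mult.assoc[symmetric])
  qed
  also have "(\<Sum>i<?L. \<Sum>v\<in>?W. ok v * ?P (delete_nth i x @ v))
      = (\<Sum>i<?L. extension q (Suc k) m (delete_nth i x) - (of_bool (i = 0) + of_bool (i = ?L - 1)) * Q)"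
  proof (rule sum.cong[OF refl])
    fix i assume "i \<in> {..<?L}"
    then have "extension q (Suc k) m (delete_nth i x) - (of_bool (i = 0) + of_bool (i = ?L - 1)) * Q
        = extension q (Suc k) m (delete_nth i x) - (\<Sum>v\<in>?W. (1 - ok v) * ?P (delete_nth i x @ v))"
      using loss by simp
    then show "(\<Sum>v\<in>?W. ok v * ?P (delete_nth i x @ v))
        = extension q (Suc k) m (delete_nth i x) - (of_bool (i = 0) + of_bool (i = ?L - 1)) * Q"
      by (simp only: extension_def sum_subtractf[symmetric]) (simp add: algebra_simps)
  qed
  also have "\<dots> = (\<Sum>i<?L. extension q (Suc k) m (delete_nth i x)) - 2 * Q"
    unfolding sum_subtractf by (subst sum_ends) (use len(2) in auto)
  finally show ?thesis by simp
qed

lemma B_Nil [simp]: "B [] = 1" by (simp add: B.simps)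

lemma B_not_proper: "\<not> distinct_adj x \<Longrightarrow> B x = 0"
  by (subst B.simps) auto

lemma B_proper: "distinct_adj x \<Longrightarrow> x \<noteq> [] \<Longrightarrow> B x = (\<Sum>i<length x. B (delete_nth i x))"
  by (subst B.simps) auto

lemma words_del:
  assumes "x \<in> words (Suc l) q" "i < length x"
  shows "delete_nth i x \<in> words l q"
  using assms by (auto simp: words_def dest: in_set_takeD in_set_dropD)

lemma card_triples: "card (triples 4) = 24" "card (triples 3) = 6"
  unfolding triples_list words4 words3 by simp_all

lemma extension_proportional:
  assumes q: "q \<ge> 3" and k: "Suc k * (q - 2) = 2" and l: "l + Suc k = 3" "l \<ge> 1"
    and base: "\<And>x. x \<in> words l q \<Longrightarrow> extension q (Suc k) 0 x = \<kappa>\<^sub>0 * real (B x)"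
  shows "\<exists>\<kappa>. \<forall>x\<in>words (m + l) q. extension q (Suc k) m x = \<kappa> * real (B x)"
proof (induction m)
  case 0
  show ?case using base by auto
next
  case (Suc m)
  then obtain \<kappa> where \<kappa>: "\<And>x. x \<in> words (m + l) q \<Longrightarrow> extension q (Suc k) m x = \<kappa> * real (B x)" by blast
  let ?c = "real (m + 4) * (real q - 2)"
  have "extension q (Suc k) (Suc m) x = \<kappa> / ?c * real (B x)" if x: "x \<in> words (Suc m + l) q" for x
  proof (cases "distinct_adj x")
    case True
    have xne: "x \<noteq> []" using x by (auto simp: words_def)
    have "?c * extension q (Suc k) (Suc m) x = (\<Sum>i<length x. extension q (Suc k) m (delete_nth i x))"
      by (rule extension_rec[OF q k]) (use x l True in \<open>auto simp: words_def\<close>)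
    also have "\<dots> = (\<Sum>i<length x. \<kappa> * real (B (delete_nth i x)))"
      by (intro sum.cong refl \<kappa> words_del) (use x in auto)
    also have "\<dots> = \<kappa> * real (B x)"
      using B_proper[OF True xne] by (simp add: sum_distrib_left)
    finally have "?c * extension q (Suc k) (Suc m) x = \<kappa> * real (B x)" .
    moreover have "extension q (Suc k) (Suc m) x = ?c * extension q (Suc k) (Suc m) x / ?c"
      using q by simp
    ultimately show ?thesis by simp
  next
    case False
    then have "\<not> proper_cycle (x @ v)" for v by (auto simp: proper_cycle_def distinct_adj_append_iff)
    then show ?thesis using False q
      by (simp add: extension_def pmf_necklace_eq_0 B_not_proper del: necklace.simps)
  qed
  then have "\<forall>x\<in>words (Suc m + l) q. extension q (Suc k) (Suc m) x = \<kappa> / ?c * real (B x)" by blast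
  then show ?case by (rule exI)
qed

lemma B_single: "B [b] = 1"
  by (subst B_proper) simp_all

lemma B_pair: "B [b, c] = (if b = c then 0 else 2)"
proof (cases "b = c")
  case False
  then have "B [b, c] = (\<Sum>i<2. B (delete_nth i [b, c]))"
    by (subst B_proper) (simp_all add: numeral_2_eq_2)
  then show ?thesis using False by (simp add: numeral_2_eq_2 B_single)
qed (simp add: B_not_proper)

lemma triple_in_triples:
  "[a, b, c] \<in> triples q \<longleftrightarrow> a \<noteq> b \<and> a \<noteq> c \<and> b \<noteq> c \<and> {a, b, c} \<subseteq> {1..q}"
  by (auto simp: triples_def)

lemma pmf_triples:
  assumes "q \<ge> 3"
  shows "pmf (necklace q 0) z = of_bool (z \<in> triples q) / card (triples q)"
  using triples_nonempty[OF assms] triples_finite by (simp add: indicator_def)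

text \<open>A probability proportional to \<open>B\<close> is determined by its total mass.\<close>

lemma normalized_by_Z:
  assumes supp: "set_pmf p \<subseteq> words l q"
    and proportional: "\<And>x. x \<in> words l q \<Longrightarrow> pmf p x = \<kappa> * real (B x)"
    and x: "x \<in> words l q"
  shows "pmf p x = B x / Z l q"
proof -
  have "1 = (\<Sum>x\<in>words l q. pmf p x)"
    by (rule sum_pmf_eq_1[symmetric]) (use supp finite_words in auto)
  also have "\<dots> = \<kappa> * real (Z l q)"
    by (simp add: proportional Z_def sum_distrib_left)
  finally have "\<kappa> * real (Z l q) = 1" by simp
  moreover from this have "real (Z l q) \<noteq> 0" by (metis mult_zero_right zero_neq_one)
  ultimately have "\<kappa> = 1 / real (Z l q)" by (simp add: eq_divide_eq)
  then show ?thesis using proportional[OF x] by simp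
qed

lemma pmf_take:
  assumes p: "\<And>z. z \<in> set_pmf p \<Longrightarrow> length z = l + k \<and> set z \<subseteq> {1..q}" and x: "length x = l"
  shows "pmf (map_pmf (take l) p) x = (\<Sum>v\<in>words k q. pmf p (x @ v))"
proof -
  have "take l -` {x} \<inter> set_pmf p = (@) x ` words k q \<inter> set_pmf p"
  proof (intro set_eqI iffI)
    fix z assume z: "z \<in> take l -` {x} \<inter> set_pmf p"
    then have "z = x @ drop l z" using append_take_drop_id[of l z] by simp
    moreover have "drop l z \<in> words k q"
      using p[of z] z by (auto simp: words_def dest: in_set_dropD)
    ultimately show "z \<in> (@) x ` words k q \<inter> set_pmf p" using z by blast
  qed (use x in auto)
  then have "pmf (map_pmf (take l) p) x = measure p ((@) x ` words k q)"
    unfolding pmf_map by (metis measure_Int_set_pmf)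
  also have "\<dots> = (\<Sum>z\<in>(@) x ` words k q. pmf p z)"
    by (rule measure_measure_pmf_finite) (simp add: finite_words)
  also have "\<dots> = (\<Sum>v\<in>words k q. pmf p (x @ v))"
    by (subst sum.reindex) (auto simp: inj_on_def)
  finally show ?thesis .
qed

lemma take_words:
  assumes "q \<ge> 3" "l \<le> m + 3"
  shows "set_pmf (map_pmf (take l) (necklace q m)) \<subseteq> words l q"
  using assms by (auto simp: words_def dest!: necklace_support[OF assms(1)] dest: in_set_takeD)

lemma necklace_segment:
  assumes q: "q \<ge> 3" and k: "Suc k * (q - 2) = 2" and l: "l + Suc k = 3" "l \<ge> 1"
    and base: "\<And>x. x \<in> words l q \<Longrightarrow> extension q (Suc k) 0 x = \<kappa>\<^sub>0 * real (B x)"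
    and x: "x \<in> words (m + l) q"
  shows "pmf (map_pmf (take (m + l)) (necklace q m)) x = real (B x) / Z (m + l) q"
proof -
  obtain \<kappa> where \<kappa>: "\<And>x. x \<in> words (m + l) q \<Longrightarrow> extension q (Suc k) m x = \<kappa> * real (B x)"
    using extension_proportional[OF q k l base, of m] by blast
  have "pmf (map_pmf (take (m + l)) (necklace q m)) x = \<kappa> * real (B x)"
    if x: "x \<in> words (m + l) q" for x
    unfolding \<kappa>[OF x, symmetric] extension_def
    by (rule pmf_take) (use necklace_support[OF q, of _ m] l x in \<open>auto simp: words_def\<close>)
  from normalized_by_Z[OF take_words[OF q] this x] l show ?thesis by simp
qed

theorem necklace4_segment:
  assumes "x \<in> words (m + 2) 4"
  shows "pmf (map_pmf (take (m + 2)) (necklace 4 m)) x = real (B x) / Z (m + 2) 4"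
proof (rule necklace_segment[where k = 0 and \<kappa>\<^sub>0 = "1/24"])
  fix x assume "x \<in> words 2 4"
  then obtain b c where x: "x = [b, c]" "b \<in> {1..4}" "c \<in> {1..4}"
    by (auto simp: words_def numeral_2_eq_2 length_Suc_conv)
  have "words (Suc 0) 4 = (\<lambda>a. [a]) ` {1..4}"
    by (auto simp: words_def length_Suc_conv)
  then have "extension 4 (Suc 0) 0 x = (\<Sum>a\<in>{1..4}. pmf (necklace 4 0) [b, c, a])"
    by (simp add: extension_def sum.reindex inj_on_def x del: necklace.simps)
  also have "\<dots> = (\<Sum>a\<in>{1..4}. of_bool (b \<noteq> c) * of_bool (a \<noteq> b \<and> a \<noteq> c) / 24)"
    by (intro sum.cong refl) (use x in \<open>auto simp: pmf_triples card_triples triple_in_triples simp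
      del: necklace.simps\<close>)
  also have "\<dots> = of_bool (b \<noteq> c) * (\<Sum>a\<in>{1..4}. of_bool (a \<noteq> b \<and> a \<noteq> c)) / 24"
    by (simp only: sum_distrib_left sum_divide_distrib)
  finally show "extension 4 (Suc 0) 0 x = 1 / 24 * real (B x)"
    using x sum_avoiding_two[of b 4 c] by (simp add: B_pair)
qed (use assms in simp_all)

theorem necklace3_segment:
  assumes "x \<in> words (m + 1) 3"
  shows "pmf (map_pmf (take (m + 1)) (necklace 3 m)) x = real (B x) / Z (m + 1) 3"
proof (rule necklace_segment[where k = 1 and \<kappa>\<^sub>0 = "1/3"])
  fix x assume "x \<in> words 1 3"
  then obtain b where x: "x = [b]" "b \<in> {1..3}"
    by (auto simp: words_def length_Suc_conv)
  have "words (Suc 1) 3 = (\<lambda>(a, c). [a, c]) ` ({1..3} \<times> {1..3})"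
    by (auto simp: words_def length_Suc_conv)
  then have "extension 3 (Suc 1) 0 x = (\<Sum>a\<in>{1..3}. \<Sum>c\<in>{1..3}. pmf (necklace 3 0) [b, a, c])"
    by (simp add: extension_def sum.reindex inj_on_def split_def sum.cartesian_product x del:
      necklace.simps)
  also have "\<dots> = (\<Sum>a\<in>{1..3}. \<Sum>c\<in>{1..3}. of_bool (a \<noteq> b) * of_bool (c \<noteq> a \<and> c \<noteq> b) / 6)"
    by (intro sum.cong refl) (use x in \<open>auto simp: pmf_triples card_triples triple_in_triples simp
      del: necklace.simps\<close>)
  also have "\<dots> = (\<Sum>a\<in>{1..3}. of_bool (a \<noteq> b) * (\<Sum>c\<in>{1..3}. of_bool (c \<noteq> a \<and> c \<noteq> b)) / 6)"
    by (simp only: sum_distrib_left sum_divide_distrib)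
  also have "\<dots> = (\<Sum>a\<in>{1..3} - {b}. 1 / 6)"
  proof (rule sum.mono_neutral_cong_right)
    fix a assume "a \<in> {1..3} - {b}"
    then show "of_bool (a \<noteq> b) * (\<Sum>c\<in>{1..3}. of_bool (c \<noteq> a \<and> c \<noteq> b)) / 6 = (1 / 6 :: real)"
      using sum_avoiding_two[of a 3 b] x by simp
  qed auto
  finally show "extension 3 (Suc 1) 0 x = 1 / 3 * real (B x)"
    using x by (simp add: B_single card_Diff_singleton)
qed (use assms in simp_all)

section \<open>Random words\<close>

lemma measurable_word:
  fixes V :: "'i \<Rightarrow> 'a \<Rightarrow> 'b::countable"
  assumes "\<And>j. j \<in> set js \<Longrightarrow> V j \<in> measurable M (count_space UNIV)"
  shows "(\<lambda>\<omega>. map (\<lambda>j. V j \<omega>) js) \<in> measurable M (count_space UNIV)"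
  using assms
proof (induction js)
  case (Cons j js)
  have tail: "(\<lambda>\<omega>. map (\<lambda>j. V j \<omega>) js) \<in> measurable M (count_space UNIV)"
    by (rule Cons.IH) (use Cons.prems in auto)
  have "(\<lambda>\<omega>. x # map (\<lambda>j. V j \<omega>) js) \<in> measurable M (count_space UNIV)" for x
    by (rule measurable_compose[OF tail]) simp
  then have "(\<lambda>\<omega>. V j \<omega> # map (\<lambda>j. V j \<omega>) js) \<in> measurable M (count_space UNIV)"
    by (rule measurable_compose_countable) (use Cons.prems in simp)
  then show ?case by simp
qed simp

lemma distr_map_pmf:
  assumes "V \<in> measurable M (count_space UNIV)" "distr M (count_space UNIV) V = measure_pmf p"
  shows "distr M (count_space UNIV) (\<lambda>\<omega>. f (V \<omega>)) = measure_pmf (map_pmf f p)"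
proof -
  have "distr M (count_space UNIV) (\<lambda>\<omega>. f (V \<omega>))
    = distr (distr M (count_space UNIV) V) (count_space UNIV) f"
    by (subst distr_distr) (use assms(1) in \<open>auto simp: comp_def\<close>)
  then show ?thesis by (simp add: assms(2) map_pmf_rep_eq)
qed

text \<open>The point probabilities in \<open>S\<close> add up to 1, so nothing is left for the other points.\<close>

lemma distr_eq_pmfI:
  fixes p :: "'b::countable pmf"
  assumes "prob_space M" and V: "V \<in> measurable M (count_space UNIV)"
    and S: "set_pmf p \<subseteq> S"
    and eq: "\<And>x. x \<in> S \<Longrightarrow> measure M {\<omega> \<in> space M. V \<omega> = x} = pmf p x"
  shows "distr M (count_space UNIV) V = measure_pmf p"
proof -
  interpret prob_space M by fact
  interpret D: prob_space "distr M (count_space UNIV) V" by (rule prob_space_distr[OF V])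
  have single: "emeasure (distr M (count_space UNIV) V) {x} = emeasure (measure_pmf p) {x}"
    if "x \<in> S" for x
  proof -
    have "emeasure (distr M (count_space UNIV) V) {x} = emeasure M (V -` {x} \<inter> space M)"
      by (rule emeasure_distr[OF V]) simp
    also have "V -` {x} \<inter> space M = {\<omega> \<in> space M. V \<omega> = x}" by auto
    also have "emeasure M \<dots> = emeasure (measure_pmf p) {x}"
      by (simp add: emeasure_eq_measure eq[OF that] emeasure_pmf_single)
    finally show ?thesis .
  qed
  have "emeasure (distr M (count_space UNIV) V) S
    = (\<integral>\<^sup>+x. emeasure (distr M (count_space UNIV) V) {x} \<partial>count_space S)"
    by (rule emeasure_countable_singleton) auto
  also have "\<dots> = (\<integral>\<^sup>+x. emeasure (measure_pmf p) {x} \<partial>count_space S)"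
    by (rule nn_integral_cong) (simp add: single)
  also have "\<dots> = emeasure (measure_pmf p) S"
    by (rule emeasure_countable_singleton[symmetric]) auto
  also have "\<dots> = 1"
    using S by (intro measure_pmf.emeasure_eq_1_AE) (auto simp: AE_measure_pmf_iff)
  finally have "emeasure (distr M (count_space UNIV) V) S = 1" .
  then have "AE x in distr M (count_space UNIV) V. x \<in> S"
    using D.AE_in_set_eq_1[of S] by (simp add: D.emeasure_eq_measure)
  then show ?thesis
    by (intro measure_eqI_countable_AE[where \<Omega> = S] single)
       (use S in \<open>auto simp: AE_measure_pmf_iff\<close>)
qed

lemma law_cycle_eqI:
  fixes V :: "int \<Rightarrow> 'a \<Rightarrow> nat" and V' :: "int \<Rightarrow> 'b \<Rightarrow> nat"
  assumes "\<And>i. i \<in> {1..int n} \<Longrightarrow> V i \<in> measurable M (count_space UNIV)"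
    and "\<And>i. i \<in> {1..int n} \<Longrightarrow> V' i \<in> measurable M' (count_space UNIV)"
    and words: "distr M (count_space UNIV) (\<lambda>\<omega>. map (\<lambda>i. V i \<omega>) [1..int n])
      = distr M' (count_space UNIV) (\<lambda>\<omega>. map (\<lambda>i. V' i \<omega>) [1..int n])"
  shows "law (Cycle n) M (count_space UNIV) V = law (Cycle n) M' (count_space UNIV) V'"
proof -
  have law_word: "law (Cycle n) N (count_space UNIV) W
      = distr (distr N (count_space UNIV) (\<lambda>\<omega>. map (\<lambda>i. W i \<omega>) [1..int n]))
          (PiM {1..int n} (\<lambda>_. count_space UNIV)) (\<lambda>x. \<lambda>i\<in>{1..int n}. x ! nat (i - 1))"
    if W: "\<And>i. i \<in> {1..int n} \<Longrightarrow> W i \<in> measurable N (count_space UNIV)"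
    for N :: "'c measure" and W :: "int \<Rightarrow> 'c \<Rightarrow> nat"
  proof -
    have "(\<lambda>\<omega>. map (\<lambda>i. W i \<omega>) [1..int n]) \<in> measurable N (count_space UNIV)"
      by (rule measurable_word) (use W in auto)
    moreover have "(\<lambda>x. \<lambda>i\<in>{1..int n}. x ! nat (i - 1))
        \<in> measurable (count_space UNIV) (PiM {1..int n} (\<lambda>_. count_space UNIV))"
      by (auto simp: space_PiM)
    ultimately show ?thesis
      unfolding law_def indices.simps
      by (subst distr_distr) (auto intro!: arg_cong[where f = "distr N _"] ext simp: restrict_def)
  qed
  have "law (Cycle n) M (count_space UNIV) V
      = distr (distr M (count_space UNIV) (\<lambda>\<omega>. map (\<lambda>i. V i \<omega>) [1..int n]))
          (PiM {1..int n} (\<lambda>_. count_space UNIV)) (\<lambda>x. \<lambda>i\<in>{1..int n}. x ! nat (i - 1))"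
    by (rule law_word) (rule assms(1))
  also have "\<dots> = law (Cycle n) M' (count_space UNIV) V'"
    unfolding words by (rule law_word[symmetric]) (rule assms(2))
  finally show ?thesis .
qed

text \<open>Cylinder events generate the product \<open>\<sigma>\<close>-algebra, and the coordinates of such an event lie in a
  window of consecutive integers.\<close>

lemma law_integers_eqI:
  fixes V :: "int \<Rightarrow> 'a \<Rightarrow> nat" and V' :: "int \<Rightarrow> 'b \<Rightarrow> nat"
  assumes "prob_space M" "prob_space M'"
    and V: "\<And>i. V i \<in> measurable M (count_space UNIV)"
    and V': "\<And>i. V' i \<in> measurable M' (count_space UNIV)"
    and words: "\<And>t m. m \<ge> 2 \<Longrightarrow> distr M (count_space UNIV) (\<lambda>\<omega>. map (\<lambda>i. V (i + t) \<omega>) [1..int m])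
      = distr M' (count_space UNIV) (\<lambda>\<omega>. map (\<lambda>i. V' (i + t) \<omega>) [1..int m])"
  shows "law Integers M (count_space UNIV) V = law Integers M' (count_space UNIV) V'"
proof -
  let ?P = "PiM UNIV (\<lambda>_::int. count_space (UNIV :: nat set))"
  have meas: "(\<lambda>\<omega>. \<lambda>i\<in>UNIV. W i \<omega>) \<in> measurable N ?P"
    if "\<And>i. W i \<in> measurable N (count_space UNIV)" for N :: "'c measure" and W :: "int \<Rightarrow> 'c \<Rightarrow> nat"
    by (rule measurable_restrict) (use that in auto)
  show ?thesis
  proof (rule measure_eqI_PiM_infinite)
    show "sets (law Integers M (count_space UNIV) V) = sets ?P"
      "sets (law Integers M' (count_space UNIV) V') = sets ?P"
      by (simp_all add: law_def)
    interpret prob_space M by fact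
    show "finite_measure (law Integers M (count_space UNIV) V)"
      unfolding law_def indices.simps by (rule finite_measure_distr) (rule meas[OF V])
    fix A :: "int \<Rightarrow> nat set" and J :: "int set" assume J: "finite J"
    obtain b where b: "\<And>j. j \<in> J \<Longrightarrow> \<bar>j\<bar> \<le> b"
    proof (cases "J = {}")
      case False
      then show ?thesis using that[of "Max (abs ` J)"] J by simp
    qed (use that in auto)
    \<comment> \<open>The window from \<open>t + 1\<close> to \<open>t + m\<close> contains \<open>J\<close>.\<close>
    define t where "t = - (\<bar>b\<bar> + 1)"
    define m where "m = nat (2 * \<bar>b\<bar> + 2)"
    have m: "m \<ge> 2" by (simp add: m_def)
    have pos: "1 \<le> j - t" "j - t \<le> int m" if "j \<in> J" for j
      using b[OF that] by (auto simp: t_def m_def)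
    define G where "G = {x :: nat list. \<forall>j\<in>J. x ! nat (j - t - 1) \<in> A j}"
    have emb: "emeasure (law Integers N (count_space UNIV) W) (prod_emb UNIV (\<lambda>_. count_space
      UNIV) J (Pi\<^sub>E J A))
        = emeasure (distr N (count_space UNIV) (\<lambda>\<omega>. map (\<lambda>i. W (i + t) \<omega>) [1..int m])) G"
      if W: "\<And>i. W i \<in> measurable N (count_space UNIV)" for N :: "'c measure" and W :: "int \<Rightarrow> 'c \<Rightarrow> nat"
    proof -
      have "emeasure (law Integers N (count_space UNIV) W) (prod_emb UNIV (\<lambda>_. count_space UNIV) J
        (Pi\<^sub>E J A))
          = emeasure N ((\<lambda>\<omega>. \<lambda>i\<in>UNIV. W i \<omega>) -` prod_emb UNIV (\<lambda>_. count_space UNIV) J (Pi\<^sub>E J A)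
            \<inter> space N)"
        unfolding law_def indices.simps
        by (rule emeasure_distr[OF meas[OF W]]) (use J in \<open>auto intro!: sets_PiM_I\<close>)
      also have "(\<lambda>\<omega>. \<lambda>i\<in>UNIV. W i \<omega>) -` prod_emb UNIV (\<lambda>_. count_space UNIV) J (Pi\<^sub>E J A) \<inter> space N
          = (\<lambda>\<omega>. map (\<lambda>i. W (i + t) \<omega>) [1..int m]) -` G \<inter> space N"
      proof -
        have "(\<lambda>i\<in>UNIV. W i \<omega>) \<in> prod_emb UNIV (\<lambda>_. count_space UNIV) J (Pi\<^sub>E J A)
            \<longleftrightarrow> (\<forall>j\<in>J. W j \<omega> \<in> A j)" for \<omega>
          by (auto simp: prod_emb_def PiE_def Pi_def)
        moreover have "map (\<lambda>i. W (i + t) \<omega>) [1..int m] \<in> G \<longleftrightarrow> (\<forall>j\<in>J. W j \<omega> \<in> A j)" for \<omega>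
        proof -
          have "map (\<lambda>i. W (i + t) \<omega>) [1..int m] ! nat (j - t - 1) = W j \<omega>" if "j \<in> J" for j
          proof -
            have "nat (j - t - 1) < m" using pos[OF that] by linarith
            then show ?thesis using pos[OF that] by (simp add: nth_map)
          qed
          then show ?thesis by (simp add: G_def)
        qed
        ultimately show ?thesis by blast
      qed
      also have "emeasure N \<dots> = emeasure (distr N (count_space UNIV) (\<lambda>\<omega>. map (\<lambda>i. W (i
        + t) \<omega>) [1..int m])) G"
        by (rule emeasure_distr[symmetric]) (auto intro!: measurable_word W)
      finally show ?thesis .
    qed
    show "emeasure (law Integers M (count_space UNIV) V) (prod_emb UNIV (\<lambda>_. count_space UNIV) J
      (Pi\<^sub>E J A))
        = emeasure (law Integers M' (count_space UNIV) V') (prod_emb UNIV (\<lambda>_. count_space UNIV) J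
          (Pi\<^sub>E J A))"
      unfolding emb[of V M, OF V] emb[of V' M', OF V'] words[OF m] ..
  qed
qed


section \<open>Ranks of i.i.d. uniform variables\<close>

text \<open>Ranks turn real numbers into a word over the naturals with the same comparisons, hence with the
  same descents and peaks.\<close>

definition ranks :: "'a::linorder list \<Rightarrow> nat list" where
  "ranks xs = map (\<lambda>x. length (filter (\<lambda>y. y < x) xs)) xs"

lemma length_ranks [simp]: "length (ranks xs) = length xs"
  by (simp add: ranks_def)

lemma nth_ranks: "i < length xs \<Longrightarrow> ranks xs ! i = card {k. k < length xs \<and> xs ! k < xs ! i}"
  by (simp add: ranks_def length_filter_conv_card)

lemma ranks_less_iff:
  assumes "i < length xs" "j < length xs"
  shows "ranks xs ! i < ranks xs ! j \<longleftrightarrow> xs ! i < xs ! j"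
proof
  assume "xs ! i < xs ! j"
  then have "{k. k < length xs \<and> xs ! k < xs ! i} \<subset> {k. k < length xs \<and> xs ! k < xs ! j}"
    using assms by (auto intro: less_trans)
  then show "ranks xs ! i < ranks xs ! j"
    using assms by (auto simp: nth_ranks intro!: psubset_card_mono)
next
  assume r: "ranks xs ! i < ranks xs ! j"
  show "xs ! i < xs ! j"
  proof (rule ccontr)
    assume "\<not> xs ! i < xs ! j"
    then have "{k. k < length xs \<and> xs ! k < xs ! j} \<subseteq> {k. k < length xs \<and> xs ! k < xs ! i}" by auto
    then have "ranks xs ! j \<le> ranks xs ! i"
      using assms by (auto simp: nth_ranks intro!: card_mono)
    then show False using r by simp
  qed
qed

lemma cyc_desc_ranks: "cyc_desc (ranks xs) = cyc_desc xs"
proof (rule nth_equalityI)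
  fix i assume "i < length (cyc_desc (ranks xs))"
  then have i: "i < length xs" by simp
  moreover from i have "Suc i mod length xs < length xs" by (cases xs) auto
  ultimately show "cyc_desc (ranks xs) ! i = cyc_desc xs ! i"
    by (simp add: nth_cyc_desc ranks_less_iff)
qed simp

lemma cyc_peaks_ranks: "cyc_peaks (ranks xs) = cyc_peaks xs"
proof (rule nth_equalityI)
  fix i assume "i < length (cyc_peaks (ranks xs))"
  then have i: "i < length xs" by simp
  moreover from i have "Suc i mod length xs < length xs" by (cases xs) auto
  moreover from i have "(if i = 0 then length xs - 1 else i - 1) < length xs" by auto
  ultimately show "cyc_peaks (ranks xs) ! i = cyc_peaks xs ! i"
    by (simp only: nth_cyc_peaks length_ranks ranks_less_iff)
qed simp

lemma ranks_distinct:
  assumes "distinct xs"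
  shows "ranks xs \<in> permutations_of_set {..<length xs}"
proof -
  have dist: "distinct (ranks xs)"
    unfolding distinct_conv_nth
  proof (intro allI impI)
    fix i j assume ij: "i < length (ranks xs)" "j < length (ranks xs)" "i \<noteq> j"
    then have "xs ! i \<noteq> xs ! j" using assms by (simp add: nth_eq_iff_index_eq)
    then show "ranks xs ! i \<noteq> ranks xs ! j"
      using ranks_less_iff[of i xs j] ranks_less_iff[of j xs i] ij by (cases "xs ! i < xs ! j") auto
  qed
  have "set (ranks xs) \<subseteq> {..<length xs}"
  proof
    fix r assume "r \<in> set (ranks xs)"
    then obtain i where i: "i < length xs" "r = ranks xs ! i" by (auto simp: in_set_conv_nth)
    have "{k. k < length xs \<and> xs ! k < xs ! i} \<subset> {..<length xs}" using i(1) by auto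
    then have "card {k. k < length xs \<and> xs ! k < xs ! i} < card {..<length xs}"
      by (intro psubset_card_mono) auto
    then show "r \<in> {..<length xs}" using i by (simp add: nth_ranks)
  qed
  then have "set (ranks xs) = {..<length xs}"
    using distinct_card[OF dist] by (intro card_subset_eq) auto
  with dist show ?thesis by (simp add: permutations_of_set_def)
qed

lemma measurable_ranks:
  fixes U :: "'i \<Rightarrow> 'a \<Rightarrow> real"
  assumes U: "\<And>j. j \<in> set js \<Longrightarrow> U j \<in> borel_measurable M"
  shows "(\<lambda>\<omega>. ranks (map (\<lambda>j. U j \<omega>) js)) \<in> measurable M (count_space UNIV)"
proof -
  have count: "(\<lambda>\<omega>. length (filter (\<lambda>y. y < U i \<omega>) (map (\<lambda>j. U j \<omega>) ks)))
    \<in> measurable M (count_space UNIV)"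
    if "i \<in> set js" "set ks \<subseteq> set js" for i ks
    using that(2)
  proof (induction ks)
    case (Cons k ks)
    have IH: "(\<lambda>\<omega>. length (filter (\<lambda>y. y < U i \<omega>) (map (\<lambda>j. U j \<omega>) ks)))
      \<in> measurable M (count_space UNIV)"
      using Cons by simp
    have "{\<omega> \<in> space M. U k \<omega> < U i \<omega>} \<in> sets M"
      by (rule borel_measurable_less) (use U that(1) Cons.prems in auto)
    then have "(\<lambda>\<omega>. if U k \<omega> < U i \<omega> then Suc (length (filter (\<lambda>y. y < U i \<omega>) (map (\<lambda>j. U j \<omega>) ks)))
        else length (filter (\<lambda>y. y < U i \<omega>) (map (\<lambda>j. U j \<omega>) ks))) \<in> measurable M (count_space UNIV)"
      by (intro measurable_If IH measurable_compose[OF IH]) auto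
    moreover have "length (filter (\<lambda>y. y < U i \<omega>) (map (\<lambda>j. U j \<omega>) (k # ks)))
        = (if U k \<omega> < U i \<omega> then Suc (length (filter (\<lambda>y. y < U i \<omega>) (map (\<lambda>j. U j \<omega>) ks)))
           else length (filter (\<lambda>y. y < U i \<omega>) (map (\<lambda>j. U j \<omega>) ks)))" for \<omega>
      by simp
    ultimately show ?case by (simp only:)
  qed simp
  have "ranks (map (\<lambda>j. U j \<omega>) js)
    = map (\<lambda>i. length (filter (\<lambda>y. y < U i \<omega>) (map (\<lambda>j. U j \<omega>) js))) js" for \<omega>
    by (simp add: ranks_def)
  then show ?thesis
    by (simp only:) (rule measurable_word, rule count, auto)
qed


lemma iid_processD:
  assumes "iid_process I M D W"
  shows "prob_space M" "i \<in> indices I \<Longrightarrow> W i \<in> measurable M D" "i \<in> indices I \<Longrightarrow> distr M D (W i) = D"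
    "prob_space.indep_vars M (\<lambda>_. D) W (indices I)" "i \<in> indices I \<Longrightarrow> prob_space D"
proof -
  show M: "prob_space M" and D: "i \<in> indices I \<Longrightarrow> distr M D (W i) = D"
    and ind: "prob_space.indep_vars M (\<lambda>_. D) W (indices I)"
    using assms by (simp_all add: iid_process_def)
  interpret prob_space M by fact
  show W: "i \<in> indices I \<Longrightarrow> W i \<in> measurable M D" using ind by (simp add: indep_vars_def)
  show "i \<in> indices I \<Longrightarrow> prob_space D" using prob_space_distr[OF W] D by simp
qed

lemma iid_vector:
  assumes iid: "iid_process I M D W" and js: "distinct js" "set js \<subseteq> indices I" "js \<noteq> []"
  shows "distr M (PiM {..<length js} (\<lambda>_. D)) (\<lambda>\<omega>. \<lambda>k\<in>{..<length js}. W (js ! k) \<omega>)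
    = PiM {..<length js} (\<lambda>_. D)"
proof -
  note W = iid_processD[OF iid]
  interpret prob_space M by (rule W)
  let ?n = "length js" and ?I = "indices I"
  have ne: "?I \<noteq> {}" using js by auto
  have mem: "js ! k \<in> ?I" if "k < ?n" for k using js(2) that nth_mem by blast
  have "distr M (PiM ?I (\<lambda>_. D)) (\<lambda>\<omega>. \<lambda>i\<in>?I. W i \<omega>) = PiM ?I (\<lambda>i. distr M D (W i))"
    using indep_vars_iff_distr_eq_PiM'[OF ne, of W "\<lambda>_. D"] W(2,4) by simp
  also have "\<dots> = PiM ?I (\<lambda>_. D)" by (rule PiM_cong) (simp_all add: W(3))
  finally have joint: "distr M (PiM ?I (\<lambda>_. D)) (\<lambda>\<omega>. \<lambda>i\<in>?I. W i \<omega>) = PiM ?I (\<lambda>_. D)" .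
  have "distr (PiM ?I (\<lambda>_. D)) (PiM {..<?n} (\<lambda>_. D)) (\<lambda>\<omega>. \<lambda>k\<in>{..<?n}. \<omega> (js ! k)) = PiM {..<?n} (\<lambda>_. D)"
  proof (rule distr_PiM_reindex)
    show "inj_on ((!) js) {..<?n}" using js(1) by (auto simp: inj_on_def nth_eq_iff_index_eq)
  qed (use W(5) mem in auto)
  moreover have "distr (distr M (PiM ?I (\<lambda>_. D)) (\<lambda>\<omega>. \<lambda>i\<in>?I. W i \<omega>)) (PiM {..<?n} (\<lambda>_. D)) (\<lambda>\<omega>.
    \<lambda>k\<in>{..<?n}. \<omega> (js ! k))
      = distr M (PiM {..<?n} (\<lambda>_. D)) (\<lambda>\<omega>. \<lambda>k\<in>{..<?n}. W (js ! k) \<omega>)"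
  proof (subst distr_distr)
    show "(\<lambda>\<omega>. \<lambda>k\<in>{..<?n}. \<omega> (js ! k)) \<in> measurable (PiM ?I (\<lambda>_. D)) (PiM {..<?n} (\<lambda>_. D))"
      by (rule measurable_restrict, rule measurable_component_singleton) (use mem in auto)
    show "(\<lambda>\<omega>. \<lambda>i\<in>?I. W i \<omega>) \<in> measurable M (PiM ?I (\<lambda>_. D))"
      by (rule measurable_restrict) (rule W(2))
    show "distr M (PiM {..<?n} (\<lambda>_. D)) ((\<lambda>\<omega>. \<lambda>k\<in>{..<?n}. \<omega> (js ! k)) \<circ> (\<lambda>\<omega>. \<lambda>i\<in>?I. W i \<omega>))
        = distr M (PiM {..<?n} (\<lambda>_. D)) (\<lambda>\<omega>. \<lambda>k\<in>{..<?n}. W (js ! k) \<omega>)"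
      by (rule arg_cong[where f = "distr M _"]) (use mem in \<open>auto simp: fun_eq_iff restrict_def\<close>)
  qed
  ultimately show ?thesis by (simp add: joint)
qed

text \<open>The right side only depends on the number of indices, which expresses exchangeability.\<close>

lemma iid_vector_word:
  assumes iid: "iid_process I M D W" and js: "distinct js" "set js \<subseteq> indices I" "js \<noteq> []"
    and f: "(\<lambda>g. f (map g [0..<length js]))
      \<in> measurable (PiM {..<length js} (\<lambda>_. D)) (count_space UNIV)"
  shows "measure M {\<omega> \<in> space M. f (map (\<lambda>j. W j \<omega>) js) = y}
    = measure (PiM {..<length js} (\<lambda>_. D)) {g
      \<in> space (PiM {..<length js} (\<lambda>_. D)). f (map g [0..<length js]) = y}"
proof -
  let ?n = "length js" and ?P = "PiM {..<length js} (\<lambda>_. D)"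
  let ?V = "\<lambda>\<omega>. \<lambda>k\<in>{..<?n}. W (js ! k) \<omega>"
  have V: "?V \<in> measurable M ?P"
    by (rule measurable_restrict) (use js(2) nth_mem in \<open>blast intro: iid_processD(2)[OF iid]\<close>)
  have word: "map (?V \<omega>) [0..<?n] = map (\<lambda>j. W j \<omega>) js" for \<omega>
    by (rule nth_equalityI) simp_all
  have set: "{g \<in> space ?P. f (map g [0..<?n]) = y} \<in> sets ?P"
    using measurable_sets[OF f, of "{y}"] by (simp add: vimage_def Int_def conj_commute)
  have "measure ?P {g \<in> space ?P. f (map g [0..<?n]) = y}
    = measure (distr M ?P ?V) {g \<in> space ?P. f (map g [0..<?n]) = y}"
    by (simp add: iid_vector[OF iid js])
  also have "\<dots> = measure M (?V -` {g \<in> space ?P. f (map g [0..<?n]) = y} \<inter> space M)"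
    by (rule measure_distr[OF V set])
  also have "?V -` {g \<in> space ?P. f (map g [0..<?n]) = y} \<inter> space M
    = {\<omega> \<in> space M. f (map (\<lambda>j. W j \<omega>) js) = y}"
    using measurable_space[OF V] word by auto
  finally show ?thesis by simp
qed

lemma sets_uniform01 [simp, measurable_cong]: "sets uniform01 = sets borel"
  by (simp add: uniform01_def)

lemma emeasure_uniform01_singleton: "emeasure uniform01 {x} = 0"
proof -
  have "emeasure lborel ({0..1} \<inter> {x}) \<le> emeasure lborel {x}" by (rule emeasure_mono) auto
  then have "emeasure lborel ({0..1} \<inter> {x}) = 0" by simp
  then show ?thesis by (simp add: uniform01_def)
qed

text \<open>The joint law is a product of measures without atoms, so the diagonal is a null set.\<close>

lemma iid_uniform_ne:
  assumes iid: "iid_process I M uniform01 U" and ij: "i \<in> indices I" "j \<in> indices I" "i \<noteq> j"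
  shows "AE \<omega> in M. U i \<omega> \<noteq> U j \<omega>"
proof -
  note U = iid_processD[OF iid]
  interpret prob_space M by (rule U)
  interpret D: prob_space uniform01 by (rule U(5)[OF ij(1)])
  let ?D = uniform01
  have "indep_var ?D ((\<lambda>f. f i) \<circ> (\<lambda>\<omega>. restrict (\<lambda>i. U i \<omega>) {i})) ?D ((\<lambda>f. f j) \<circ> (\<lambda>\<omega>. restrict
    (\<lambda>i. U i \<omega>) {j}))"
    by (rule indep_var_compose[OF indep_var_restrict[OF U(4)]])
       (use ij in \<open>auto intro: measurable_component_singleton\<close>)
  then have "indep_var ?D (U i) ?D (U j)" by (simp add: comp_def)
  then have joint: "distr M (?D \<Otimes>\<^sub>M ?D) (\<lambda>\<omega>. (U i \<omega>, U j \<omega>)) = ?D \<Otimes>\<^sub>M ?D"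
    unfolding indep_var_distribution_eq using U(3) ij by simp
  have "{p \<in> space (?D \<Otimes>\<^sub>M ?D). fst p = snd p} \<in> sets (?D \<Otimes>\<^sub>M ?D)"
    by (rule borel_measurable_eq) measurable
  moreover have sp: "space (?D \<Otimes>\<^sub>M ?D) = UNIV"
    by (simp add: space_pair_measure uniform01_def)
  ultimately have diag: "{p. fst p = snd p} \<in> sets (?D \<Otimes>\<^sub>M ?D)" by simp
  have "emeasure (?D \<Otimes>\<^sub>M ?D) {p. fst p = snd p} = (\<integral>\<^sup>+x. emeasure ?D (Pair x -` {p. fst p
    = snd p}) \<partial>?D)"
    by (rule D.emeasure_pair_measure_alt[OF diag])
  also have "\<dots> = (\<integral>\<^sup>+x. 0 \<partial>?D)"
  proof (rule nn_integral_cong)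
    fix x :: real
    have "Pair x -` {p. fst p = snd p} = {x}" by auto
    then show "emeasure ?D (Pair x -` {p. fst p = snd p}) = 0"
      by (simp add: emeasure_uniform01_singleton)
  qed
  finally have "AE p in ?D \<Otimes>\<^sub>M ?D. fst p \<noteq> snd p"
    using diag sp by (intro AE_I'[of "{p. fst p = snd p}"]) (auto simp: null_sets_def)
  then have "AE p in distr M (?D \<Otimes>\<^sub>M ?D) (\<lambda>\<omega>. (U i \<omega>, U j \<omega>)). fst p \<noteq> snd p"
    by (simp only: joint)
  then have "AE \<omega> in M. fst (U i \<omega>, U j \<omega>) \<noteq> snd (U i \<omega>, U j \<omega>)"
    by (rule AE_distrD[rotated]) (intro measurable_Pair U(2) ij)
  then show ?thesis by simp
qed

text \<open>The variables have ranks \<open>l\<close> if and only if they are increasing after being rearranged by the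
  inverse of \<open>l\<close>.\<close>

lemma ranks_permuted:
  assumes l: "l \<in> permutations_of_set {..<length js}"
  shows "\<exists>js'. length js' = length js \<and> mset js' = mset js \<and>
    (\<forall>f. ranks (map f js) = l \<longleftrightarrow> ranks (map f js') = [0..<length js])"
proof -
  let ?n = "length js"
  have l': "distinct l" "set l = {..<?n}" "length l = ?n"
    using l length_finite_permutations_of_set[OF l] by (auto simp: permutations_of_set_def)
  define \<sigma> where "\<sigma> = inv_into {..<?n} ((!) l)"
  have bij: "bij_betw ((!) l) {..<?n} {..<?n}"
    using bij_betw_nth[OF l'(1)] l' by simp
  have \<sigma>: "\<sigma> (l ! k) = k" if "k < ?n" for k
    unfolding \<sigma>_def using bij that by (intro inv_into_f_f) (auto simp: bij_betw_def)
  have \<sigma>_bij: "bij_betw \<sigma> {..<?n} {..<?n}" unfolding \<sigma>_def by (rule bij_betw_inv_into[OF bij])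
  \<comment> \<open>The list in which the element at the place \<open>k\<close> moves to the place \<open>l ! k\<close>.\<close>
  define js' where "js' = map (\<lambda>i. js ! \<sigma> i) [0..<?n]"
  have lk: "l ! k < ?n" if "k < ?n" for k using bij that by (auto simp: bij_betw_def)
  have js'_nth: "js' ! (l ! k) = js ! k" if "k < ?n" for k
    using lk[OF that] \<sigma>[OF that] by (simp add: js'_def)
  have "mset js' = image_mset (\<lambda>i. js ! i) (image_mset \<sigma> (mset [0..<?n]))"
    by (simp add: js'_def image_mset.compositionality comp_def)
  also have "image_mset \<sigma> (mset [0..<?n]) = mset [0..<?n]"
  proof -
    have "image_mset \<sigma> (mset_set {..<?n}) = mset_set (\<sigma> ` {..<?n})"
      by (rule image_mset_mset_set) (use \<sigma>_bij in \<open>simp add: bij_betw_def\<close>)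
    also have "\<sigma> ` {..<?n} = {..<?n}" using \<sigma>_bij by (simp add: bij_betw_def)
    finally show ?thesis by (simp add: lessThan_atLeast0)
  qed
  also have "image_mset (\<lambda>i. js ! i) (mset [0..<?n]) = mset js"
    by (metis map_nth mset_map)
  finally have ms: "mset js' = mset js" .
  have len: "length js' = ?n" by (simp add: js'_def)
  have "ranks (map f js) = l \<longleftrightarrow> ranks (map f js') = [0..<?n]" for f :: "'a \<Rightarrow> 'b::linorder"
  proof -
    have eq: "ranks (map f js') ! (l ! k) = ranks (map f js) ! k" if k: "k < ?n" for k
    proof -
      have "length (filter P (map f js')) = length (filter P (map f js))" for P
        using ms by (metis mset_filter mset_map size_mset)
      then show ?thesis using k lk[OF k] js'_nth[OF k] len by (simp add: ranks_def)
    qed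
    show ?thesis
    proof
      assume r: "ranks (map f js) = l"
      show "ranks (map f js') = [0..<?n]"
      proof (rule nth_equalityI)
        fix i assume "i < length (ranks (map f js'))"
        then have "i \<in> {..<?n}" using len by simp
        then obtain k where "k < ?n" "i = l ! k" using bij by (auto simp: bij_betw_def)
        then show "ranks (map f js') ! i = [0..<?n] ! i" using eq[of k] r lk[of k] by simp
      qed (simp add: len)
    next
      assume r: "ranks (map f js') = [0..<?n]"
      show "ranks (map f js) = l"
      proof (rule nth_equalityI)
        fix k assume "k < length (ranks (map f js))"
        then show "ranks (map f js) ! k = l ! k" using eq[of k] r lk[of k] by simp
      qed (simp add: l')
    qed
  qed
  with ms len show ?thesis by blast
qed

text \<open>By exchangeability all permutations have the same probability, and almost surely the variables are
  distinct, in which case their ranks do form a permutation.\<close>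

theorem iid_uniform_ranks:
  assumes iid: "iid_process I M uniform01 U" and js: "distinct js" "set js \<subseteq> indices I" "js \<noteq> []"
  shows "distr M (count_space UNIV) (\<lambda>\<omega>. ranks (map (\<lambda>j. U j \<omega>) js)) = measure_pmf (perms (length js))"
proof -
  let ?n = "length js"
  note U = iid_processD[OF iid]
  interpret prob_space M by (rule U)
  have Ub: "U j \<in> borel_measurable M" if "j \<in> indices I" for j
    using U(2)[OF that] by (simp cong: measurable_cong_sets)
  have meas: "(\<lambda>\<omega>. ranks (map (\<lambda>j. U j \<omega>) ks)) \<in> measurable M (count_space UNIV)"
    if "set ks \<subseteq> indices I" for ks
    by (rule measurable_ranks) (use Ub that in auto)
  have measP: "(\<lambda>g. ranks (map g [0..<k]))
    \<in> measurable (PiM {..<k} (\<lambda>_. uniform01)) (count_space UNIV)" for k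
  proof (rule measurable_ranks)
    fix j assume "j \<in> set [0..<k]"
    then have "(\<lambda>g. g j) \<in> measurable (PiM {..<k} (\<lambda>_. uniform01)) uniform01"
      by (intro measurable_component_singleton) auto
    then show "(\<lambda>g. g j) \<in> borel_measurable (PiM {..<k} (\<lambda>_. uniform01))"
      by (simp cong: measurable_cong_sets)
  qed
  define c where "c = measure M {\<omega> \<in> space M. ranks (map (\<lambda>j. U j \<omega>) js) = [0..<?n]}"
  have Q: "measure M {\<omega> \<in> space M. ranks (map (\<lambda>j. U j \<omega>) js) = l} = c"
    if l: "l \<in> permutations_of_set {..<?n}" for l
  proof -
    obtain js' where js': "length js' = ?n" "mset js' = mset js"
      and iff: "\<And>f :: int \<Rightarrow> real. ranks (map f js) = l \<longleftrightarrow> ranks (map f js') = [0..<?n]"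
      using ranks_permuted[OF l] by blast
    have js'_ok: "distinct js'" "set js' \<subseteq> indices I" "js' \<noteq> []"
      using js js'(2) mset_eq_imp_distinct_iff mset_eq_setD by force+
    have "measure M {\<omega> \<in> space M. ranks (map (\<lambda>j. U j \<omega>) js) = l}
        = measure M {\<omega> \<in> space M. ranks (map (\<lambda>j. U j \<omega>) js') = [0..<?n]}"
      by (simp add: iff)
    also have "\<dots> = c"
      unfolding c_def iid_vector_word[OF iid js measP] iid_vector_word[OF iid js'_ok measP] js'(1) ..
    finally show ?thesis .
  qed
  let ?D = "distr M (count_space UNIV) (\<lambda>\<omega>. ranks (map (\<lambda>j. U j \<omega>) js))"
  have "AE \<omega> in M. \<forall>p\<in>set js \<times> set js. fst p \<noteq> snd p \<longrightarrow> U (fst p) \<omega> \<noteq> U (snd p) \<omega>"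
  proof (rule AE_finite_allI)
    fix p assume p: "p \<in> set js \<times> set js"
    show "AE \<omega> in M. fst p \<noteq> snd p \<longrightarrow> U (fst p) \<omega> \<noteq> U (snd p) \<omega>"
    proof (cases "fst p = snd p")
      case False
      then have "AE \<omega> in M. U (fst p) \<omega> \<noteq> U (snd p) \<omega>"
        by (intro iid_uniform_ne[OF iid]) (use p js(2) in auto)
      then show ?thesis by simp
    qed simp
  qed simp
  then have "AE \<omega> in M. ranks (map (\<lambda>j. U j \<omega>) js) \<in> permutations_of_set {..<?n}"
  proof (rule AE_mp, intro AE_I2 impI)
    fix \<omega> assume "\<forall>p\<in>set js \<times> set js. fst p \<noteq> snd p \<longrightarrow> U (fst p) \<omega> \<noteq> U (snd p) \<omega>"
    then have "distinct (map (\<lambda>j. U j \<omega>) js)"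
      using js(1) by (auto simp: distinct_map inj_on_def)
    then show "ranks (map (\<lambda>j. U j \<omega>) js) \<in> permutations_of_set {..<?n}"
      using ranks_distinct by fastforce
  qed
  then have "1 = measure M {\<omega> \<in> space M. ranks (map (\<lambda>j. U j \<omega>) js) \<in> permutations_of_set {..<?n}}"
    using prob_Collect_eq_1[of "\<lambda>\<omega>. ranks (map (\<lambda>j. U j \<omega>) js) \<in> permutations_of_set {..<?n}"]
      measurable_sets[OF meas[OF js(2)], of "permutations_of_set {..<?n}"]
    by (simp add: vimage_def Int_def conj_commute)
  also have "\<dots> = measure ?D (permutations_of_set {..<?n})"
    by (subst measure_distr[OF meas[OF js(2)]]) (auto intro!: arg_cong[where f = "measure M"])
  also have "\<dots> = (\<Sum>l\<in>permutations_of_set {..<?n}. measure ?D {l})"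
  proof -
    interpret D: prob_space ?D by (rule prob_space_distr[OF meas[OF js(2)]])
    show ?thesis by (rule D.finite_measure_eq_sum_singleton) auto
  qed
  also have "\<dots> = (\<Sum>l\<in>permutations_of_set {..<?n}. c)"
  proof (intro sum.cong refl)
    fix l assume "l \<in> permutations_of_set {..<?n}"
    moreover have "measure ?D {l} = measure M {\<omega> \<in> space M. ranks (map (\<lambda>j. U j \<omega>) js) = l}"
      by (subst measure_distr[OF meas[OF js(2)]]) (auto intro!: arg_cong[where f = "measure M"])
    ultimately show "measure ?D {l} = c" using Q by simp
  qed
  also have "\<dots> = fact ?n * c" by simp
  finally have "c = 1 / fact ?n" by (simp add: field_simps)
  then show ?thesis
    by (intro distr_eq_pmfI[where S = "permutations_of_set {..<?n}"] prob_space_axioms meas[OF js(2)])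
       (simp_all add: set_perms Q, simp add: perms_def)
qed


section \<open>Patterns of i.i.d. variables\<close>

lemma iid_uniform_pattern:
  assumes U: "iid_process I M uniform01 U" "distinct js" "set js \<subseteq> indices I" "js \<noteq> []"
    and f: "\<And>xs :: real list. f (ranks xs) = f' xs"
  shows "distr M (count_space UNIV) (\<lambda>\<omega>. F (f' (map (\<lambda>j. U j \<omega>) js)))
    = measure_pmf (map_pmf F (map_pmf f (perms (length js))))"
proof -
  have "U j \<in> borel_measurable M" if "j \<in> set js" for j
    using iid_processD(2)[OF U(1), of j] U(3) that by (auto cong: measurable_cong_sets)
  then have "(\<lambda>\<omega>. ranks (map (\<lambda>j. U j \<omega>) js)) \<in> measurable M (count_space UNIV)"
    by (rule measurable_ranks)
  from distr_map_pmf[OF this iid_uniform_ranks[OF U], of "\<lambda>x. F (f x)"] show ?thesis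
    by (simp add: f map_pmf_comp)
qed

lemmas iid_uniform_descents =
  iid_uniform_pattern[where f = cyc_desc and f' = cyc_desc, OF _ _ _ _ cyc_desc_ranks]
lemmas iid_uniform_peaks =
  iid_uniform_pattern[where f = cyc_peaks and f' = cyc_peaks, OF _ _ _ _ cyc_peaks_ranks]

lemma sets_fair_bit: "sets fair_bit = UNIV" "space fair_bit = UNIV"
  by (simp_all add: fair_bit_def)

lemma emeasure_fair_bit: "emeasure fair_bit {x. (x = 1) = b} = ennreal (1 / 2)"
proof -
  have "measure fair_bit {x. (x = 1) = b} = card ({0, 1} \<inter> {x::nat. (x = 1) = b}) / card {0, 1::nat}"
    unfolding fair_bit_def by (rule measure_pmf_of_set) auto
  also have "{0, 1} \<inter> {x::nat. (x = 1) = b} = (if b then {1} else {0})" by auto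
  finally have "measure fair_bit {x. (x = 1) = b} = 1 / 2" by (simp split: if_splits)
  then show ?thesis
    unfolding fair_bit_def measure_pmf.emeasure_eq_measure by (simp only:)
qed

lemma iid_fair_bits:
  assumes iid: "iid_process I M fair_bit W" and js: "distinct js" "set js \<subseteq> indices I" "js \<noteq> []"
  shows "distr M (count_space UNIV) (\<lambda>\<omega>. map (\<lambda>j. W j \<omega> = 1) js) = measure_pmf (bits (length js))"
proof -
  let ?n = "length js"
  let ?P = "PiM {..<?n} (\<lambda>_. fair_bit)"
  note W = iid_processD[OF iid]
  have any: "f \<in> measurable fair_bit (count_space UNIV)" for f :: "nat \<Rightarrow> bool"
    by (simp add: fair_bit_def)
  have mW: "(\<lambda>\<omega>. W j \<omega> = 1) \<in> measurable M (count_space UNIV)" if "j \<in> set js" for j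
    using measurable_compose[OF W(2) any, of j "\<lambda>x. x = 1"] that js(2) by auto
  have meas: "(\<lambda>\<omega>. map (\<lambda>j. W j \<omega> = 1) js) \<in> measurable M (count_space UNIV)"
    by (rule measurable_word) (rule mW)
  have measP: "(\<lambda>g. map (\<lambda>x. x = 1) (map g [0..<?n])) \<in> measurable ?P (count_space UNIV)"
    unfolding map_map comp_def
  proof (rule measurable_word)
    fix k assume "k \<in> set [0..<?n]"
    then have "(\<lambda>g. g k) \<in> measurable ?P fair_bit" by (intro measurable_component_singleton) auto
    from measurable_compose[OF this any] show "(\<lambda>g. g k = 1) \<in> measurable ?P (count_space UNIV)" .
  qed
  have D: "prob_space fair_bit" by (simp add: fair_bit_def measure_pmf.prob_space_axioms)
  interpret P: product_sigma_finite "\<lambda>_::nat. fair_bit"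
    by (rule product_sigma_finite.intro) (rule prob_space_imp_sigma_finite[OF D])
  show ?thesis
  proof (rule distr_eq_pmfI[where S = "{b. length b = ?n}"])
    fix b :: "bool list" assume "b \<in> {b. length b = ?n}"
    then have b: "length b = ?n" by simp
    have "measure M {\<omega> \<in> space M. map (\<lambda>x. x = 1) (map (\<lambda>j. W j \<omega>) js) = b}
        = measure ?P {g \<in> space ?P. map (\<lambda>x. x = 1) (map g [0..<?n]) = b}"
      by (rule iid_vector_word[OF iid js measP])
    also have "{g \<in> space ?P. map (\<lambda>x. x = 1) (map g [0..<?n]) = b} = (\<Pi>\<^sub>E k\<in>{..<?n}. {x. (x = 1)
      = b ! k})"
    proof -
      have sp: "space ?P = (\<Pi>\<^sub>E k\<in>{..<?n}. UNIV)" by (simp add: space_PiM sets_fair_bit)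
      have iff: "map (\<lambda>x. x = 1) (map g [0..<?n]) = b
        \<longleftrightarrow> (\<forall>k\<in>{..<?n}. (g k = 1) = b ! k)" for g :: "nat \<Rightarrow> nat"
        by (subst list_eq_iff_nth_eq) (simp add: b Ball_def)
      show ?thesis unfolding sp iff by (rule set_eqI) (simp add: PiE_iff conj_commute)
    qed
    also have "measure ?P \<dots> = 1 / 2 ^ ?n"
    proof -
      have "emeasure ?P (\<Pi>\<^sub>E k\<in>{..<?n}. {x. (x = 1) = b ! k}) = (\<Prod>k<?n. emeasure fair_bit {x. (x
        = 1) = b ! k})"
        by (rule P.emeasure_PiM) (auto simp: sets_fair_bit)
      also have "\<dots> = ennreal ((1 / 2) ^ ?n)"
        unfolding emeasure_fair_bit prod_constant card_lessThan by (rule ennreal_power) simp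
      finally show ?thesis by (simp add: measure_def power_one_over)
    qed
    also have "\<dots> = pmf (bits ?n) b"
      using b by (simp add: pmf_bits)
    finally show "measure M {\<omega> \<in> space M. map (\<lambda>j. W j \<omega> = 1) js = b} = pmf (bits ?n) b"
      by (simp add: comp_def)
  qed (use meas W(1) in \<open>auto simp: set_bits\<close>)
qed

lemma iid_bit_descents:
  assumes iid: "iid_process I M fair_bit W" and js: "distinct js" "set js \<subseteq> indices I" "js \<noteq> []"
  shows "distr M (count_space UNIV) (\<lambda>\<omega>. F (cyc_desc (map (\<lambda>j. W j \<omega>) js)))
    = measure_pmf (map_pmf F (map_pmf cyc_desc (bits (length js))))"
proof -
  note W = iid_processD[OF iid]
  have mem: "j \<in> indices I" if "j \<in> set js" for j using js(2) that by auto
  have any: "f \<in> measurable fair_bit (count_space UNIV)" for f :: "nat \<Rightarrow> 'z"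
    by (simp add: fair_bit_def)
  have "(\<lambda>\<omega>. W j \<omega> = 1) \<in> measurable M (count_space UNIV)" if "j \<in> set js" for j
    using measurable_compose[OF W(2)[OF mem[OF that]] any[of "\<lambda>x. x = 1"]] .
  then have m1: "(\<lambda>\<omega>. map (\<lambda>j. W j \<omega> = 1) js) \<in> measurable M (count_space UNIV)"
    by (rule measurable_word)
  have "(\<lambda>\<omega>. W j \<omega>) \<in> measurable M (count_space UNIV)" if "j \<in> set js" for j
    using measurable_compose[OF W(2)[OF mem[OF that]] any[of "\<lambda>x. x"]] .
  then have m2: "(\<lambda>\<omega>. map (\<lambda>j. W j \<omega>) js) \<in> measurable M (count_space UNIV)"
    by (rule measurable_word)
  have "AE \<omega> in M. W j \<omega> \<in> {0, 1}" if "j \<in> set js" for j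
  proof -
    have "AE x in fair_bit. x \<in> {0, 1}" unfolding fair_bit_def AE_measure_pmf_iff
      by (subst set_pmf_of_set) auto
    then have "AE x in distr M fair_bit (W j). x \<in> {0, 1}" by (simp only: W(3)[OF mem[OF that]])
    then show ?thesis by (rule AE_distrD[OF W(2)[OF mem[OF that]]])
  qed
  then have "AE \<omega> in M. \<forall>j\<in>set js. W j \<omega> \<in> {0, 1}"
    by (intro AE_finite_allI) auto
  then have "AE \<omega> in M. F (cyc_desc (map (\<lambda>j. W j \<omega>) js)) = F (cyc_desc (map (\<lambda>j. W j \<omega> = 1) js))"
  proof (rule AE_mp, intro AE_I2 impI)
    fix \<omega> assume w: "\<forall>j\<in>set js. W j \<omega> \<in> {0, 1}"
    have "cyc_desc (map (\<lambda>j. W j \<omega>) js) = cyc_desc (map (\<lambda>j. W j \<omega> = 1) js)"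
    proof (rule nth_equalityI)
      fix i assume "i < length (cyc_desc (map (\<lambda>j. W j \<omega>) js))"
      then have i: "i < length js" by simp
      moreover from i have i': "Suc i mod length js < length js" by (cases js) auto
      moreover have "W (js ! i) \<omega> \<in> {0, 1}" "W (js ! (Suc i mod length js)) \<omega> \<in> {0, 1}"
        using w i i' by simp_all
      ultimately show "cyc_desc (map (\<lambda>j. W j \<omega>) js) ! i = cyc_desc (map (\<lambda>j. W j \<omega> = 1) js) ! i"
        by (auto simp: nth_cyc_desc)
    qed simp
    then show "F (cyc_desc (map (\<lambda>j. W j \<omega>) js)) = F (cyc_desc (map (\<lambda>j. W j \<omega> = 1) js))" by simp
  qed
  then have "distr M (count_space UNIV) (\<lambda>\<omega>. F (cyc_desc (map (\<lambda>j. W j \<omega>) js)))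
      = distr M (count_space UNIV) (\<lambda>\<omega>. F (cyc_desc (map (\<lambda>j. W j \<omega> = 1) js)))"
    by (intro distr_cong_AE refl measurable_compose[OF m1] measurable_compose[OF m2]) auto
  also have "\<dots> = measure_pmf (map_pmf (\<lambda>b. F (cyc_desc b)) (bits (length js)))"
    by (rule distr_map_pmf[OF m1 iid_fair_bits[OF iid js]])
  finally show ?thesis by (simp add: map_pmf_comp)
qed

section \<open>Patterns along the cycle and the integers\<close>

lemma nth_cycle: "j < n \<Longrightarrow> [1..int n] ! j = 1 + int j"
  by (rule nth_upto) simp

lemma cyc_desc_cycle:
  assumes "n > 0"
  shows "cyc_desc (map f [1..int n]) = map (\<lambda>i. f i > f (idx (Cycle n) (i + 1))) [1..int n]"
proof (rule nth_equalityI)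
  fix k assume "k < length (cyc_desc (map f [1..int n]))"
  then have k: "k < n" by simp
  then have "Suc k mod n < n" by simp
  then have "[1..int n] ! (Suc k mod n) = idx (Cycle n) (int k + 2)"
    by (simp add: nth_cycle zmod_int add.commute)
  then show "cyc_desc (map f [1..int n]) ! k = map (\<lambda>i. f i > f (idx (Cycle n) (i + 1))) [1..int n] ! k"
    using k by (simp add: nth_cyc_desc nth_upto add.commute del: idx.simps)
qed simp

lemma cyc_peaks_cycle:
  assumes "n > 0"
  shows "cyc_peaks (map f [1..int n])
    = map (\<lambda>i. f (idx (Cycle n) (i - 1)) < f i \<and> f i > f (idx (Cycle n) (i + 1))) [1..int n]"
proof (rule nth_equalityI)
  fix k assume "k < length (cyc_peaks (map f [1..int n]))"
  then have k: "k < n" by simp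
  then have "Suc k mod n < n" by simp
  then have succ: "[1..int n] ! (Suc k mod n) = idx (Cycle n) (int k + 2)"
    by (simp add: nth_cycle zmod_int add.commute)
  let ?p = "if k = 0 then n - 1 else k - 1"
  have p: "?p < n" using k by auto
  have pred: "[1..int n] ! ?p = idx (Cycle n) (int k)"
  proof (cases "k = 0")
    case True
    have "(- 1) mod int n = int n - 1" using assms by (simp add: zmod_minus1)
    then show ?thesis using True assms by (simp add: nth_upto of_nat_diff)
  next
    case False
    then have "(int k - 1) mod int n = int k - 1" using k by (intro mod_pos_pos_trivial) auto
    then show ?thesis using False k by (simp add: nth_upto of_nat_diff)
  qed
  show "cyc_peaks (map f [1..int n]) ! k
      = map (\<lambda>i. f (idx (Cycle n) (i - 1)) < f i \<and> f i > f (idx (Cycle n) (i + 1))) [1..int n] ! k"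
  proof -
    define xs where "xs = [1..int n]"
    have len: "length xs = n" by (simp add: xs_def)
    have "cyc_peaks (map f xs) ! k \<longleftrightarrow> f (xs ! ?p) < f (xs ! k) \<and> f (xs ! k) > f (xs ! (Suc k mod n))"
      using nth_cyc_peaks[of k "map f xs"] k p \<open>Suc k mod n < n\<close> by (simp add: len split: if_splits)
    then show ?thesis
      using k succ pred nth_cycle[OF k] unfolding xs_def[symmetric]
      by (simp add: len add.commute del: idx.simps split del: if_split)
  qed
qed simp

text \<open>The letter of the cyclic pattern that compares the last variable with the first one is cut off.\<close>

lemma cyc_desc_segment:
  "take m (cyc_desc (map f (map (\<lambda>i. i + t) [1..int m + 1])))
    = map (\<lambda>i. f (i + t) > f (i + t + 1)) [1..int m]"
proof (rule nth_equalityI)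
  fix k assume "k < length (take m (cyc_desc (map f (map (\<lambda>i. i + t) [1..int m + 1]))))"
  then have k: "k < m" by simp
  then show "take m (cyc_desc (map f (map (\<lambda>i. i + t) [1..int m + 1]))) ! k
    = map (\<lambda>i. f (i + t) > f (i + t + 1)) [1..int m] ! k"
    by (simp add: nth_cyc_desc nth_upto algebra_simps nat_add_distrib)
qed (simp add: nat_add_distrib)

text \<open>The variable before the segment is put at the end of the list, where it becomes the cyclic
  predecessor of the first one.\<close>

lemma cyc_peaks_segment:
  "take m (cyc_peaks (map f (map (\<lambda>i. i + t) [1..int m + 1] @ [t])))
    = map (\<lambda>i. f (i + t - 1) < f (i + t) \<and> f (i + t) > f (i + t + 1)) [1..int m]"
proof (rule nth_equalityI)
  define js where "js = map (\<lambda>i. i + t) [1..int m + 1] @ [t]"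
  have len: "length js = m + 2" by (simp add: js_def nat_add_distrib)
  fix k assume "k < length (take m (cyc_peaks (map f (map (\<lambda>i. i + t) [1..int m + 1] @ [t]))))"
  then have k: "k < m" by (simp add: nat_add_distrib)
  have nth: "js ! j = int j + 1 + t" if "j < m + 1" for j
    using that by (simp add: js_def nth_append nth_upto nat_add_distrib)
  have last: "js ! (m + 1) = t" by (simp add: js_def nth_append nat_add_distrib)
  have prev: "js ! (if k = 0 then m + 2 - 1 else k - 1) = int k + t"
    using nth[of "k - 1"] last k by (cases k) auto
  have "cyc_peaks (map f js) ! k
    \<longleftrightarrow> f (int k + t) < f (int k + 1 + t) \<and> f (int k + 1 + t) > f (int k + 2 + t)"
    using k prev nth[of k] nth[of "Suc k"] by (simp add: nth_cyc_peaks len add_ac split: if_splits)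
  then show "take m (cyc_peaks (map f (map (\<lambda>i. i + t) [1..int m + 1] @ [t]))) ! k
      = map (\<lambda>i. f (i + t - 1) < f (i + t) \<and> f (i + t) > f (i + t + 1)) [1..int m] ! k"
    unfolding js_def[symmetric] using k by (simp add: nth_upto algebra_simps)
qed (simp add: nat_add_distrib)

lemma measurable_less_indicator:
  fixes U :: "int \<Rightarrow> 'a \<Rightarrow> real"
  assumes "U i \<in> borel_measurable M" "U j \<in> borel_measurable M"
  shows "(\<lambda>\<omega>. U i \<omega> < U j \<omega>) \<in> measurable M (count_space UNIV)"
  using assms by measurable

lemma measurable_fair_bit:
  assumes "V \<in> measurable M fair_bit"
  shows "V \<in> measurable M (count_space UNIV)"
proof -
  have "(\<lambda>x. x) \<in> measurable fair_bit (count_space UNIV)" by (simp add: fair_bit_def)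
  from measurable_compose[OF assms this] show ?thesis by simp
qed

lemma measurable_indicator:
  assumes "V \<in> measurable M (count_space UNIV)"
  shows "(\<lambda>\<omega>. of_bool (P (V \<omega>)) :: nat) \<in> measurable M (count_space UNIV)"
  by (rule measurable_compose[OF assms]) simp

text \<open>Stationarity reduces every window to the one that starts at 1.\<close>

lemma integer_coloring_word:
  assumes X: "integer_coloring q M X"
    and supp: "set_pmf p \<subseteq> words m q" and p: "\<And>x. x \<in> words m q \<Longrightarrow> pmf p x = B x / Z m q"
  shows "distr M (count_space UNIV) (\<lambda>\<omega>. map (\<lambda>i. X (i + t) \<omega>) [1..int m]) = measure_pmf p"
proof -
  have M: "prob_space M" and Xm: "\<And>i. X i \<in> measurable M (count_space UNIV)"
    and stat: "law Integers M (count_space UNIV) (\<lambda>i. X (i + t)) = law Integers M (count_space UNIV) X"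
    and B: "\<And>x. x \<in> words m q \<Longrightarrow> measure M {\<omega> \<in> space M. map (\<lambda>i. X i \<omega>) [1..int m] = x} = B x / Z m q"
    using X by (auto simp: integer_coloring_def stationary_def)
  let ?P = "PiM UNIV (\<lambda>_::int. count_space (UNIV :: nat set))"
  have word: "(\<lambda>g. map g [1..int m]) \<in> measurable ?P (count_space UNIV)"
    by (rule measurable_word) (rule measurable_component_singleton, simp)
  have push: "distr (law Integers M (count_space UNIV) W) (count_space UNIV) (\<lambda>g. map g [1..int m])
      = distr M (count_space UNIV) (\<lambda>\<omega>. map (\<lambda>i. W i \<omega>) [1..int m])"
    if "\<And>i. W i \<in> measurable M (count_space UNIV)" for W :: "int \<Rightarrow> 'a \<Rightarrow> nat"
  proof -
    have "(\<lambda>\<omega>. \<lambda>i\<in>UNIV. W i \<omega>) \<in> measurable M ?P"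
      by (rule measurable_restrict) (rule that)
    then show ?thesis
      unfolding law_def indices.simps
        by (subst distr_distr[OF word]) (simp_all add: comp_def restrict_def)
  qed
  have "distr M (count_space UNIV) (\<lambda>\<omega>. map (\<lambda>i. X (i + t) \<omega>) [1..int m])
      = distr M (count_space UNIV) (\<lambda>\<omega>. map (\<lambda>i. X i \<omega>) [1..int m])"
    using push[of "\<lambda>i. X (i + t)"] push[of X] Xm stat by simp
  also have "\<dots> = measure_pmf p"
    by (rule distr_eq_pmfI[OF M _ supp]) (auto intro!: measurable_word Xm simp: B p)
  finally show ?thesis .
qed

lemma integer_coloring4_word:
  assumes "integer_coloring 4 M X"
  shows "distr M (count_space UNIV) (\<lambda>\<omega>. map (\<lambda>i. X (i + t) \<omega>) [1..int (k + 2)])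
    = measure_pmf (map_pmf (take (k + 2)) (necklace 4 k))"
  by (rule integer_coloring_word[OF assms]) (use take_words[of 4 "k + 2" k] necklace4_segment in auto)

lemma integer_coloring3_word:
  assumes "integer_coloring 3 M X"
  shows "distr M (count_space UNIV) (\<lambda>\<omega>. map (\<lambda>i. X (i + t) \<omega>) [1..int (k + 1)])
    = measure_pmf (map_pmf (take (k + 1)) (necklace 3 k))"
  by (rule integer_coloring_word[OF assms]) (use take_words[of 3 "k + 1" k] necklace3_segment in auto)

lemma cycle_coloring_indicator_word:
  assumes X: "cycle_coloring (m + 3) q M X" and q: "q \<ge> 3"
  shows "distr M (count_space UNIV) (\<lambda>\<omega>. map (\<lambda>i. of_bool (\<pi> (X i \<omega>)) :: nat) [1..int (m + 3)])
    = measure_pmf (map_pmf (map of_bool) (map_pmf (map \<pi>) (necklace q m)))"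
proof -
  have Xm: "\<And>i. i \<in> {1..int (m + 3)} \<Longrightarrow> X i \<in> measurable M (count_space UNIV)"
    and law: "distr M (count_space UNIV) (\<lambda>\<omega>. map (\<lambda>i. X i \<omega>) [1..int (m + 3)])
      = measure_pmf (necklace q m)"
    using X cycle_coloring_pmf_eq_necklace[OF q, of m] by (auto simp: cycle_coloring_def)
  have "(\<lambda>\<omega>. map (\<lambda>i. X i \<omega>) [1..int (m + 3)]) \<in> measurable M (count_space UNIV)"
    by (rule measurable_word) (use Xm in auto)
  from distr_map_pmf[OF this law, of "map (\<lambda>a. of_bool (\<pi> a) :: nat)"] show ?thesis
    by (simp add: map_pmf_comp comp_def)
qed

lemma segment_indicator_word:
  fixes X :: "int \<Rightarrow> 'a \<Rightarrow> nat"
  assumes X: "distr M (count_space UNIV) (\<lambda>\<omega>. map (\<lambda>i. X (i + t) \<omega>) [1..int l])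
    = measure_pmf (map_pmf (take l) p)"
    and Xm: "\<And>i. X i \<in> measurable M (count_space UNIV)"
  shows "distr M (count_space UNIV) (\<lambda>\<omega>. map (\<lambda>i. of_bool (\<pi> (X (i + t) \<omega>)) :: nat) [1..int l])
    = measure_pmf (map_pmf (\<lambda>y. map of_bool (take l y)) (map_pmf (map \<pi>) p))"
proof -
  have "(\<lambda>\<omega>. map (\<lambda>i. X (i + t) \<omega>) [1..int l]) \<in> measurable M (count_space (UNIV :: nat list set))"
    by (rule measurable_word) (rule Xm)
  from distr_map_pmf[OF this X, of "map (\<lambda>a. of_bool (\<pi> a) :: nat)"] show ?thesis
    by (simp add: map_pmf_comp comp_def take_map)
qed

theorem cycle_colorings:
  assumes n: "n \<ge> 3"
    and X: "cycle_coloring n 4 MX X" and Y: "cycle_coloring n 3 MY Y"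
    and U: "iid_process (Cycle n) MU uniform01 U" and A: "iid_process (Cycle n) MA fair_bit A"
  shows "law (Cycle n) MX (count_space UNIV) (\<lambda>i \<omega>. of_bool (X i \<omega> \<in> {1, 2}) :: nat) =
      law (Cycle n) MU (count_space UNIV) (\<lambda>i \<omega>. of_bool (U i \<omega> > U (idx (Cycle n) (i
        + 1)) \<omega>))" (is ?descents)
    and "law (Cycle n) MY (count_space UNIV) (\<lambda>i \<omega>. of_bool (Y i \<omega> = 1) :: nat) =
      law (Cycle n) MU (count_space UNIV)
        (\<lambda>i \<omega>. of_bool (U (idx (Cycle n) (i - 1)) \<omega> < U i \<omega> \<and> U i \<omega> > U (idx (Cycle n) (i
          + 1)) \<omega>))" (is ?peaks)
    and "law (Cycle n) MX (count_space UNIV) (\<lambda>i \<omega>. of_bool (X i \<omega> = 1) :: nat) =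
      law (Cycle n) MA (count_space UNIV) (\<lambda>i \<omega>. of_bool (A i \<omega> > A (idx (Cycle n) (i
        + 1)) \<omega>))" (is ?bits)
proof -
  obtain m where m: "n = m + 3" using n by (metis add.commute le_Suc_ex)
  have n0: "n > 0" using n by simp
  have idx: "idx (Cycle n) i \<in> indices (Cycle n)" for i
  proof -
    have "(i - 1) mod int n < int n" "0 \<le> (i - 1) mod int n" using n0 by simp_all
    then show ?thesis unfolding idx.simps indices.simps atLeastAtMost_iff by linarith
  qed
  have js: "distinct [1..int n]" "set [1..int n] \<subseteq> indices (Cycle n)" "[1..int n] \<noteq> []" "length
    [1..int n] = n"
    using n0 by auto
  have Xm: "\<And>i. i \<in> {1..int n} \<Longrightarrow> X i \<in> measurable MX (count_space UNIV)"
    using X by (auto simp: cycle_coloring_def)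
  have Ym: "\<And>i. i \<in> {1..int n} \<Longrightarrow> Y i \<in> measurable MY (count_space UNIV)"
    using Y by (auto simp: cycle_coloring_def)
  have Um: "U i \<in> borel_measurable MU" if "i \<in> indices (Cycle n)" for i
    using iid_processD(2)[OF U that] by (simp cong: measurable_cong_sets)
  have U_less: "(\<lambda>\<omega>. U i \<omega> < U j \<omega>) \<in> measurable MU (count_space UNIV)"
    if "i \<in> indices (Cycle n)" "j \<in> indices (Cycle n)" for i j
    by (rule measurable_less_indicator[OF Um Um]) (use that in auto)
  have Am: "A i \<in> measurable MA (count_space UNIV)" if "i \<in> indices (Cycle n)" for i
    by (rule measurable_fair_bit[OF iid_processD(2)[OF A that]])
  show ?descents
  proof (rule law_cycle_eqI)
    have "distr MX (count_space UNIV) (\<lambda>\<omega>. map (\<lambda>i. of_bool (X i \<omega> \<in> {1, 2}) :: nat) [1..int n])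
        = measure_pmf (map_pmf (map of_bool) (map_pmf cyc_desc (perms n)))"
      using cycle_coloring_indicator_word[of m 4 MX X "\<lambda>a. a \<in> {1, 2}"] X
      unfolding necklace_descents m by simp
    also have "\<dots> = distr MU (count_space UNIV) (\<lambda>\<omega>. map of_bool (cyc_desc (map (\<lambda>j. U j \<omega>) [1..int
      n])))"
      using iid_uniform_descents[OF U js(1-3), of "map of_bool :: _ \<Rightarrow> nat list"] js(4) by simp
    finally show "distr MX (count_space UNIV) (\<lambda>\<omega>. map (\<lambda>i. of_bool (X i \<omega> \<in> {1, 2}) :: nat) [1..int n])
        = distr MU (count_space UNIV) (\<lambda>\<omega>. map (\<lambda>i. of_bool (U i \<omega> > U (idx (Cycle n) (i
          + 1)) \<omega>)) [1..int n])"
      by (simp add: cyc_desc_cycle[OF n0] comp_def del: idx.simps)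
  next
    fix i assume i: "i \<in> {1..int n}"
    show "(\<lambda>\<omega>. of_bool (X i \<omega> \<in> {1, 2}) :: nat) \<in> measurable MX (count_space UNIV)"
      by (rule measurable_indicator[OF Xm[OF i]])
    show "(\<lambda>\<omega>. of_bool (U i \<omega> > U (idx (Cycle n) (i + 1)) \<omega>) :: nat) \<in> measurable MU (count_space UNIV)"
      by (rule measurable_indicator[OF U_less[OF idx]]) (use i in simp)
  qed
  show ?peaks
  proof (rule law_cycle_eqI)
    have "distr MY (count_space UNIV) (\<lambda>\<omega>. map (\<lambda>i. of_bool (Y i \<omega> = 1) :: nat) [1..int n])
        = measure_pmf (map_pmf (map of_bool) (map_pmf cyc_peaks (perms n)))"
      using cycle_coloring_indicator_word[of m 3 MY Y "\<lambda>a. a = 1"] Y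
      unfolding necklace_peaks m by simp
    also have "\<dots> = distr MU (count_space UNIV) (\<lambda>\<omega>. map of_bool (cyc_peaks (map (\<lambda>j. U j \<omega>)
      [1..int n])))"
      using iid_uniform_peaks[OF U js(1-3), of "map of_bool :: _ \<Rightarrow> nat list"] js(4) by simp
    finally show "distr MY (count_space UNIV) (\<lambda>\<omega>. map (\<lambda>i. of_bool (Y i \<omega> = 1) :: nat) [1..int n])
        = distr MU (count_space UNIV) (\<lambda>\<omega>. map (\<lambda>i. of_bool (U (idx (Cycle n) (i - 1)) \<omega> < U i \<omega>
          \<and> U i \<omega> > U (idx (Cycle n) (i + 1)) \<omega>)) [1..int n])"
      by (simp add: cyc_peaks_cycle[OF n0] comp_def del: idx.simps)
  next
    fix i assume i: "i \<in> {1..int n}"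
    then have ii: "i \<in> indices (Cycle n)" by simp
    show "(\<lambda>\<omega>. of_bool (Y i \<omega> = 1) :: nat) \<in> measurable MY (count_space UNIV)"
      by (rule measurable_indicator[OF Ym[OF i]])
    have "(\<lambda>\<omega>. U (idx (Cycle n) (i - 1)) \<omega> < U i \<omega> \<and> U i \<omega> > U (idx (Cycle n) (i
      + 1)) \<omega>) \<in> measurable MU (count_space UNIV)"
      by (rule pred_intros_logic) (rule U_less idx ii)+
    from measurable_indicator[OF this, of "\<lambda>x. x"]
    show "(\<lambda>\<omega>. of_bool (U (idx (Cycle n) (i - 1)) \<omega> < U i \<omega> \<and> U i \<omega> > U (idx (Cycle n) (i
      + 1)) \<omega>) :: nat) \<in> measurable MU (count_space UNIV)"
      by simp
  qed
  show ?bits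
  proof (rule law_cycle_eqI)
    have "distr MX (count_space UNIV) (\<lambda>\<omega>. map (\<lambda>i. of_bool (X i \<omega> = 1) :: nat) [1..int n])
        = measure_pmf (map_pmf (map of_bool) (map_pmf cyc_desc (bits n)))"
      using cycle_coloring_indicator_word[of m 4 MX X "\<lambda>a. a = 1"] X
      unfolding necklace_bits m by simp
    also have "\<dots> = distr MA (count_space UNIV) (\<lambda>\<omega>. map of_bool (cyc_desc (map (\<lambda>j. A j \<omega>) [1..int
      n])))"
      using iid_bit_descents[OF A js(1-3), of "map of_bool :: _ \<Rightarrow> nat list"] js(4) by simp
    finally show "distr MX (count_space UNIV) (\<lambda>\<omega>. map (\<lambda>i. of_bool (X i \<omega> = 1) :: nat) [1..int n])
        = distr MA (count_space UNIV) (\<lambda>\<omega>. map (\<lambda>i. of_bool (A i \<omega> > A (idx (Cycle n) (i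
          + 1)) \<omega>)) [1..int n])"
      by (simp add: cyc_desc_cycle[OF n0] comp_def del: idx.simps)
  next
    fix i assume i: "i \<in> {1..int n}"
    show "(\<lambda>\<omega>. of_bool (X i \<omega> = 1) :: nat) \<in> measurable MX (count_space UNIV)"
      by (rule measurable_indicator[OF Xm[OF i]])
    have "(\<lambda>\<omega>. map (\<lambda>j. A j \<omega>) [i, idx (Cycle n) (i + 1)]) \<in> measurable MA (count_space UNIV)"
      by (rule measurable_word) (use i idx Am in \<open>auto simp del: idx.simps\<close>)
    from measurable_indicator[OF this, of "\<lambda>l. l ! 0 > l ! 1"]
    show "(\<lambda>\<omega>. of_bool (A i \<omega> > A (idx (Cycle n) (i + 1)) \<omega>) :: nat) \<in> measurable MA (count_space UNIV)"
      by (simp del: idx.simps)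
  qed
qed

theorem integer_colorings:
  assumes X: "integer_coloring 4 MX X" and Y: "integer_coloring 3 MY Y"
    and U: "iid_process Integers MU uniform01 U" and A: "iid_process Integers MA fair_bit A"
  shows "law Integers MX (count_space UNIV) (\<lambda>i \<omega>. of_bool (X i \<omega> \<in> {1, 2}) :: nat) =
      law Integers MU (count_space UNIV) (\<lambda>i \<omega>. of_bool (U i \<omega> > U (i + 1) \<omega>))" (is ?descents)
    and "law Integers MY (count_space UNIV) (\<lambda>i \<omega>. of_bool (Y i \<omega> = 1) :: nat) =
      law Integers MU (count_space UNIV) (\<lambda>i \<omega>. of_bool (U (i - 1) \<omega> < U i \<omega> \<and> U i \<omega> > U (i
        + 1) \<omega>))" (is ?peaks)
    and "law Integers MX (count_space UNIV) (\<lambda>i \<omega>. of_bool (X i \<omega> = 1) :: nat) =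
      law Integers MA (count_space UNIV) (\<lambda>i \<omega>. of_bool (A i \<omega> > A (i + 1) \<omega>))" (is ?bits)
proof -
  have Xm: "X i \<in> measurable MX (count_space UNIV)" and Ym: "Y i
    \<in> measurable MY (count_space UNIV)" for i
    using X Y by (auto simp: integer_coloring_def)
  have MX: "prob_space MX" and MY: "prob_space MY" and MU: "prob_space MU" and MA: "prob_space MA"
    using X Y U A by (auto simp: integer_coloring_def iid_process_def)
  have Um: "U i \<in> borel_measurable MU" for i
    using iid_processD(2)[OF U, of i] by (simp cong: measurable_cong_sets)
  have U_less: "(\<lambda>\<omega>. U i \<omega> < U j \<omega>) \<in> measurable MU (count_space UNIV)" for i j
    by (rule measurable_less_indicator[OF Um Um])
  have Am: "A i \<in> measurable MA (count_space UNIV)" for i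
    by (rule measurable_fair_bit[OF iid_processD(2)[OF A]]) simp
  show ?descents
  proof (rule law_integers_eqI[OF MX MU])
    fix t :: int and m :: nat assume "m \<ge> 2"
    then obtain k where k: "m = k + 2" by (metis add.commute le_Suc_ex)
    let ?js = "map (\<lambda>i. i + t) [1..int m + 1]"
    have js: "distinct ?js" "set ?js \<subseteq> indices Integers" "?js \<noteq> []" "length ?js = k + 3"
      by (simp_all add: distinct_map inj_on_def k nat_add_distrib)
    have "distr MX (count_space UNIV) (\<lambda>\<omega>. map (\<lambda>i. of_bool (X (i + t) \<omega> \<in> {1, 2}) :: nat) [1..int m])
        = measure_pmf (map_pmf (\<lambda>y. map of_bool (take m y)) (map_pmf cyc_desc (perms (k + 3))))"
      using segment_indicator_word[OF integer_coloring4_word[OF X] Xm, of "\<lambda>a. a \<in> {1, 2}" t k]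
      unfolding necklace_descents k .
    also have "\<dots> = distr MU (count_space UNIV) (\<lambda>\<omega>. map of_bool (take m (cyc_desc (map (\<lambda>j. U j \<omega>)
      ?js))))"
      using iid_uniform_descents[OF U js(1-3), of "\<lambda>y. map of_bool (take m y) :: nat list"]
        unfolding js(4) by simp
    finally show "distr MX (count_space UNIV) (\<lambda>\<omega>. map (\<lambda>i. of_bool (X (i
      + t) \<omega> \<in> {1, 2}) :: nat) [1..int m])
        = distr MU (count_space UNIV) (\<lambda>\<omega>. map (\<lambda>i. of_bool (U (i + t) \<omega> > U (i + t
          + 1) \<omega>)) [1..int m])"
      unfolding cyc_desc_segment map_map[of of_bool] comp_def .
  next
    fix i
    show "(\<lambda>\<omega>. of_bool (X i \<omega> \<in> {1, 2}) :: nat) \<in> measurable MX (count_space UNIV)"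
      by (rule measurable_indicator[OF Xm])
    show "(\<lambda>\<omega>. of_bool (U i \<omega> > U (i + 1) \<omega>) :: nat) \<in> measurable MU (count_space UNIV)"
      by (rule measurable_indicator[OF U_less])
  qed
  show ?peaks
  proof (rule law_integers_eqI[OF MY MU])
    fix t :: int and m :: nat assume "m \<ge> 2"
    then obtain k where k: "m = k + 1" by (metis add.commute add_leD2 le_Suc_ex one_add_one)
    let ?js = "map (\<lambda>i. i + t) [1..int m + 1] @ [t]"
    have js: "distinct ?js" "set ?js \<subseteq> indices Integers" "?js \<noteq> []" "length ?js = k + 3"
      by (auto simp: distinct_map inj_on_def k nat_add_distrib)
    have "distr MY (count_space UNIV) (\<lambda>\<omega>. map (\<lambda>i. of_bool (Y (i + t) \<omega> = 1) :: nat) [1..int m])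
        = measure_pmf (map_pmf (\<lambda>y. map of_bool (take m y)) (map_pmf cyc_peaks (perms (k + 3))))"
      using segment_indicator_word[OF integer_coloring3_word[OF Y] Ym, of "\<lambda>a. a = 1" t k]
      unfolding necklace_peaks k .
    also have "\<dots> = distr MU (count_space UNIV) (\<lambda>\<omega>. map of_bool (take m (cyc_peaks (map (\<lambda>j. U j
      \<omega>) ?js))))"
      using iid_uniform_peaks[OF U js(1-3), of "\<lambda>y. map of_bool (take m y) :: nat list"]
        unfolding js(4) by simp
    finally show "distr MY (count_space UNIV) (\<lambda>\<omega>. map (\<lambda>i. of_bool (Y (i + t) \<omega>
      = 1) :: nat) [1..int m])
        = distr MU (count_space UNIV) (\<lambda>\<omega>. map (\<lambda>i. of_bool (U (i + t - 1) \<omega> < U (i + t) \<omega> \<and> U (i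
          + t) \<omega> > U (i + t + 1) \<omega>)) [1..int m])"
      unfolding cyc_peaks_segment map_map[of of_bool] comp_def .
  next
    fix i
    show "(\<lambda>\<omega>. of_bool (Y i \<omega> = 1) :: nat) \<in> measurable MY (count_space UNIV)"
      by (rule measurable_indicator[OF Ym])
    have "(\<lambda>\<omega>. U (i - 1) \<omega> < U i \<omega> \<and> U i \<omega> > U (i + 1) \<omega>) \<in> measurable MU (count_space UNIV)"
      by (rule pred_intros_logic) (rule U_less)+
    from measurable_indicator[OF this, of "\<lambda>x. x"]
    show "(\<lambda>\<omega>. of_bool (U (i - 1) \<omega> < U i \<omega> \<and> U i \<omega> > U (i
      + 1) \<omega>) :: nat) \<in> measurable MU (count_space UNIV)" .
  qed
  show ?bits
  proof (rule law_integers_eqI[OF MX MA])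
    fix t :: int and m :: nat assume "m \<ge> 2"
    then obtain k where k: "m = k + 2" by (metis add.commute le_Suc_ex)
    let ?js = "map (\<lambda>i. i + t) [1..int m + 1]"
    have js: "distinct ?js" "set ?js \<subseteq> indices Integers" "?js \<noteq> []" "length ?js = k + 3"
      by (simp_all add: distinct_map inj_on_def k nat_add_distrib)
    have "distr MX (count_space UNIV) (\<lambda>\<omega>. map (\<lambda>i. of_bool (X (i + t) \<omega> = 1) :: nat) [1..int m])
        = measure_pmf (map_pmf (\<lambda>y. map of_bool (take m y)) (map_pmf cyc_desc (bits (k + 3))))"
      using segment_indicator_word[OF integer_coloring4_word[OF X] Xm, of "\<lambda>a. a = 1" t k]
      unfolding necklace_bits k .
    also have "\<dots> = distr MA (count_space UNIV) (\<lambda>\<omega>. map of_bool (take m (cyc_desc (map (\<lambda>j. A j \<omega>)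
      ?js))))"
      using iid_bit_descents[OF A js(1-3), of "\<lambda>y. map of_bool (take m y) :: nat list"]
        unfolding js(4) by simp
    finally show "distr MX (count_space UNIV) (\<lambda>\<omega>. map (\<lambda>i. of_bool (X (i + t) \<omega>
      = 1) :: nat) [1..int m])
        = distr MA (count_space UNIV) (\<lambda>\<omega>. map (\<lambda>i. of_bool (A (i + t) \<omega> > A (i + t
          + 1) \<omega>)) [1..int m])"
      unfolding cyc_desc_segment map_map[of of_bool] comp_def .
  next
    fix i
    show "(\<lambda>\<omega>. of_bool (X i \<omega> = 1) :: nat) \<in> measurable MX (count_space UNIV)"
      by (rule measurable_indicator[OF Xm])
    have "(\<lambda>\<omega>. map (\<lambda>j. A j \<omega>) [i, i + 1]) \<in> measurable MA (count_space UNIV)"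
      by (rule measurable_word) (rule Am)
    from measurable_indicator[OF this, of "\<lambda>l. l ! 0 > l ! 1"]
    show "(\<lambda>\<omega>. of_bool (A i \<omega> > A (i + 1) \<omega>) :: nat) \<in> measurable MA (count_space UNIV)"
      by simp
  qed
qed

theorem theorem2:
  fixes I :: index_set
    and MX :: "'a measure" and X :: "int \<Rightarrow> 'a \<Rightarrow> nat"
    and MY :: "'b measure" and Y :: "int \<Rightarrow> 'b \<Rightarrow> nat"
    and MU :: "'c measure" and U :: "int \<Rightarrow> 'c \<Rightarrow> real"
    and MA :: "'d measure" and A :: "int \<Rightarrow> 'd \<Rightarrow> nat"
  assumes cycle_length: "\<And>n. I = Cycle n \<Longrightarrow> n \<ge> 3"
    and X: "is_coloring I 4 MX X"
    and Y: "is_coloring I 3 MY Y"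
    and U: "iid_process I MU uniform01 U"
    and A: "iid_process I MA fair_bit A"
  shows
    "law I MX (count_space UNIV) (\<lambda>i \<omega>. of_bool (X i \<omega> \<in> {1, 2}) :: nat) =
     law I MU (count_space UNIV) (\<lambda>i \<omega>. of_bool (U i \<omega> > U (idx I (i + 1)) \<omega>))
     \<and>
     law I MY (count_space UNIV) (\<lambda>i \<omega>. of_bool (Y i \<omega> = 1) :: nat) =
     law I MU (count_space UNIV)
       (\<lambda>i \<omega>. of_bool (U (idx I (i - 1)) \<omega> < U i \<omega> \<and> U i \<omega> > U (idx I (i + 1)) \<omega>))
     \<and>
     law I MX (count_space UNIV) (\<lambda>i \<omega>. of_bool (X i \<omega> = 1) :: nat) =
     law I MA (count_space UNIV) (\<lambda>i \<omega>. of_bool (A i \<omega> > A (idx I (i + 1)) \<omega>))"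
proof (cases I)
  case Integers
  then show ?thesis
    using integer_colorings[of MX X MY Y MU U MA A] X Y U A by simp
next
  case (Cycle n)
  then show ?thesis
    using cycle_colorings[of n MX X MY Y MU U MA A] cycle_length[OF Cycle] X Y U A
    by (simp del: idx.simps)
qed

end
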